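(* Let $n\ge 1$ be an integer, $0<\gamma<n$, $1<p<n/\gamma$, $1/q=1/p-\gamma/n$ and $w\in A_{p,q}$. Assume that $p\le\alpha<\beta<s\le\infty$ with $1/\beta=1/\alpha-\gamma/n$, that $\mu\in\Delta_2$ and that $b\in BMO(\mathbb R^n)$. Then the linear commutator $[b,I_\gamma]$ is bounded from $(L^p,L^s)^{\alpha}(w^p,w^q;\mu)$ into $(L^q,L^s)^{\beta}(w^q;\mu)$; that is, there is a constant $C>0$ independent of $f$ such that $\|[b,I_\gamma]f\|_{(L^q,L^s)^{\beta}(w^q;\mu)}\le C\|f\|_{(L^p,L^s)^{\alpha}(w^p,w^q;\mu)}$ for all $f\in(L^p,L^s)^{\alpha}(w^p,w^q;\mu)$.
   Context: A weight is a non-negative locally integrable function on $\mathbb R^n$; for a weight $w$ and measurable $E$, $w(E)=\int_E w(x)\,dx$, and $w^q(E)=\int_E w(x)^q\,dx$. $B(y,r)$ is the open Euclidean ball with center $y$ and radius $r$; $p'=p/(p-1)$. Linear commutator of the fractional integral operator: $[b,I_\gamma]f(x)=\frac{1}{\zeta(\gamma)}\int_{\mathbb R^n}\frac{[b(x)-b(y)]f(y)}{|x-y|^{n-\gamma}}\,dy$, with $\zeta(\gamma)=\frac{\pi^{n/2}2^\gamma\Gamma(\gamma/2)}{\Gamma((n-\gamma)/2)}$. $BMO(\mathbb R^n)$: locally integrable $b$ with $\|b\|_*=\sup_B\frac1{|B|}\int_B|b-b_B|\,dx<\infty$, the supremum over all balls, $b_B$ the mean of $b$ over $B$. For $1<p,q<\infty$,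 $w\in A_{p,q}$ means: there is $C>0$ such that for every ball $B$, $\left(\frac1{|B|}\int_B w^q\,dx\right)^{1/q}\left(\frac1{|B|}\int_B w^{-p'}\,dx\right)^{1/p'}\le C$. $\mu\in\Delta_2$ means that $\mu$ is a weight and there is $C>0$ with $\mu(2B)\le C\mu(B)$ for every ball $B$ ($2B$ is the concentric ball with twice the radius). Weighted amalgam spaces: for $1\le p\le\alpha\le s\le\infty$ and weights $\nu,w,\mu$, the space $(L^p,L^s)^{\alpha}(\nu,w;\mu)$ consists of all locally integrable $f$ with $$\|f\|_{(L^p,L^s)^{\alpha}(\nu,w;\mu)}:=\sup_{r>0}\Big\|w(B(y,r))^{1/\alpha-1/p-1/s}\,\|f\chi_{B(y,r)}\|_{L^p(\nu)}\Big\|_{L^s(\mu)}<\infty,$$ where the $L^s(\mu)$-norm (norm with respect to $\mu(y)\,dy$, usual modification when $s=\infty$) is taken in $y$, and $\|g\|_{L^p(\nu)}=(\int|g|^p\nu\,dx)^{1/p}$. One writes $(L^p,L^s)^{\alpha}(w;\mu):=(L^p,L^s)^{\alpha}(w,w;\mu)$. *)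

theory Defs
  imports "HOL-Analysis.Analysis" "HOL-Probability.Essential_Supremum"
begin

text \<open>
  Functions on R^n are taken up to Lebesgue measurability, so all integrals are with respect to
  \<^const>\<open>lebesgue\<close>. Norms are valued in \<^typ>\<open>ennreal\<close>, where 0 times infinity is 0.
  Functions such as b and f take values in a type of class
  \<open>{real_normed_field,euclidean_space}\<close>, which covers the real and the complex numbers.
\<close>

text \<open>Real powers on \<open>[0,\<infinity>]\<close>: 0 to a negative power is \<open>\<infinity>\<close>, and \<open>\<infinity>\<close> to a negative power is 0.\<close>

definition ennpowr :: "ennreal \<Rightarrow> real \<Rightarrow> ennreal" (infixr "ennpowr" 80) where
  "x ennpowr a =
    (if a = 0 then 1
     else if x = 0 then (if a < 0 then \<infinity> else 0)
     else if x = \<infinity> then (if a < 0 then 0 else \<infinity>)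
     else ennreal (enn2real x powr a))"

definition locally_integrable :: "('a::euclidean_space \<Rightarrow> 'b::euclidean_space) \<Rightarrow> bool" where
  "locally_integrable f \<longleftrightarrow> (\<forall>K. compact K \<longrightarrow> set_integrable lebesgue K f)"

definition weight :: "('a::euclidean_space \<Rightarrow> real) \<Rightarrow> bool" where
  "weight w \<longleftrightarrow> (\<forall>x. 0 \<le> w x) \<and> locally_integrable w"

definition weight_measure :: "('a::euclidean_space \<Rightarrow> real) \<Rightarrow> 'a set \<Rightarrow> ennreal" where
  "weight_measure w E = (\<integral>\<^sup>+x\<in>E. ennreal (w x) \<partial>lebesgue)"

definition conj_exponent :: "real \<Rightarrow> real" where
  "conj_exponent p = p / (p - 1)"

definition enn_avg :: "'a::euclidean_space set \<Rightarrow> ('a \<Rightarrow> ennreal) \<Rightarrow> ennreal" where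
  "enn_avg B g = (\<integral>\<^sup>+x\<in>B. g x \<partial>lebesgue) / emeasure lebesgue B"

text \<open>
  In the class \<open>A\<^sub>p\<^sub>,\<^sub>q\<close>, \<open>w\<^sup>-\<^sup>p\<^sup>'\<close> is \<open>\<infinity>\<close> where w vanishes. The averages are required to be finite. For the
  second one this has to be said explicitly, but it only excludes \<open>w = 0\<close> almost everywhere, for which the
  product would be 0 times infinity; finiteness of the first one then follows from the bound on
  the product.
\<close>

definition Apq :: "real \<Rightarrow> real \<Rightarrow> ('a::euclidean_space \<Rightarrow> real) set" where
  "Apq p q = {w. weight w \<and>
    (\<exists>C>0. \<forall>c. \<forall>r>0.
      enn_avg (ball c r) (\<lambda>x. ennreal (w x) ennpowr (- conj_exponent p)) < \<infinity> \<and>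
      enn_avg (ball c r) (\<lambda>x. ennreal (w x) ennpowr q) ennpowr (1 / q) *
      enn_avg (ball c r) (\<lambda>x. ennreal (w x) ennpowr (- conj_exponent p))
        ennpowr (1 / conj_exponent p) \<le> ennreal C)}"

definition doubling_weights :: "('a::euclidean_space \<Rightarrow> real) set" where
  "doubling_weights = {\<mu>. weight \<mu> \<and>
    (\<exists>C>0. \<forall>c. \<forall>r>0.
      weight_measure \<mu> (ball c (2 * r)) \<le> ennreal C * weight_measure \<mu> (ball c r))}"

definition mean_on :: "'a::euclidean_space set \<Rightarrow> ('a \<Rightarrow> 'b::euclidean_space) \<Rightarrow> 'b" where
  "mean_on B b = (LINT x:B|lebesgue. b x) /\<^sub>R measure lebesgue B"

definition bmo_norm :: "('a::euclidean_space \<Rightarrow> 'b::euclidean_space) \<Rightarrow> ennreal" where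
  "bmo_norm b =
    (SUP c. SUP r\<in>{0<..}. enn_avg (ball c r) (\<lambda>x. ennreal (norm (b x - mean_on (ball c r) b))))"

definition BMO :: "('a::euclidean_space \<Rightarrow> 'b::euclidean_space) set" where
  "BMO = {b. locally_integrable b \<and> bmo_norm b < \<infinity>}"

definition weighted_Lnorm ::
  "ennreal \<Rightarrow> ('a::euclidean_space \<Rightarrow> real) \<Rightarrow> ('a \<Rightarrow> ennreal) \<Rightarrow> ennreal" where
  "weighted_Lnorm s \<nu> g =
    (if s = \<infinity> then esssup (density lebesgue (\<lambda>x. ennreal (\<nu> x))) g
     else (\<integral>\<^sup>+x. g x ennpowr enn2real s * ennreal (\<nu> x) \<partial>lebesgue) ennpowr (1 / enn2real s))"

text \<open>In the exponent below, \<open>enn2real (1 / s)\<close> is 0 for \<open>s = \<infinity>\<close>.\<close>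

definition amalgam_norm ::
  "real \<Rightarrow> ennreal \<Rightarrow> real \<Rightarrow>
   ('a::euclidean_space \<Rightarrow> real) \<Rightarrow> ('a \<Rightarrow> real) \<Rightarrow> ('a \<Rightarrow> real) \<Rightarrow>
   ('a \<Rightarrow> 'b::euclidean_space) \<Rightarrow> ennreal" where
  "amalgam_norm p s \<alpha> \<nu> w \<mu> f =
    (SUP r\<in>{0<..}. weighted_Lnorm s \<mu> (\<lambda>y.
       weight_measure w (ball y r) ennpowr (1 / \<alpha> - 1 / p - enn2real (1 / s)) *
       weighted_Lnorm (ennreal p) \<nu> (\<lambda>x. ennreal (norm (f x)) * indicator (ball y r) x)))"

definition amalgam_space ::
  "real \<Rightarrow> ennreal \<Rightarrow> real \<Rightarrow>
   ('a::euclidean_space \<Rightarrow> real) \<Rightarrow> ('a \<Rightarrow> real) \<Rightarrow> ('a \<Rightarrow> real) \<Rightarrow>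
   ('a \<Rightarrow> 'b::euclidean_space) set" where
  "amalgam_space p s \<alpha> \<nu> w \<mu> = {f. locally_integrable f \<and> amalgam_norm p s \<alpha> \<nu> w \<mu> f < \<infinity>}"

definition frac_const :: "nat \<Rightarrow> real \<Rightarrow> real" where
  "frac_const n \<gamma> =
    pi powr (real n / 2) * 2 powr \<gamma> * Gamma (\<gamma> / 2) / Gamma ((real n - \<gamma>) / 2)"

definition commutator_integrand ::
  "real \<Rightarrow> ('a::euclidean_space \<Rightarrow> 'b::{real_normed_field,euclidean_space}) \<Rightarrow> ('a \<Rightarrow> 'b) \<Rightarrow>
   'a \<Rightarrow> 'a \<Rightarrow> 'b" where
  "commutator_integrand \<gamma> b f x y = ((b x - b y) * f y) /\<^sub>R (norm (x - y) powr (real DIM('a) - \<gamma>))"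

text \<open>
  The commutator \<open>[b, I\<^sub>\<gamma>]\<close>. The integral is total: it is 0 at points x where the integrand
  is not integrable.
\<close>

definition frac_commutator ::
  "real \<Rightarrow> ('a::euclidean_space \<Rightarrow> 'b::{real_normed_field,euclidean_space}) \<Rightarrow> ('a \<Rightarrow> 'b) \<Rightarrow>
   'a \<Rightarrow> 'b" where
  "frac_commutator \<gamma> b f x =
    (\<integral>y. commutator_integrand \<gamma> b f x y \<partial>lebesgue) /\<^sub>R frac_const DIM('a) \<gamma>"

end

theory Submission
  imports Defs
begin

text \<open>
  The kernel of the commutator is replaced by its absolute value, so that only positive operators
  occur. Write \<open>u = w\<^sup>q\<close> and \<open>v = w\<^sup>-\<^sup>p\<^sup>'\<close>. The condition \<open>A\<^sub>p\<^sub>,\<^sub>q\<close> makes both weights satisfy a weak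
  A-infinity condition, which gives doubling, reverse doubling and, by a Calderon-Zygmund stopping
  argument carried out for the weighted measure itself, a weighted John-Nirenberg inequality.
  The Riesz kernel is an average of products of indicators of balls over all centers and dyadic
  radii. Splitting \<open>|b x - b y|\<close> through a constant on each ball and absorbing the oscillation by
  Hoelder's inequality reduces the bilinear form of the operator to a product of averages; because
  \<open>p < q\<close>, Young's inequality and a Hardy-Littlewood-Sobolev type embedding over balls bound it, and
  duality yields the \<open>L\<^sup>p(w\<^sup>p)\<close> to \<open>L\<^sup>q(w\<^sup>q)\<close> estimate.
  For the amalgam norm, f is split at the double ball. The far part is bounded pointwise by a
  sum over dilated balls whose coefficients decay geometrically by reverse doubling, since
  \<open>1/\<beta> > 1/s\<close>, and each dilated ball is controlled by the norm of f at the same center.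
\<close>

section \<open>Powers on the extended nonnegative reals\<close>

text \<open>With \<sigma> = 1/q + 1/p' = 1 - \<gamma>/n and a = 1/(q \<sigma>), the identity u^a
  v^(1-a) = 1 holds pointwise. Hoelder's inequality gives |E| <= u(E)^a v(E)^(1-a) for every set E,
  while A_{p,q} is the reverse inequality on balls up to a constant; together they yield the
  A-infinity condition for both weights. The operator is written against v dx with F = |f| w^p',
  because then F v = |f| and F^p v = |f|^p w^p: the problem becomes L^p(v dx) to L^q(u dx) for a
  kernel without weights, and A_{p,q} enters again only through \<open>ball_bound\<close>. The
  exponents need room. Absorbing the oscillation replaces L^1 averages by L^l and L^m averages with
  1 < l < p and 1 < m < q', and the embedding needs an outer exponent strictly above the inner one.
  An outer pair t, t' with p < t < q has both t > p and t' > q'. For the amalgam norm the estimate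
  is made pointwise in the center y, and the L^s norm in y is taken last.\<close>

lemma ennpowr_0 [simp]: "x ennpowr 0 = 1"
  by (simp add: ennpowr_def)

lemma zero_ennpowr [simp]: "0 < a \<Longrightarrow> 0 ennpowr a = 0"
  by (simp add: ennpowr_def)

lemma one_ennpowr [simp]: "1 ennpowr a = 1"
  by (simp add: ennpowr_def)

lemma ennpowr_1 [simp]: "x ennpowr 1 = x"
  by (auto simp: ennpowr_def less_top)

lemma top_ennpowr [simp]: "0 < a \<Longrightarrow> top ennpowr a = top"
  by (simp add: ennpowr_def)

lemma ennpowr_ennreal: "0 < r \<Longrightarrow> ennreal r ennpowr a = ennreal (r powr a)"
  by (auto simp: ennpowr_def)

lemma ennpowr_ennreal': "0 \<le> r \<Longrightarrow> 0 < a \<Longrightarrow> ennreal r ennpowr a = ennreal (r powr a)"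
  by (cases "r = 0") (auto simp: ennpowr_ennreal)

lemma ennreal_pos_cases [case_names zero top pos]:
  fixes x :: ennreal
  obtains "x = 0" | "x = top" | r where "0 < r" "x = ennreal r"
  by (cases x) (auto, metis ennreal_0 le_less)

lemma ennpowr_eq_0_iff: "0 < a \<Longrightarrow> x ennpowr a = 0 \<longleftrightarrow> x = 0"
  by (cases x rule: ennreal_pos_cases) (auto simp: ennpowr_ennreal)

lemma ennpowr_eq_top_iff: "0 < a \<Longrightarrow> x ennpowr a = top \<longleftrightarrow> x = top"
  by (cases x rule: ennreal_pos_cases) (auto simp: ennpowr_ennreal)

lemma ennpowr_less_top_iff: "0 < a \<Longrightarrow> x ennpowr a < top \<longleftrightarrow> x < top"
  using ennpowr_eq_top_iff[of a x] by (auto simp: less_top)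

text \<open>The sign condition is due to 0 * top = 0: for a < 0 the left side would be top and the
  right side 0 at x = 0, y = top.\<close>

lemma ennpowr_mult:
  assumes "0 \<le> a" shows "(x * y) ennpowr a = x ennpowr a * y ennpowr a"
proof (cases "a = 0")
  case False
  then have "0 < a" using assms by simp
  then show ?thesis
    by (cases x rule: ennreal_pos_cases; cases y rule: ennreal_pos_cases)
       (auto simp: ennpowr_ennreal powr_mult ennreal_mult ennreal_mult_top ennreal_top_mult
             simp flip: ennreal_mult)
qed simp

text \<open>Holds without sign conditions, since a negative exponent exchanges 0 and top and two
  exchanges cancel.\<close>

lemma ennpowr_ennpowr: "(x ennpowr a) ennpowr b = x ennpowr (a * b)"
proof (cases "a = 0 \<or> b = 0")
  case False
  then show ?thesis
    by (cases x rule: ennreal_pos_cases)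
       (auto simp: ennpowr_ennreal powr_powr, auto simp: ennpowr_def zero_less_mult_iff mult_less_0_iff)
qed auto

lemma ennpowr_mono:
  assumes "x \<le> y" "0 \<le> a" shows "x ennpowr a \<le> y ennpowr a"
proof (cases "a = 0")
  case False
  then have "0 < a" using assms by simp
  then show ?thesis using assms
    by (cases x rule: ennreal_pos_cases; cases y rule: ennreal_pos_cases)
       (auto simp: ennpowr_ennreal top_unique intro!: ennreal_leI powr_mono2)
qed simp

text \<open>The crude factor 2^a comes from x + y <= 2 max x y. It covers concave and convex powers
  at once; both exponents q and 1/q occur later.\<close>

lemma ennpowr_add_le:
  assumes "0 \<le> a"
  shows "(x + y) ennpowr a \<le> ennreal (2 powr a) * (x ennpowr a + y ennpowr a)"
proof -
  have "x + y \<le> ennreal 2 * max x y"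
    by (simp add: mult_2 add_mono)
  then have "(x + y) ennpowr a \<le> (ennreal 2 * max x y) ennpowr a"
    using assms by (rule ennpowr_mono)
  also have "\<dots> = ennreal (2 powr a) * (max x y ennpowr a)"
    using assms by (simp add: ennpowr_mult ennpowr_ennreal del: ennreal_numeral)
  also have "\<dots> \<le> ennreal (2 powr a) * (x ennpowr a + y ennpowr a)"
    by (intro mult_left_mono) (auto simp: max_def add_increasing add_increasing2)
  finally show ?thesis .
qed

lemma borel_measurable_ennpowr [measurable (raw)]:
  assumes [measurable]: "f \<in> borel_measurable M"
  shows "(\<lambda>x. f x ennpowr a) \<in> borel_measurable M"
  unfolding ennpowr_def by measurable

section \<open>Young's and Hoelder's inequalities for extended nonnegative functions\<close>

lemma conjugate_exponent_gt_1:
  fixes p p' :: real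
  assumes "1 < p" "1 / p + 1 / p' = 1"
  shows "1 < p'"
proof -
  have "0 < 1 / p" "1 / p < 1" using assms by auto
  then have "0 < 1 / p'" "1 / p' < 1" using assms by linarith+
  then show ?thesis by (simp add: less_divide_eq_1)
qed

lemma ennreal_Young:
  fixes x y :: ennreal
  assumes "1 < p" "1 / p + 1 / p' = 1"
  shows "x * y \<le> x ennpowr p + y ennpowr p'"
proof -
  have p: "0 < p" "1/p < 1" using assms by auto
  then have "0 < 1 / p'" using assms by linarith
  then have p': "0 < p'" by simp
  have 1: "p > 1" "p' > 1"
    using assms conjugate_exponent_gt_1 by auto
  have *: "a * b \<le> a powr p + b powr p'" if "0 < a" "0 < b" for a b
  proof -
    have "a * b \<le> a powr p / p + b powr p' / p'"
      using that assms 1 by (intro Youngs_inequality) auto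
    also have "\<dots> \<le> a powr p + b powr p'"
      using 1 by (intro add_mono) (simp_all add: divide_le_eq mult_le_cancel_left1)
    finally show ?thesis .
  qed
  show ?thesis using p p'
    by (cases x rule: ennreal_pos_cases; cases y rule: ennreal_pos_cases)
       (auto simp: ennpowr_ennreal *  simp flip: ennreal_mult ennreal_plus)
qed

text \<open>Young's inequality applied to f and g divided by their norms. The convention 0 * top = 0
  forces a separate treatment of zero and infinite norms: if one norm is 0 the left side vanishes,
  and otherwise an infinite norm makes the right side infinite.\<close>

lemma Holder_nn_integral:
  fixes f g :: "'a \<Rightarrow> ennreal"
  assumes [measurable]: "f \<in> borel_measurable M" "g \<in> borel_measurable M"
    and "1 < p" "1 / p + 1 / p' = 1"
  shows "(\<integral>\<^sup>+x. f x * g x \<partial>M) \<le>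
    (\<integral>\<^sup>+x. f x ennpowr p \<partial>M) ennpowr (1 / p) * (\<integral>\<^sup>+x. g x ennpowr p' \<partial>M) ennpowr (1 / p')"
proof -
  have p: "0 < p" "1/p < 1" using assms by auto
  then have p1: "0 < 1 / p'" using assms by linarith
  then have p': "0 < p'" by simp
  have 1: "p > 1" "p' > 1"
    using assms conjugate_exponent_gt_1 by auto
  define A where "A = (\<integral>\<^sup>+x. f x ennpowr p \<partial>M)"
  define B where "B = (\<integral>\<^sup>+x. g x ennpowr p' \<partial>M)"
  consider "A = 0 \<or> B = 0" | "A = top" "B \<noteq> 0" | "A \<noteq> 0" "B = top" | a b where "0 < a" "0 < b" "A = ennreal a" "B = ennreal b"
    by (cases A rule: ennreal_pos_cases; cases B rule: ennreal_pos_cases) auto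
  then show ?thesis
  proof cases
    case 1
    then have "AE x in M. f x * g x = 0"
    proof
      assume "A = 0"
      then have "AE x in M. f x ennpowr p = 0"
        unfolding A_def by (subst (asm) nn_integral_0_iff_AE) auto
      then show ?thesis by eventually_elim (use p in \<open>simp add: ennpowr_eq_0_iff\<close>)
    next
      assume "B = 0"
      then have "AE x in M. g x ennpowr p' = 0"
        unfolding B_def by (subst (asm) nn_integral_0_iff_AE) auto
      then show ?thesis by eventually_elim (use p' in \<open>simp add: ennpowr_eq_0_iff\<close>)
    qed
    then have "(\<integral>\<^sup>+x. f x * g x \<partial>M) = 0"
      by (subst nn_integral_0_iff_AE) auto
    then show ?thesis by simp
  next
    case 2
    then have "A ennpowr (1/p) * B ennpowr (1/p') = top"
      using p p1 p' by (auto simp: ennreal_top_mult ennpowr_eq_0_iff)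
    then show ?thesis unfolding A_def B_def by simp
  next
    case 3
    then have "A ennpowr (1/p) * B ennpowr (1/p') = top"
      using p p1 p' by (auto simp: ennreal_mult_top ennpowr_eq_0_iff)
    then show ?thesis unfolding A_def B_def by simp
  next
    case (4 a b)
    \<comment> \<open>The norms of f and g, as positive reals.\<close>
    define s where "s = a powr (1/p)"
    define t where "t = b powr (1/p')"
    have st: "s > 0" "t > 0" using 4 by (auto simp: s_def t_def)
    have sp: "s powr p = a" and tp: "t powr p' = b"
      using 4 p p' by (auto simp: s_def t_def powr_powr)
    \<comment> \<open>The factors 1/p and 1/p' are kept here: after integration they add up to 1,
      which gives the constant 1 in Hoelder's inequality.\<close>
    have pt: "f x * g x \<le> ennreal (s * t) * (ennreal (1 / (p * a)) * f x ennpowr p + ennreal (1 / (p' * b)) * g x ennpowr p')" for x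
    proof -
      have *: "u * v \<le> s * t * (1 / (p * a) * u powr p + 1 / (p' * b) * v powr p')" if "0 < u" "0 < v" for u v
      proof -
        have "(u / s) * (v / t) \<le> (u / s) powr p / p + (v / t) powr p' / p'"
          using that assms 1 \<open>1 < p'\<close> st by (intro Youngs_inequality) auto
        also have "\<dots> = 1 / (p * a) * u powr p + 1 / (p' * b) * v powr p'"
          using that st by (simp add: powr_divide sp tp field_simps)
        finally show ?thesis using st by (simp add: field_simps)
      qed
      consider "f x = 0 \<or> g x = 0" | "f x = top" "g x \<noteq> 0" | "f x \<noteq> 0" "g x = top" | u v where "0 < u" "0 < v" "f x = ennreal u" "g x = ennreal v"
        by (cases "f x" rule: ennreal_pos_cases; cases "g x" rule: ennreal_pos_cases) auto
      then show ?thesis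
      proof cases
        case (4 u v)
        have "ennreal (u * v) \<le> ennreal (s * t * (1 / (p * a) * u powr p + 1 / (p' * b) * v powr p'))"
          by (intro ennreal_leI * 4)
        also have "\<dots> = ennreal (s * t) * (ennreal (1 / (p * a)) * f x ennpowr p + ennreal (1 / (p' * b)) * g x ennpowr p')"
          using 4 st p p' \<open>0 < a\<close> \<open>0 < b\<close>
          by (simp add: ennpowr_ennreal flip: ennreal_mult ennreal_plus)
        finally show ?thesis using 4 by (simp add: ennreal_mult)
      qed (use p p' st \<open>0 < a\<close> \<open>0 < b\<close> in \<open>auto simp: ennreal_mult_top ennreal_top_mult\<close>)
    qed
    have "(\<integral>\<^sup>+x. f x * g x \<partial>M) \<le> (\<integral>\<^sup>+x. ennreal (s * t) * (ennreal (1 / (p * a)) * f x ennpowr p + ennreal (1 / (p' * b)) * g x ennpowr p') \<partial>M)"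
      by (intro nn_integral_mono pt)
    also have "\<dots> = ennreal (s * t) * (ennreal (1 / (p * a)) * A + ennreal (1 / (p' * b)) * B)"
      unfolding A_def B_def by (simp add: nn_integral_add nn_integral_cmult)
    also have "\<dots> = ennreal (s * t) * (ennreal (1 / p) + ennreal (1 / p'))"
      using 4 p p' by (simp flip: ennreal_mult'')
    also have "\<dots> = ennreal (s * t)"
      using assms p p' by (simp flip: ennreal_plus)
    also have "\<dots> = A ennpowr (1/p) * B ennpowr (1/p')"
      using 4 by (simp add: ennpowr_ennreal s_def t_def ennreal_mult)
    finally show ?thesis unfolding A_def B_def .
  qed
qed

section \<open>Measures of A-infinity type\<close>

lemma nn_integral_count_space_int_le:
  fixes f :: "int \<Rightarrow> ennreal"
  assumes "\<And>I. finite I \<Longrightarrow> sum f I \<le> c"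
  shows "(\<integral>\<^sup>+k. f k \<partial>count_space UNIV) \<le> c"
proof -
  have "(\<integral>\<^sup>+k. f k \<partial>count_space UNIV) = (\<integral>\<^sup>+i. f (int_decode i) \<partial>count_space UNIV)"
    by (rule nn_integral_bij_count_space[symmetric]) (rule bij_int_decode)
  also have "\<dots> = (\<Sum>i. f (int_decode i))"
    by (rule nn_integral_count_space_nat)
  also have "\<dots> = (SUP n. \<Sum>i<n. f (int_decode i))"
    by (rule suminf_eq_SUP)
  also have "\<dots> \<le> c"
  proof (rule SUP_least)
    fix n
    have "(\<Sum>i<n. f (int_decode i)) = sum f (int_decode ` {..<n})"
      by (subst sum.reindex) (auto intro: inj_on_subset[OF inj_int_decode])
    also have "\<dots> \<le> c" by (intro assms) auto
    finally show "(\<Sum>i<n. f (int_decode i)) \<le> c" .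
  qed
  finally show ?thesis .
qed

text \<open>Each step upwards multiplies s by at least 1 / \<theta>. From the first index with A <=
  s on, the negative powers are therefore dominated by a geometric series that starts at A powr
  (-a).\<close>

lemma geometric_growth_sum_ge:
  fixes s :: "int \<Rightarrow> real"
  assumes pos: "\<And>k. 0 < s k" and geo: "\<And>k. s k \<le> \<theta> * s (k + 1)"
    and th: "0 < \<theta>" "\<theta> < 1" and a: "0 < a" and A: "0 < A"
  shows "(\<integral>\<^sup>+k. ennreal (s k powr (-a)) * indicator {k. A \<le> s k} k \<partial>count_space UNIV)
    \<le> ennreal (A powr (-a) / (1 - \<theta> powr a))"
proof (rule nn_integral_count_space_int_le)
  fix I :: "int set" assume "finite I"
  define I' where "I' = {k\<in>I. A \<le> s k}"
  have [simp]: "finite I'" using \<open>finite I\<close> by (simp add: I'_def)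
  have th1: "0 < \<theta> powr a" "\<theta> powr a < 1"
    using th a powr_less_mono2[of a \<theta> 1] by auto
  have grow: "s k \<le> \<theta> ^ m * s (k + int m)" for k m
  proof (induction m)
    case (Suc m)
    have "s k \<le> \<theta> ^ m * (\<theta> * s (k + int m + 1))"
      using Suc geo[of "k + int m"] th by (meson mult_left_mono order_trans zero_le_power less_imp_le)
    then show ?case by (simp add: algebra_simps)
  qed simp
  have "(\<Sum>k\<in>I. ennreal (s k powr (-a)) * indicator {k. A \<le> s k} k) = (\<Sum>k\<in>I'. ennreal (s k powr (-a)))"
    unfolding I'_def using \<open>finite I\<close> by (intro sum.mono_neutral_cong_right) (auto simp: indicator_def)
  also have "\<dots> = ennreal (\<Sum>k\<in>I'. s k powr (-a))"
    by (simp add: sum_ennreal)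
  also have "\<dots> \<le> ennreal (A powr (-a) / (1 - \<theta> powr a))"
  proof (cases "I' = {}")
    case False
    \<comment> \<open>The smallest index in I' with A <= s; all others are compared with it through
      \<open>grow\<close>.\<close>
    define k0 where "k0 = Min I'"
    have k0: "k0 \<in> I'" "\<And>k. k \<in> I' \<Longrightarrow> k0 \<le> k" using False by (auto simp: k0_def)
    have "(\<Sum>k\<in>I'. s k powr (-a)) \<le> (\<Sum>k\<in>I'. A powr (-a) * (\<theta> powr a) ^ nat (k - k0))"
    proof (rule sum_mono)
      fix k assume k: "k \<in> I'"
      have "A \<le> s k0" using k0 by (auto simp: I'_def)
      also have "\<dots> \<le> \<theta> ^ nat (k - k0) * s k" using grow[of k0 "nat (k - k0)"] k0(2)[OF k] by simp
      finally have "A / \<theta> ^ nat (k - k0) \<le> s k" using th by (simp add: field_simps)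
      then have "s k powr (-a) \<le> (A / \<theta> ^ nat (k - k0)) powr (-a)"
        using a A th by (intro powr_mono2') auto
      also have "\<dots> = A powr (-a) * (\<theta> powr a) ^ nat (k - k0)"
        using A th by (simp add: powr_divide powr_minus_divide powr_powr mult.commute field_simps flip: powr_realpow)
      finally show "s k powr (-a) \<le> A powr (-a) * (\<theta> powr a) ^ nat (k - k0)" .
    qed
    also have "\<dots> = A powr (-a) * (\<Sum>k\<in>I'. (\<theta> powr a) ^ nat (k - k0))"
      by (simp add: sum_distrib_left)
    also have "(\<Sum>k\<in>I'. (\<theta> powr a) ^ nat (k - k0)) = (\<Sum>j\<in>(\<lambda>k. nat (k - k0)) ` I'. (\<theta> powr a) ^ j)"
      by (subst sum.reindex) (use k0(2) in \<open>force simp: inj_on_def eq_nat_nat_iff\<close>)+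
    also have "\<dots> \<le> (\<Sum>j. (\<theta> powr a) ^ j)"
      using th1 by (intro sum_le_suminf) auto
    also have "\<dots> = 1 / (1 - \<theta> powr a)"
      using th1 by (simp add: suminf_geometric)
    finally show ?thesis using A by (intro ennreal_leI) (simp add: mult_left_mono)
  qed simp
  finally show "(\<Sum>k\<in>I. ennreal (s k powr (-a)) * indicator {k. A \<le> s k} k)
    \<le> ennreal (A powr (-a) / (1 - \<theta> powr a))" .
qed

text \<open>Replacing k by -k and s by 1/s preserves the growth condition and exchanges small with
  large values, so this is the previous lemma for the reflected sequence.\<close>

lemma geometric_growth_sum_le:
  fixes s :: "int \<Rightarrow> real"
  assumes pos: "\<And>k. 0 < s k" and geo: "\<And>k. s k \<le> \<theta> * s (k + 1)"
    and th: "0 < \<theta>" "\<theta> < 1" and a: "0 < a" and A: "0 < A"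
  shows "(\<integral>\<^sup>+k. ennreal (s k powr a) * indicator {k. s k \<le> A} k \<partial>count_space UNIV)
    \<le> ennreal (A powr a / (1 - \<theta> powr a))"
proof -
  have "(\<integral>\<^sup>+k. ennreal (s k powr a) * indicator {k. s k \<le> A} k \<partial>count_space UNIV)
     = (\<integral>\<^sup>+k. ennreal (s (-k) powr a) * indicator {k. s k \<le> A} (-k) \<partial>count_space UNIV)"
    by (rule nn_integral_bij_count_space[symmetric, of uminus]) (rule bij_uminus)
  also have "\<dots> = (\<integral>\<^sup>+k. ennreal ((1 / s (-k)) powr (-a)) * indicator {k. 1 / A \<le> 1 / s (-k)} k \<partial>count_space UNIV)"
    using pos A by (intro nn_integral_cong) (auto simp: powr_divide powr_minus_divide indicator_def frac_le
        simp: field_simps less_imp_le split: if_splits)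
  also have "\<dots> \<le> ennreal ((1 / A) powr (-a) / (1 - \<theta> powr a))"
  proof (rule geometric_growth_sum_ge)
    fix k show "1 / s (- k) \<le> \<theta> * (1 / s (- (k + 1)))"
      using geo[of "-(k+1)"] pos[of "-k"] pos[of "-(k+1)"] by (simp add: field_simps)
  qed (use assms in auto)
  also have "(1 / A) powr (-a) = A powr a"
    using A by (simp add: powr_divide powr_minus_divide)
  finally show ?thesis .
qed

text \<open>Stated for a moving center as well as a moving point: the Tonelli arguments need joint
  measurability in both.\<close>

lemma borel_measurable_indicator_ball [measurable (raw)]:
  fixes f g :: "'c \<Rightarrow> 'a::euclidean_space"
  assumes [measurable]: "f \<in> borel_measurable N" "g \<in> borel_measurable N"
  shows "(\<lambda>p. indicator (ball (f p) r) (g p) :: ennreal) \<in> borel_measurable N"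
proof -
  have "(\<lambda>p. indicator (ball (f p) r) (g p) :: ennreal) = (\<lambda>p. indicator {..<r} (dist (f p) (g p)))"
    by (auto simp: indicator_def)
  then show ?thesis by simp
qed

text \<open>The condition \<open>A_infty\<close> is |E|/|B| <= K (M(E)/M(B))^\<kappa> cleared of
  denominators: a subset of a ball with small relative M-measure has small relative Lebesgue
  measure.\<close>

locale A_infty_measure =
  fixes M :: "'a::euclidean_space measure" and K \<kappa> :: real
  assumes sets_M [measurable_cong, simp]: "sets M = sets borel"
    and K_pos: "0 < K" and \<kappa>_pos: "0 < \<kappa>"
    and ball_finite: "emeasure M (ball z r) < top"
    and ball_pos: "0 < r \<Longrightarrow> 0 < emeasure M (ball z r)"
    and A_infty: "0 < r \<Longrightarrow> E \<in> sets borel \<Longrightarrow> E \<subseteq> ball z r \<Longrightarrow>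
      measure lborel E * measure M (ball z r) powr \<kappa> \<le> K * measure lborel (ball z r) * measure M E powr \<kappa>"
    and abs_cont: "absolutely_continuous lborel M"
begin

lemma space_M [simp]: "space M = UNIV"
  using sets_eq_imp_space_eq[OF sets_M] by simp

lemma emeasure_subset_ball: "E \<in> sets borel \<Longrightarrow> E \<subseteq> ball z r \<Longrightarrow> emeasure M E = ennreal (measure M E)"
  by (intro emeasure_eq_ennreal_measure)
     (metis ball_finite emeasure_mono infinity_ennreal_def leD sets_M borel_open open_ball top.not_eq_extremum)

lemma emeasure_ball_eq: "emeasure M (ball z r) = ennreal (measure M (ball z r))"
  by (rule emeasure_subset_ball) auto

lemma measure_ball_pos: "0 < r \<Longrightarrow> 0 < measure M (ball z r)"
  using ball_pos[of r z] by (simp add: emeasure_ball_eq)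

lemma measure_mono_ball: "E \<in> sets borel \<Longrightarrow> F \<in> sets borel \<Longrightarrow> E \<subseteq> F \<Longrightarrow> F \<subseteq> ball z r \<Longrightarrow> measure M E \<le> measure M F"
  by (metis emeasure_mono emeasure_subset_ball ennreal_le_iff measure_nonneg order_trans sets_M)

lemma measure_ball_mono: "ball y t \<subseteq> ball z r \<Longrightarrow> measure M (ball y t) \<le> measure M (ball z r)"
  by (rule measure_mono_ball[where z=z and r=r]) auto

lemma sigma_finite_M: "sigma_finite_measure M"
proof
  show "\<exists>A. countable A \<and> A \<subseteq> sets M \<and> \<Union> A = space M \<and> (\<forall>a\<in>A. emeasure M a \<noteq> \<infinity>)"
  proof (intro exI[of _ "range (\<lambda>n::nat. ball 0 (real n))"] conjI ballI)
    show "\<Union> (range (\<lambda>n::nat. ball (0::'a) (real n))) = space M"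
      by (auto intro: reals_Archimedean2)
  qed (auto simp: emeasure_ball_eq)
qed

section \<open>Doubling, reverse doubling and sets of large relative measure\<close>

lemma doubling:
  obtains D where "1 \<le> D" "\<And>z r. 0 < r \<Longrightarrow> measure M (ball z (2 * r)) \<le> D * measure M (ball z r)"
proof
  \<comment> \<open>The A-infinity condition for E = \<open>ball z r\<close> inside the double ball,
    where the Lebesgue measures differ by the factor 2^n, solved for the M-measure of the double
    ball.\<close>
  define D where "D = (K * 2 ^ DIM('a)) powr (1 / \<kappa>)"
  show *: "measure M (ball z (2 * r)) \<le> max 1 D * measure M (ball z r)" if r: "0 < r" for z :: 'a and r
  proof -
    define V where "V = unit_ball_vol (real DIM('a)) * r ^ DIM('a)"
    have V: "V > 0" using r by (simp add: V_def)
    have "measure lborel (ball z r) * measure M (ball z (2 * r)) powr \<kappa>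
      \<le> K * measure lborel (ball z (2*r)) * measure M (ball z r) powr \<kappa>"
      using r by (intro A_infty) auto
    then have "V * measure M (ball z (2 * r)) powr \<kappa> \<le> V * (K * 2 ^ DIM('a) * measure M (ball z r) powr \<kappa>)"
      using r by (simp add: content_ball V_def power_mult_distrib algebra_simps)
    then have "measure M (ball z (2 * r)) powr \<kappa> \<le> K * 2 ^ DIM('a) * measure M (ball z r) powr \<kappa>"
      using V by simp
    then have "(measure M (ball z (2 * r)) powr \<kappa>) powr (1 / \<kappa>) \<le> (K * 2 ^ DIM('a) * measure M (ball z r) powr \<kappa>) powr (1/\<kappa>)"
      using \<kappa>_pos by (intro powr_mono2) auto
    then have "measure M (ball z (2 * r)) \<le> D * measure M (ball z r)"
      using \<kappa>_pos K_pos by (simp add: powr_mult powr_powr D_def)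
    then show ?thesis
      by (smt (verit) mult_right_mono measure_nonneg)
  qed
qed simp

text \<open>Named after its use on complements: a set that leaves a fixed Lebesgue fraction of a
  ball uncovered also leaves a fixed M-fraction uncovered.\<close>

lemma complement_bound:
  assumes "0 < c"
  obtains \<eta> where "0 < \<eta>" "\<And>(z::'a) r E. 0 < r \<Longrightarrow> E \<in> sets borel \<Longrightarrow> E \<subseteq> ball z r \<Longrightarrow>
    c * measure lborel (ball z r) \<le> measure lborel E \<Longrightarrow> \<eta> * measure M (ball z r) \<le> measure M E"
proof
  show "0 < (c / K) powr (1 / \<kappa>)" using assms K_pos by simp
  fix z :: 'a and r E assume r: "0 < r" and E: "E \<in> sets borel" "E \<subseteq> ball z r" and c: "c * measure lborel (ball z r) \<le> measure lborel E"
  define V where "V = measure lborel (ball z r)"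
  have V: "V > 0" using r by (simp add: V_def content_ball)
  have "V * (c * measure M (ball z r) powr \<kappa>) \<le> measure lborel E * measure M (ball z r) powr \<kappa>"
    using c mult_right_mono[OF c, of "measure M (ball z r) powr \<kappa>"] by (simp add: V_def algebra_simps)
  also have "\<dots> \<le> V * (K * measure M E powr \<kappa>)"
    using A_infty[OF r E] by (simp add: V_def algebra_simps)
  finally have "c * measure M (ball z r) powr \<kappa> \<le> K * measure M E powr \<kappa>"
    using V by simp
  then have "c / K * measure M (ball z r) powr \<kappa> \<le> measure M E powr \<kappa>"
    using K_pos by (simp add: field_simps)
  then have "(c / K * measure M (ball z r) powr \<kappa>) powr (1/\<kappa>) \<le> (measure M E powr \<kappa>) powr (1/\<kappa>)"
    using \<kappa>_pos K_pos assms by (intro powr_mono2) auto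
  then show "(c / K) powr (1 / \<kappa>) * measure M (ball z r) \<le> measure M E"
    using \<kappa>_pos K_pos assms by (simp add: powr_mult powr_powr powr_divide)
qed

text \<open>The shell between the two balls fills at least half of the larger one in Lebesgue
  measure because 2^n >= 2, so it carries a fixed fraction of its M-measure.\<close>

lemma reverse_doubling:
  obtains \<theta> where "0 < \<theta>" "\<theta> < 1" "\<And>z r. 0 < r \<Longrightarrow> measure M (ball z r) \<le> \<theta> * measure M (ball z (2 * r))"
proof -
  have "0 < (1/2::real)" by simp
  from complement_bound[OF this] obtain \<eta> where \<eta>: "0 < \<eta>" "\<And>(z::'a) r E. 0 < r \<Longrightarrow> E \<in> sets borel \<Longrightarrow> E \<subseteq> ball z r \<Longrightarrow>
    1/2 * measure lborel (ball z r) \<le> measure lborel E \<Longrightarrow> \<eta> * measure M (ball z r) \<le> measure M E"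
    by blast
  have *: "measure M (ball z r) \<le> (1 - \<eta>) * measure M (ball z (2 * r))" if r: "0 < r" for z :: 'a and r
  proof -
    define E where "E = ball z (2 * r) - ball z r"
    have sub: "ball z r \<subseteq> ball z (2 * r)" using r by auto
    have "(2::real) * 1 \<le> 2 ^ DIM('a)" using power_increasing[of 1 "DIM('a)" "2::real"] by simp
    then have le: "(2::real) \<le> 2 ^ DIM('a)" by simp
    have "measure lborel E = measure lborel (ball z (2 * r)) - measure lborel (ball z r)"
      unfolding E_def using sub using emeasure_lborel_ball_finite[of z "2 * r"] by (intro measure_Diff) auto
    also have "\<dots> \<ge> 1/2 * measure lborel (ball z (2 * r))"
    proof -
      define V where "V = unit_ball_vol (real DIM('a)) * r ^ DIM('a)"
      have "measure lborel (ball z (2 * r)) = V * 2 ^ DIM('a)" "measure lborel (ball z r) = V"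
        using r by (simp_all add: content_ball V_def power_mult_distrib)
      moreover have "V * 2 \<le> V * 2 ^ DIM('a)"
        using le r by (intro mult_left_mono) (auto simp: V_def)
      ultimately show ?thesis by linarith
    qed
    finally have "\<eta> * measure M (ball z (2 * r)) \<le> measure M E"
      using r by (intro \<eta>(2)) (auto simp: E_def)
    also have "measure M E = measure M (ball z (2 * r)) - measure M (ball z r)"
      unfolding E_def using sub by (intro measure_Diff) (auto simp: emeasure_ball_eq)
    finally show ?thesis by (simp add: algebra_simps)
  qed
  \<comment> \<open>Both balls have positive M-measure, so the factor in the inequality just shown
    cannot be nonpositive.\<close>
  have "0 < 1 - \<eta>"
    using *[of 1 0] measure_ball_pos[of 1 0] measure_ball_pos[of 2 0] by (simp add: zero_less_mult_iff) (smt (verit) zero_less_mult_iff mult_nonpos_nonneg)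
  then show ?thesis using * \<eta>(1) by (intro that[of "1 - \<eta>"]) auto
qed

lemma borel_measurable_integral_ball [measurable]:
  assumes [measurable]: "F \<in> borel_measurable borel"
  shows "(\<lambda>z. \<integral>\<^sup>+x. F x * indicator (ball z r) x \<partial>M) \<in> borel_measurable borel"
proof -
  interpret sigma_finite_measure M by (rule sigma_finite_M)
  show ?thesis by measurable
qed

lemma borel_measurable_emeasure_ball [measurable]: "(\<lambda>z. emeasure M (ball z r)) \<in> borel_measurable borel"
  using borel_measurable_integral_ball[of "\<lambda>_. 1" r] by simp

lemma borel_measurable_measure_ball [measurable]: "(\<lambda>z. measure M (ball z r)) \<in> borel_measurable borel"
  unfolding measure_def by measurable

end

section \<open>Dyadic cells\<close>

text \<open>The half-open cube of side h / 2^k around x in the grid with origin a. As a class of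
  points with equal floors it makes nesting and disjointness facts about an equivalence relation.
  Origin and side are free so that each ball can be given its own grid.\<close>

definition dyadic_cell :: "'a::euclidean_space \<Rightarrow> real \<Rightarrow> nat \<Rightarrow> 'a \<Rightarrow> 'a set" where
  "dyadic_cell a h k x = {y. \<forall>i\<in>Basis. \<lfloor>2 ^ k * ((y - a) \<bullet> i) / h\<rfloor> = \<lfloor>2 ^ k * ((x - a) \<bullet> i) / h\<rfloor>}"

definition cell_corner :: "'a::euclidean_space \<Rightarrow> real \<Rightarrow> nat \<Rightarrow> 'a \<Rightarrow> 'a" where
  "cell_corner a h k x = a + (\<Sum>i\<in>Basis. (h / 2 ^ k * of_int \<lfloor>2 ^ k * ((x - a) \<bullet> i) / h\<rfloor>) *\<^sub>R i)"

lemma cell_self: "x \<in> dyadic_cell a h k x"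
  by (simp add: dyadic_cell_def)

lemma cell_eq: "y \<in> dyadic_cell a h k x \<Longrightarrow> dyadic_cell a h k y = dyadic_cell a h k x"
  by (auto simp: dyadic_cell_def)

lemma cell_Suc_subset: "dyadic_cell a h (Suc k) x \<subseteq> dyadic_cell a h k x"
proof
  fix y assume y: "y \<in> dyadic_cell a h (Suc k) x"
  \<comment> \<open>The coarser floor is a function of the finer one, so points in the same fine
    cell share the coarse cell.\<close>
  have *: "\<lfloor>2 ^ k * t / h\<rfloor> = \<lfloor>2 ^ Suc k * t / h\<rfloor> div 2" for t :: real
    using floor_divide_real_eq_div[of 2 "2 ^ Suc k * t / h"] by simp
  show "y \<in> dyadic_cell a h k x"
    using y unfolding dyadic_cell_def by (auto simp: *)
qed

lemma cell_antimono: "j \<le> k \<Longrightarrow> dyadic_cell a h k x \<subseteq> dyadic_cell a h j x"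
  by (rule lift_Suc_antimono_le[of "\<lambda>k. dyadic_cell a h k x"]) (rule cell_Suc_subset)

lemma cell_nested: "j \<le> k \<Longrightarrow> y \<in> dyadic_cell a h j x \<Longrightarrow> dyadic_cell a h k y \<subseteq> dyadic_cell a h j x"
  using cell_antimono cell_eq by metis

lemma mem_cell_iff:
  assumes "0 < h"
  shows "y \<in> dyadic_cell a h k x \<longleftrightarrow>
    (\<forall>i\<in>Basis. cell_corner a h k x \<bullet> i \<le> y \<bullet> i \<and> y \<bullet> i < cell_corner a h k x \<bullet> i + h / 2 ^ k)"
proof -
  have "\<lfloor>2 ^ k * ((y - a) \<bullet> i) / h\<rfloor> = m \<longleftrightarrow> a \<bullet> i + h / 2 ^ k * of_int m \<le> y \<bullet> i \<and> y \<bullet> i < a \<bullet> i + h / 2 ^ k * of_int m + h / 2 ^ k"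
    for i m using assms
    by (simp add: floor_eq_iff inner_diff_left field_simps)
  then show ?thesis
    by (simp add: dyadic_cell_def cell_corner_def inner_add_left)
qed

lemma cell_borel [measurable]: "0 < h \<Longrightarrow> dyadic_cell a h k x \<in> sets borel"
proof -
  assume "0 < h"
  then have "dyadic_cell a h k x = {y. \<forall>i\<in>Basis. cell_corner a h k x \<bullet> i \<le> y \<bullet> i \<and> y \<bullet> i < cell_corner a h k x \<bullet> i + h / 2 ^ k}"
    by (auto simp: mem_cell_iff)
  also have "\<dots> \<in> sets borel" by measurable
  finally show ?thesis .
qed

lemma emeasure_cell:
  fixes a :: "'a::euclidean_space"
  assumes "0 < h" shows "emeasure lborel (dyadic_cell a h k x) = ennreal ((h / 2 ^ k) ^ DIM('a))"
proof (rule antisym)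
  define c where "c = cell_corner a h k x"
  define d where "d = c + (h / 2 ^ k) *\<^sub>R One"
  have cd: "d \<bullet> i = c \<bullet> i + h / 2 ^ k" if "i \<in> Basis" for i
    using that by (simp add: d_def inner_add_left)
  have "box c d \<subseteq> dyadic_cell a h k x" "dyadic_cell a h k x \<subseteq> cbox c d"
    using assms by (auto simp: mem_cell_iff mem_box cd c_def[symmetric] less_imp_le)
  then have "emeasure lborel (box c d) \<le> emeasure lborel (dyadic_cell a h k x)"
    "emeasure lborel (dyadic_cell a h k x) \<le> emeasure lborel (cbox c d)"
    using assms by (auto intro!: emeasure_mono)
  moreover have "emeasure lborel (box c d) = ennreal ((h / 2 ^ k) ^ DIM('a))"
    using assms by (subst emeasure_lborel_box) (auto simp: cd inner_diff_left)
  moreover have "emeasure lborel (cbox c d) = ennreal ((h / 2 ^ k) ^ DIM('a))"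
    using assms by (subst emeasure_lborel_cbox) (auto simp: cd inner_diff_left)
  ultimately show "emeasure lborel (dyadic_cell a h k x) \<le> ennreal ((h / 2 ^ k) ^ DIM('a))"
    "ennreal ((h / 2 ^ k) ^ DIM('a)) \<le> emeasure lborel (dyadic_cell a h k x)" by simp_all
qed

lemma measure_cell:
  fixes a :: "'a::euclidean_space"
  assumes "0 < h" shows "measure lborel (dyadic_cell a h k x) = (h / 2 ^ k) ^ DIM('a)"
  using emeasure_cell[OF assms, of a k x] assms by (simp add: measure_def)

lemma emeasure_cell_Suc:
  fixes a :: "'a::euclidean_space"
  assumes "0 < h"
  shows "emeasure lborel (dyadic_cell a h k x) = ennreal (2 ^ DIM('a)) * emeasure lborel (dyadic_cell a h (Suc k) x)"
  using assms by (simp add: emeasure_cell power_divide power_mult_distrib flip: ennreal_mult)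

text \<open>The factor \<open>DIM('a)\<close> comes from bounding the Euclidean norm by the l1 norm;
  every ball attached to a cell inherits it.\<close>

lemma dist_cell_less:
  fixes a :: "'a::euclidean_space"
  assumes "0 < h" "y \<in> dyadic_cell a h k x" "z \<in> dyadic_cell a h k x"
  shows "dist y z < real DIM('a) * (h / 2 ^ k)"
proof -
  have "dist y z \<le> (\<Sum>i\<in>Basis. \<bar>(y - z) \<bullet> i\<bar>)"
    by (simp add: dist_norm norm_le_l1)
  also have "\<dots> < (\<Sum>i\<in>(Basis::'a set). h / 2 ^ k)"
    using assms by (intro sum_strict_mono) (auto simp: mem_cell_iff inner_diff_left abs_less_iff, (smt (verit))+)
  finally show ?thesis by simp
qed

lemma cell_corner_in_cell: "0 < h \<Longrightarrow> cell_corner a h k x \<in> dyadic_cell a h k x"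
  by (simp add: mem_cell_iff)

lemma cell_subset_ball:
  fixes a :: "'a::euclidean_space"
  assumes "0 < h"
  shows "dyadic_cell a h k x \<subseteq> ball (cell_corner a h k x) (real DIM('a) * (h / 2 ^ k))"
  using dist_cell_less[OF assms cell_corner_in_cell[OF assms]] by auto

lemma countable_cells: "countable (range (dyadic_cell a h k))"
proof -
  define G where "G m = {y. \<forall>i\<in>Basis. \<lfloor>2 ^ k * ((y - a) \<bullet> i) / h\<rfloor> = m i}" for m :: "'a \<Rightarrow> int"
  have "range (dyadic_cell a h k) \<subseteq> G ` (PiE Basis (\<lambda>_. UNIV))"
  proof clarify
    fix x
    have "dyadic_cell a h k x = G (restrict (\<lambda>i. \<lfloor>2 ^ k * ((x - a) \<bullet> i) / h\<rfloor>) Basis)"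
      by (auto simp: dyadic_cell_def G_def)
    then show "dyadic_cell a h k x \<in> G ` (PiE Basis (\<lambda>_. UNIV))" by auto
  qed
  moreover have "countable (PiE (Basis::'a set) (\<lambda>_. UNIV::int set))"
    by (rule countable_PiE) auto
  ultimately show ?thesis by (meson countable_image countable_subset)
qed

text \<open>Stopping time selection in general form: a point is assigned its cell at the first level
  where P holds, and these cells partition the set where P ever holds. It is used with cells inside
  an open set and with cells of large average.\<close>

lemma maximal_cells:
  fixes P :: "nat \<Rightarrow> 'a::euclidean_space \<Rightarrow> bool"
  assumes P: "\<And>k x y. P k x \<Longrightarrow> y \<in> dyadic_cell a h k x \<Longrightarrow> P k y"
  obtains \<Q> where "countable \<Q>" "disjoint \<Q>" "\<Union>\<Q> = {x. \<exists>k. P k x}"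
    "\<And>R. R \<in> \<Q> \<Longrightarrow> \<exists>k x. R = dyadic_cell a h k x \<and> P k x \<and> (\<forall>j<k. \<not> P j x)"
proof
  define \<Q> where "\<Q> = {R. \<exists>k x. R = dyadic_cell a h k x \<and> P k x \<and> (\<forall>j<k. \<not> P j x)}"
  show "R \<in> \<Q> \<Longrightarrow> \<exists>k x. R = dyadic_cell a h k x \<and> P k x \<and> (\<forall>j<k. \<not> P j x)" for R
    by (simp add: \<Q>_def)
  have "\<Q> \<subseteq> (\<Union>k. range (dyadic_cell a h k))" by (auto simp: \<Q>_def)
  then show "countable \<Q>" by (rule countable_subset) (auto intro!: countable_cells)
  \<comment> \<open>If two selected cells meet, the one of the larger level l lies inside the other.
    Then P holds for it at level k already, and minimality of l forces k = l.\<close>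
  have *: "dyadic_cell a h k x = dyadic_cell a h l y"
    if "k \<le> l" and z: "z \<in> dyadic_cell a h k x" "z \<in> dyadic_cell a h l y"
      and k: "P k x" and l: "\<forall>j<l. \<not> P j y" for k l x y z
  proof -
    have "y \<in> dyadic_cell a h l z" using z by (metis cell_eq cell_self)
    then have y: "y \<in> dyadic_cell a h k z" using cell_antimono[OF \<open>k \<le> l\<close>] by auto
    moreover have "P k z" using k z(1) by (rule P)
    ultimately have "P k y" by (blast intro: P)
    with l \<open>k \<le> l\<close> have "k = l" by (meson le_neq_implies_less)
    then show ?thesis using z by (metis cell_eq)
  qed
  show "disjoint \<Q>"
  proof (rule disjointI)
    fix R R' assume "R \<in> \<Q>" "R' \<in> \<Q>" "R \<noteq> R'"
    then obtain k x l y where R: "R = dyadic_cell a h k x" "P k x" "\<forall>j<k. \<not> P j x"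
      "R' = dyadic_cell a h l y" "P l y" "\<forall>j<l. \<not> P j y" unfolding \<Q>_def by blast
    show "R \<inter> R' = {}"
    proof (rule ccontr)
      assume "R \<inter> R' \<noteq> {}"
      then obtain z where z: "z \<in> R" "z \<in> R'" by auto
      consider "k \<le> l" | "l \<le> k" by linarith
      then have "R = R'"
      proof cases
        case 1
        then show ?thesis using *[OF 1, of z x y] R z by simp
      next
        case 2
        then show ?thesis using *[OF 2, of z y x] R z by simp
      qed
      with \<open>R \<noteq> R'\<close> show False ..
    qed
  qed
  show "\<Union>\<Q> = {x. \<exists>k. P k x}"
  proof (intro equalityI subsetI)
    fix x assume "x \<in> {x. \<exists>k. P k x}"
    then obtain k where "P k x" by auto
    then have "P (LEAST k. P k x) x" by (rule LeastI)
    moreover have "\<forall>j<(LEAST k. P k x). \<not> P j x" using not_less_Least by blast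
    ultimately have "dyadic_cell a h (LEAST k. P k x) x \<in> \<Q>" unfolding \<Q>_def by blast
    then show "x \<in> \<Union>\<Q>" using cell_self by blast
  next
    fix x assume "x \<in> \<Union>\<Q>"
    then show "x \<in> {x. \<exists>k. P k x}" unfolding \<Q>_def using P by blast
  qed
qed

lemma emeasure_disjoint_Union:
  assumes "countable \<Q>" "disjoint \<Q>" "\<And>R. R \<in> \<Q> \<Longrightarrow> R \<in> sets M" "E \<in> sets M"
  shows "emeasure M (E \<inter> \<Union>\<Q>) = (\<integral>\<^sup>+R. emeasure M (E \<inter> R) \<partial>count_space \<Q>)"
proof -
  have "E \<inter> \<Union>\<Q> = (\<Union>R\<in>\<Q>. E \<inter> R)" by auto
  also have "emeasure M \<dots> = (\<integral>\<^sup>+R. emeasure M (E \<inter> R) \<partial>count_space \<Q>)"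
    using assms by (intro emeasure_UN_countable) (auto simp: disjoint_family_on_def disjoint_def)
  finally show ?thesis .
qed

text \<open>A one-sided substitute for Lebesgue's differentiation theorem.\<close>

lemma cell_averages_bound:
  fixes g :: "'a::euclidean_space \<Rightarrow> real"
  assumes h: "0 < h" and [measurable]: "g \<in> borel_measurable borel" "S \<in> sets borel"
    and bdd: "emeasure lborel S < top" and "0 \<le> A"
    and avg: "\<And>x k. x \<in> S \<Longrightarrow> j < k \<Longrightarrow>
      (\<integral>\<^sup>+y\<in>dyadic_cell a h k x. ennreal (g y) \<partial>lborel) \<le> ennreal A * emeasure lborel (dyadic_cell a h k x)"
  shows "AE x in lborel. x \<in> S \<longrightarrow> g x \<le> A"
proof -
  have null: "emeasure lborel {x\<in>S. A + \<delta> \<le> g x} = 0" if "0 < \<delta>" for \<delta>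
  proof (rule ccontr)
    define E where "E = {x\<in>S. A + \<delta> \<le> g x}"
    assume "emeasure lborel {x\<in>S. A + \<delta> \<le> g x} \<noteq> 0"
    moreover have [measurable]: "E \<in> sets borel" by (simp add: E_def)
    have "emeasure lborel E \<le> emeasure lborel S" by (intro emeasure_mono) (auto simp: E_def)
    then have "emeasure lborel E < top" using bdd by order
    ultimately obtain e where e: "0 < e" "emeasure lborel E = ennreal e"
      unfolding E_def[symmetric] by (cases "emeasure lborel E" rule: ennreal_pos_cases) auto
    \<comment> \<open>Makes A * \<eta> < \<delta> * e in the end; the summand 1 covers A =
      0.\<close>
    define \<eta> where "\<eta> = \<delta> * e / (2 * (A + 1))"
    have \<eta>: "0 < \<eta>" using that e \<open>0 \<le> A\<close> by (simp add: \<eta>_def)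
    obtain U where U: "open U" "E \<subseteq> U" "emeasure lborel (U - E) < ennreal \<eta>"
      using outer_regular_lborel[of E \<eta>] \<eta> by auto
    \<comment> \<open>Averages are controlled only at levels finer than j; since U is open, each of
      its points still has such a cell inside U.\<close>
    define P where "P k x \<longleftrightarrow> j < k \<and> dyadic_cell a h k x \<subseteq> U" for k x
    have P_cong: "P k y" if "P k x" "y \<in> dyadic_cell a h k x" for k x y
      using that cell_eq[of y a h k x] by (simp add: P_def)
    obtain \<Q> where \<Q>: "countable \<Q>" "disjoint \<Q>" "\<Union>\<Q> = {x. \<exists>k. P k x}"
      "\<And>R. R \<in> \<Q> \<Longrightarrow> \<exists>k x. R = dyadic_cell a h k x \<and> P k x \<and> (\<forall>j<k. \<not> P j x)"
      using maximal_cells[of P a h] P_cong by blast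
    have U_eq: "\<Union>\<Q> = U"
    proof (intro equalityI subsetI)
      fix x assume "x \<in> U"
      then obtain \<epsilon> where \<epsilon>: "0 < \<epsilon>" "ball x \<epsilon> \<subseteq> U" using U(1) openE by blast
      have "(\<lambda>k. real DIM('a) * (h / 2 ^ k)) \<longlonglongrightarrow> real DIM('a) * 0"
        by (intro tendsto_intros LIMSEQ_divide_realpow_zero) auto
      then have "eventually (\<lambda>k. real DIM('a) * (h / 2 ^ k) < \<epsilon>) sequentially"
        using \<epsilon> by (auto dest: order_tendstoD)
      then have "eventually (\<lambda>k. real DIM('a) * (h / 2 ^ k) < \<epsilon> \<and> j < k) sequentially"
        by (intro eventually_conj eventually_gt_at_top)
      then obtain k where k: "real DIM('a) * (h / 2 ^ k) < \<epsilon>" "j < k"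
        by (auto simp: eventually_sequentially)
      have "dyadic_cell a h k x \<subseteq> ball x \<epsilon>"
        using dist_cell_less[OF h cell_self, of _ a k x] k(1) by force
      then have "P k x" using \<epsilon> k by (auto simp: P_def)
      then show "x \<in> \<Union>\<Q>" using \<Q>(3) by auto
    qed (auto simp: \<Q>(3) P_def dest: subsetD[OF _ cell_self])
    have Q_borel: "R \<in> sets borel" if "R \<in> \<Q>" for R using \<Q>(4)[OF that] h by auto
    define \<nu> where "\<nu> = density lborel (\<lambda>x. ennreal (g x))"
    have [simp]: "sets \<nu> = sets borel" by (simp add: \<nu>_def)
    have \<nu>: "emeasure \<nu> X = (\<integral>\<^sup>+y\<in>X. ennreal (g y) \<partial>lborel)" if "X \<in> sets borel" for X
      using that by (simp add: \<nu>_def emeasure_density)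
    have "ennreal (A + \<delta>) * emeasure lborel E = (\<integral>\<^sup>+y\<in>E. ennreal (A + \<delta>) \<partial>lborel)"
      by (simp add: nn_integral_cmult_indicator)
    also have "\<dots> \<le> (\<integral>\<^sup>+y\<in>E. ennreal (g y) \<partial>lborel)"
      by (intro nn_integral_mono) (auto simp: E_def indicator_def intro!: ennreal_leI)
    also have "\<dots> = emeasure \<nu> (E \<inter> \<Union>\<Q>)" using U by (subst \<nu>) (auto simp: U_eq Int_absorb2)
    also have "\<dots> = (\<integral>\<^sup>+R. emeasure \<nu> (E \<inter> R) \<partial>count_space \<Q>)"
      using \<Q>(1,2) Q_borel by (intro emeasure_disjoint_Union) auto
    also have "\<dots> \<le> (\<integral>\<^sup>+R. ennreal A * emeasure lborel R \<partial>count_space \<Q>)"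
    proof (intro nn_integral_mono)
      fix R assume "R \<in> space (count_space \<Q>)"
      then have R: "R \<in> \<Q>" by simp
      show "emeasure \<nu> (E \<inter> R) \<le> ennreal A * emeasure lborel R"
      proof (cases "E \<inter> R = {}")
        case False
        \<comment> \<open>A selected cell that meets E is the cell of a point of S, so its average
          is at most A; cells that miss E contribute nothing.\<close>
        then obtain x where x: "x \<in> E" "x \<in> R" by auto
        obtain k y where R': "R = dyadic_cell a h k y" "j < k" using \<Q>(4)[OF R] by (auto simp: P_def)
        then have Rx: "R = dyadic_cell a h k x" using x cell_eq by blast
        have "emeasure \<nu> (E \<inter> R) \<le> emeasure \<nu> R" using Q_borel[OF R] by (intro emeasure_mono) auto
        also have "\<dots> \<le> ennreal A * emeasure lborel R"
          using avg[of x k] x R' Q_borel[OF R] by (simp add: \<nu> Rx[symmetric] E_def)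
        finally show ?thesis .
      qed simp
    qed
    also have "\<dots> = ennreal A * emeasure lborel (UNIV \<inter> \<Union>\<Q>)"
      using \<Q>(1,2) Q_borel by (subst emeasure_disjoint_Union) (auto simp: nn_integral_cmult)
    also have "\<dots> = ennreal A * emeasure lborel (E \<union> (U - E))" using U by (simp add: U_eq Un_absorb1)
    also have "\<dots> = ennreal A * (emeasure lborel E + emeasure lborel (U - E))"
      using U by (subst plus_emeasure[symmetric]) auto
    also have "\<dots> \<le> ennreal A * (ennreal e + ennreal \<eta>)"
      using U e by (intro mult_left_mono add_mono) auto
    also have "\<dots> = ennreal (A * (e + \<eta>))" using e \<eta> \<open>0 \<le> A\<close> by (simp add: ennreal_mult)
    finally have "ennreal ((A + \<delta>) * e) \<le> ennreal (A * (e + \<eta>))"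
      using e that \<open>0 \<le> A\<close> by (simp add: ennreal_mult)
    then have "(A + \<delta>) * e \<le> A * (e + \<eta>)"
      using e \<eta> \<open>0 \<le> A\<close> by (subst (asm) ennreal_le_iff) auto
    then have "\<delta> * e \<le> A * \<eta>" by (simp add: algebra_simps)
    also have "\<dots> < \<delta> * e" using that e \<open>0 \<le> A\<close>
    proof -
      have "A * \<eta> = \<delta> * e * (A / (2 * (A + 1)))" by (simp add: \<eta>_def)
      also have "\<dots> < \<delta> * e * 1"
        using that e \<open>0 \<le> A\<close> by (intro mult_strict_left_mono) (auto simp: field_simps)
      finally show ?thesis by simp
    qed
    finally show False by simp
  qed
  have "AE x in lborel. \<forall>m::nat. \<not> (x \<in> S \<and> A + 1 / real (Suc m) \<le> g x)"
    unfolding AE_all_countable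
  proof
    fix m :: nat
    show "AE x in lborel. \<not> (x \<in> S \<and> A + 1 / real (Suc m) \<le> g x)"
      using null[of "1 / real (Suc m)"] by (subst AE_iff_measurable[OF _ refl]) (auto simp: conj_commute)
  qed
  then show ?thesis
  proof eventually_elim
    case (elim x)
    show ?case
    proof (intro impI, rule ccontr)
      assume x: "x \<in> S" "\<not> g x \<le> A"
      then obtain m where "1 / real (Suc m) < g x - A" using nat_approx_posE[of "g x - A"] by auto
      then show False using elim[rule_format, of m] x by simp
    qed
  qed
qed

text \<open>Average |c - c'| <= |b x - c| + |b x - c'| over R. This replaces every comparison of
  means of b over neighbouring balls and cells.\<close>

lemma center_diff_bound:
  fixes b :: "'a::euclidean_space \<Rightarrow> 'b::euclidean_space"
  assumes [measurable]: "b \<in> borel_measurable borel" "R \<in> sets borel"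
    and R: "0 < emeasure lborel R" "emeasure lborel R < top"
    and A: "0 \<le> A" "(\<integral>\<^sup>+x\<in>R. ennreal (norm (b x - c)) \<partial>lborel) \<le> ennreal A * emeasure lborel R"
    and A': "0 \<le> A'" "(\<integral>\<^sup>+x\<in>R. ennreal (norm (b x - c')) \<partial>lborel) \<le> ennreal A' * emeasure lborel R"
  shows "norm (c - c') \<le> A + A'"
proof -
  obtain e where e: "0 < e" "emeasure lborel R = ennreal e"
    using R by (cases "emeasure lborel R" rule: ennreal_pos_cases) auto
  have "ennreal (norm (c - c')) * emeasure lborel R = (\<integral>\<^sup>+x\<in>R. ennreal (norm (c - c')) \<partial>lborel)"
    by (simp add: nn_integral_cmult_indicator)
  also have "\<dots> \<le> (\<integral>\<^sup>+x\<in>R. ennreal (norm (b x - c)) + ennreal (norm (b x - c')) \<partial>lborel)"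
  proof (intro nn_integral_mono mult_right_mono)
    fix x show "ennreal (norm (c - c')) \<le> ennreal (norm (b x - c)) + ennreal (norm (b x - c'))"
      using norm_triangle_ineq4[of "b x - c'" "b x - c"] by (simp flip: ennreal_plus add: ennreal_leI)
  qed simp
  also have "\<dots> = (\<integral>\<^sup>+x\<in>R. ennreal (norm (b x - c)) \<partial>lborel) + (\<integral>\<^sup>+x\<in>R. ennreal (norm (b x - c')) \<partial>lborel)"
    by (subst nn_integral_add[symmetric]) (auto simp: distrib_right)
  also have "\<dots> \<le> ennreal A * emeasure lborel R + ennreal A' * emeasure lborel R"
    using A A' by (intro add_mono)
  finally have "ennreal (norm (c - c') * e) \<le> ennreal ((A + A') * e)"
    using e A A' by (simp add: ring_distribs flip: ennreal_mult ennreal_plus)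
  then show ?thesis using e A A' by (subst (asm) ennreal_le_iff) auto
qed

section \<open>Weighted John-Nirenberg inequality\<close>

lemma term_le_suminf: "f k \<le> (\<Sum>k. f k)" for f :: "nat \<Rightarrow> ennreal"
  using sum_le_suminf[of f "{k}"] by simp

lemma poly_geometric_bound:
  fixes \<theta> m :: real
  assumes \<theta>: "0 < \<theta>" "\<theta> < 1" and m: "0 < m"
  obtains C where "0 < C" "\<And>k::nat. (real k + 1) powr m * \<theta> ^ k \<le> C * sqrt \<theta> ^ k"
proof -
  \<comment> \<open>With \<psi>^m = sqrt \<theta>, half of the decay \<theta>^k becomes
    (\<psi>^k)^m, and the claim reduces to boundedness of k \<psi>^k.\<close>
  define \<psi> where "\<psi> = sqrt \<theta> powr (1 / m)"
  have \<psi>: "0 < \<psi>" "\<psi> < 1"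
    using \<theta> m powr_less_mono2[of "1/m" "sqrt \<theta>" 1] by (auto simp: \<psi>_def)
  have "(\<lambda>k. real k * \<psi> ^ k) \<longlonglongrightarrow> 0" using \<psi> powser_times_n_limit_0[of \<psi>] by simp
  then have "Bseq (\<lambda>k. real k * \<psi> ^ k)" by (intro convergent_imp_Bseq) (auto simp: convergent_def)
  then obtain B where B: "0 < B" "\<And>k. \<bar>real k * \<psi> ^ k\<bar> \<le> B" by (auto elim: BseqE)
  have "(real k + 1) powr m * \<theta> ^ k \<le> (B + 1) powr m * sqrt \<theta> ^ k" for k :: nat
  proof -
    have "(real k + 1) * \<psi> ^ k \<le> B + 1"
      using B(2)[of k] \<psi> power_le_one[of \<psi> k] by (simp add: ring_distribs)
    then have "((real k + 1) * \<psi> ^ k) powr m \<le> (B + 1) powr m"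
      using \<psi> m by (intro powr_mono2) auto
    moreover have "(\<psi> ^ k) powr m = sqrt \<theta> ^ k"
      using \<theta> m by (simp add: \<psi>_def powr_powr mult_ac flip: powr_realpow)
    ultimately have "(real k + 1) powr m * sqrt \<theta> ^ k \<le> (B + 1) powr m"
      using \<psi> by (simp add: powr_mult)
    then have "(real k + 1) powr m * sqrt \<theta> ^ k * sqrt \<theta> ^ k \<le> (B + 1) powr m * sqrt \<theta> ^ k"
      using \<theta> by (intro mult_right_mono) auto
    moreover have "sqrt \<theta> ^ k * sqrt \<theta> ^ k = \<theta> ^ k" using \<theta> by (simp flip: power_mult_distrib)
    ultimately show ?thesis by (simp add: mult.assoc)
  qed
  then show ?thesis using B(1) by (intro that[of "(B + 1) powr m"]) auto
qed

text \<open>\<open>c z r\<close> plays the role of the mean of b over the ball, but only the oscillation bound matters.\<close>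

definition mean_oscillation_bound ::
  "('a::euclidean_space \<Rightarrow> 'b::euclidean_space) \<Rightarrow> ('a \<Rightarrow> real \<Rightarrow> 'b) \<Rightarrow> real \<Rightarrow> bool" where
  "mean_oscillation_bound b c N \<longleftrightarrow> b \<in> borel_measurable borel \<and> 0 < N \<and>
    (\<forall>z r. 0 < r \<longrightarrow> (\<integral>\<^sup>+x\<in>ball z r. ennreal (norm (b x - c z r)) \<partial>lborel) \<le> ennreal N * emeasure lborel (ball z r))"

text \<open>The constant of the ball from \<open>cell_subset_ball\<close>, which contains the cell;
  oscillation over cells is thus inherited from balls.\<close>

definition cell_center :: "('a::euclidean_space \<Rightarrow> real \<Rightarrow> 'b) \<Rightarrow> 'a \<Rightarrow> real \<Rightarrow> nat \<Rightarrow> 'a \<Rightarrow> 'b" where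
  "cell_center c a h k x = c (cell_corner a h k x) (real DIM('a) * (h / 2 ^ k))"

text \<open>The volume of the ball from \<open>cell_subset_ball\<close> divided by that of its cell,
  the same at every scale.\<close>

definition ball_cell_ratio :: "'a::euclidean_space itself \<Rightarrow> real" where
  "ball_cell_ratio _ = unit_ball_vol (real DIM('a)) * real DIM('a) ^ DIM('a)"

lemma ball_cell_ratio_pos: "0 < ball_cell_ratio TYPE('a::euclidean_space)"
  by (simp add: ball_cell_ratio_def)

lemma emeasure_ball_cell:
  fixes a x z :: "'a::euclidean_space"
  assumes "0 < h"
  shows "emeasure lborel (ball z (real DIM('a) * (h / 2 ^ k)))
    = ennreal (ball_cell_ratio TYPE('a)) * emeasure lborel (dyadic_cell a h k x)"
proof -
  have "emeasure lborel (ball z (real DIM('a) * (h / 2 ^ k)))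
    = ennreal (unit_ball_vol (real DIM('a)) * (real DIM('a) * (h / 2 ^ k)) ^ DIM('a))"
    using assms by (intro emeasure_ball) auto
  also have "unit_ball_vol (real DIM('a)) * (real DIM('a) * (h / 2 ^ k)) ^ DIM('a)
    = ball_cell_ratio TYPE('a) * (h / 2 ^ k) ^ DIM('a)"
    unfolding ball_cell_ratio_def by (simp only: power_mult_distrib mult.assoc)
  finally show ?thesis
    using assms ball_cell_ratio_pos[where 'a='a] by (simp only: emeasure_cell ennreal_mult less_imp_le zero_le_power
      zero_le_divide_iff zero_le_numeral simp_thms)
qed

lemma cell_oscillation:
  fixes b :: "'a::euclidean_space \<Rightarrow> 'b::euclidean_space"
  assumes b: "mean_oscillation_bound b c N" and h: "0 < h"
  shows "(\<integral>\<^sup>+y\<in>dyadic_cell a h k x. ennreal (norm (b y - cell_center c a h k x)) \<partial>lborel)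
    \<le> ennreal (N * ball_cell_ratio TYPE('a)) * emeasure lborel (dyadic_cell a h k x)"
proof -
  let ?z = "cell_corner a h k x" and ?r = "real DIM('a) * (h / 2 ^ k)"
  have "(\<integral>\<^sup>+y\<in>dyadic_cell a h k x. ennreal (norm (b y - c ?z ?r)) \<partial>lborel)
    \<le> (\<integral>\<^sup>+y\<in>ball ?z ?r. ennreal (norm (b y - c ?z ?r)) \<partial>lborel)"
    using cell_subset_ball[OF h, of a k x] by (intro nn_integral_mono mult_left_mono) (auto simp: indicator_def)
  also have "\<dots> \<le> ennreal N * emeasure lborel (ball ?z ?r)"
    using b h by (auto simp: mean_oscillation_bound_def)
  also have "\<dots> = ennreal (N * ball_cell_ratio TYPE('a)) * emeasure lborel (dyadic_cell a h k x)"
    using b ball_cell_ratio_pos[where 'a='a]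
    by (subst emeasure_ball_cell[OF h, of _ k a x]) (simp add: ennreal_mult mean_oscillation_bound_def mult.assoc)
  finally show ?thesis by (simp add: cell_center_def)
qed

context A_infty_measure
begin

lemma cell_emeasure_eq:
  assumes "0 < h" "E \<in> sets borel" "E \<subseteq> dyadic_cell a h k x"
  shows "emeasure M E = ennreal (measure M E)"
  using emeasure_subset_ball[OF assms(2)] assms(3) cell_subset_ball[OF assms(1)] by blast

text \<open>Half of a cell is still a fixed Lebesgue fraction of the ball around it, so
  \<open>complement_bound\<close> applies to the part of the cell outside E.\<close>

lemma half_cell_bound:
  obtains \<theta> where "0 < \<theta>" "\<theta> < 1"
    "\<And>(a::'a) h k x E. 0 < h \<Longrightarrow> E \<in> sets borel \<Longrightarrow> E \<subseteq> dyadic_cell a h k x \<Longrightarrow>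
      2 * measure lborel E \<le> measure lborel (dyadic_cell a h k x) \<Longrightarrow>
      emeasure M E \<le> ennreal \<theta> * emeasure M (dyadic_cell a h k x)"
proof -
  let ?\<rho> = "ball_cell_ratio TYPE('a)"
  have "0 < 1 / (2 * ?\<rho>)" using ball_cell_ratio_pos by simp
  from complement_bound[OF this] obtain \<eta> where \<eta>: "0 < \<eta>" "\<And>(z::'a) r E. 0 < r \<Longrightarrow> E \<in> sets borel \<Longrightarrow> E \<subseteq> ball z r \<Longrightarrow>
    1 / (2 * ?\<rho>) * measure lborel (ball z r) \<le> measure lborel E \<Longrightarrow> \<eta> * measure M (ball z r) \<le> measure M E"
    by blast
  \<comment> \<open>The maximum with 1/2 keeps \<theta> positive.\<close>
  define \<theta> where "\<theta> = max (1/2) (1 - \<eta>)"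
  have \<theta>: "0 < \<theta>" "\<theta> < 1" using \<eta>(1) by (auto simp: \<theta>_def)
  have bound: "emeasure M E \<le> ennreal \<theta> * emeasure M (dyadic_cell a h k x)"
    if h: "0 < h" and E: "E \<in> sets borel" "E \<subseteq> dyadic_cell a h k x"
      and half: "2 * measure lborel E \<le> measure lborel (dyadic_cell a h k x)" for a :: 'a and h k x E
  proof -
    let ?Q = "dyadic_cell a h k x"
    define z where "z = cell_corner a h k x"
    define r where "r = real DIM('a) * (h / 2 ^ k)"
    have r: "0 < r" using h by (simp add: r_def)
    have Q: "?Q \<in> sets borel" "?Q \<subseteq> ball z r" using h cell_subset_ball[OF h, of a k x] by (auto simp: z_def r_def)
    have "emeasure lborel ?Q < top" using h by (simp add: emeasure_cell)
    then have fin: "emeasure lborel ?Q \<noteq> \<infinity>" by simp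
    have "measure lborel (ball z r) = ?\<rho> * measure lborel ?Q"
    proof -
      have "measure lborel (ball z r) = unit_ball_vol (real DIM('a)) * r ^ DIM('a)"
        using r by (simp add: content_ball)
      also have "r ^ DIM('a) = real DIM('a) ^ DIM('a) * (h / 2 ^ k) ^ DIM('a)"
        unfolding r_def by (rule power_mult_distrib)
      finally show ?thesis
        unfolding measure_cell[OF h] ball_cell_ratio_def mult.assoc .
    qed
    then have "1 / (2 * ?\<rho>) * measure lborel (ball z r) = measure lborel ?Q / 2"
      using ball_cell_ratio_pos[where 'a='a] by simp
    also have "\<dots> \<le> measure lborel ?Q - measure lborel E" using half by simp
    also have "\<dots> = measure lborel (?Q - E)"
      using E Q(1) fin by (intro measure_Diff[symmetric]) auto
    finally have "\<eta> * measure M (ball z r) \<le> measure M (?Q - E)"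
      using Q E r by (intro \<eta>(2)) auto
    also have "\<dots> = measure M ?Q - measure M E"
      using E Q cell_emeasure_eq[OF h Q(1), of a k x] by (intro measure_Diff) auto
    finally have "measure M E \<le> measure M ?Q - \<eta> * measure M (ball z r)" by simp
    also have "\<dots> \<le> measure M ?Q - \<eta> * measure M ?Q"
    proof -
      have "measure M ?Q \<le> measure M (ball z r)"
        by (rule measure_mono_ball[OF Q(1) _ Q(2) order_refl]) simp
      then show ?thesis using \<eta>(1) by (intro diff_left_mono mult_left_mono) auto
    qed
    also have "\<dots> = (1 - \<eta>) * measure M ?Q" by (simp add: algebra_simps)
    also have "\<dots> \<le> \<theta> * measure M ?Q" by (intro mult_right_mono) (auto simp: \<theta>_def)
    finally have "ennreal (measure M E) \<le> ennreal (\<theta> * measure M ?Q)" by (rule ennreal_leI)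
    also have "\<dots> = ennreal \<theta> * ennreal (measure M ?Q)" using \<theta> by (intro ennreal_mult) auto
    finally show ?thesis
      by (simp only: cell_emeasure_eq[OF h E] cell_emeasure_eq[OF h Q(1) order_refl])
  qed
  show ?thesis by (rule that[OF \<theta> bound])
qed

text \<open>
  The Calderon-Zygmund stopping cells at height A carry at most half of the cell, their
  centers differ from that of the cell by at most D, and b stays within A of the center outside of them.
\<close>

lemma John_Nirenberg_cells:
  fixes b :: "'a \<Rightarrow> 'b::euclidean_space"
  assumes b: "mean_oscillation_bound b c N"
  obtains D \<theta> where "0 < D" "0 < \<theta>" "\<theta> < 1"
    "\<And>(a::'a) h j x k. 0 < h \<Longrightarrow>
      emeasure M {y \<in> dyadic_cell a h j x. real k * D < norm (b y - cell_center c a h j x)}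
      \<le> ennreal (\<theta> ^ k) * emeasure M (dyadic_cell a h j x)"
proof -
  define N1 where "N1 = N * ball_cell_ratio TYPE('a)"
  \<comment> \<open>Twice the mean oscillation on a cell: the cells of average above A then fill at
    most half of it in Lebesgue measure.\<close>
  define A where "A = 2 * N1"
  \<comment> \<open>N1 is the oscillation on a stopping cell around its own center. A * 2^n bounds
    the average of g there through the parent, whose average is at most A and whose volume is 2^n
    times larger.\<close>
  define D where "D = N1 + A * 2 ^ DIM('a)"
  have [measurable]: "b \<in> borel_measurable borel" and N: "0 < N"
    using b by (auto simp: mean_oscillation_bound_def)
  have N1: "0 < N1" using N ball_cell_ratio_pos[where 'a='a] by (simp add: N1_def)
  have A: "0 < A" using N1 by (simp add: A_def)
  have "A * 1 \<le> A * 2 ^ DIM('a)" using A by (intro mult_left_mono) auto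
  then have D: "A \<le> D" "0 < D" using A N1 unfolding D_def by linarith+
  obtain \<theta> where \<theta>: "0 < \<theta>" "\<theta> < 1" and half:
    "\<And>(a::'a) h k x E. 0 < h \<Longrightarrow> E \<in> sets borel \<Longrightarrow> E \<subseteq> dyadic_cell a h k x \<Longrightarrow>
      2 * measure lborel E \<le> measure lborel (dyadic_cell a h k x) \<Longrightarrow>
      emeasure M E \<le> ennreal \<theta> * emeasure M (dyadic_cell a h k x)"
    using half_cell_bound by blast
  have main: "emeasure M {y \<in> dyadic_cell a h j x. real k * D < norm (b y - cell_center c a h j x)}
      \<le> ennreal (\<theta> ^ k) * emeasure M (dyadic_cell a h j x)" if h: "0 < h" for a :: 'a and h j x k
  proof (induction k arbitrary: j x)
    case 0
    have "emeasure M {y \<in> dyadic_cell a h j x. real 0 * D < norm (b y - cell_center c a h j x)}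
      \<le> emeasure M (dyadic_cell a h j x)" using h by (intro emeasure_mono) auto
    then show ?case by simp
  next
    case (Suc k)
    define Q where "Q = dyadic_cell a h j x"
    define g where "g y = norm (b y - cell_center c a h j x)" for y
    have [measurable]: "g \<in> borel_measurable borel" unfolding g_def by measurable
    have [measurable]: "Q \<in> sets borel" using h by (auto simp: Q_def)
    have osc_Q: "(\<integral>\<^sup>+y\<in>Q. ennreal (g y) \<partial>lborel) \<le> ennreal N1 * emeasure lborel Q"
      using cell_oscillation[OF b h, of a j x] by (simp add: g_def Q_def N1_def)
    \<comment> \<open>Only proper subcells of Q compete; Q itself has average at most N1, which is
      below A.\<close>
    define P where "P l y \<longleftrightarrow> j < l \<and> y \<in> Q \<and>
      ennreal A * emeasure lborel (dyadic_cell a h l y) < (\<integral>\<^sup>+y\<in>dyadic_cell a h l y. ennreal (g y) \<partial>lborel)" for l y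
    have P_cong: "P l z" if "P l y" "z \<in> dyadic_cell a h l y" for l y z
    proof -
      have "z \<in> Q" using that cell_nested[of j l y a h x] by (auto simp: P_def Q_def)
      then show ?thesis using that cell_eq[of z a h l y] by (simp add: P_def)
    qed
    obtain \<Q> where \<Q>: "countable \<Q>" "disjoint \<Q>" "\<Union>\<Q> = {y. \<exists>l. P l y}"
      "\<And>R. R \<in> \<Q> \<Longrightarrow> \<exists>l y. R = dyadic_cell a h l y \<and> P l y \<and> (\<forall>i<l. \<not> P i y)"
      using maximal_cells[of P a h] P_cong by blast
    have Q_borel: "R \<in> sets borel" if "R \<in> \<Q>" for R using \<Q>(4)[OF that] h by auto
    have \<Q>_borel [measurable]: "\<Union>\<Q> \<in> sets borel"
      using \<Q>(1) Q_borel by (intro sets.countable_Union) auto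
    have \<Q>_sub: "\<Union>\<Q> \<subseteq> Q" by (auto simp: \<Q>(3) P_def)
    define \<nu> where "\<nu> = density lborel (\<lambda>x. ennreal (g x))"
    have [simp]: "sets \<nu> = sets borel" by (simp add: \<nu>_def)
    have \<nu>: "emeasure \<nu> X = (\<integral>\<^sup>+y\<in>X. ennreal (g y) \<partial>lborel)" if "X \<in> sets borel" for X
      using that by (simp add: \<nu>_def emeasure_density)
    have "ennreal A * emeasure lborel (UNIV \<inter> \<Union>\<Q>) = (\<integral>\<^sup>+R. ennreal A * emeasure lborel R \<partial>count_space \<Q>)"
      using \<Q>(1,2) Q_borel by (subst emeasure_disjoint_Union) (auto simp: nn_integral_cmult)
    also have "\<dots> \<le> (\<integral>\<^sup>+R. emeasure \<nu> (UNIV \<inter> R) \<partial>count_space \<Q>)"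
    proof (intro nn_integral_mono)
      fix R assume "R \<in> space (count_space \<Q>)"
      then have R: "R \<in> \<Q>" by simp
      then obtain l y where "R = dyadic_cell a h l y" "P l y" using \<Q>(4) by blast
      then show "ennreal A * emeasure lborel R \<le> emeasure \<nu> (UNIV \<inter> R)"
        using Q_borel[OF R] by (simp add: \<nu> P_def less_imp_le)
    qed
    also have "\<dots> = emeasure \<nu> (UNIV \<inter> \<Union>\<Q>)"
      using \<Q>(1,2) Q_borel by (subst emeasure_disjoint_Union[of \<Q>]) auto
    also have "\<dots> \<le> emeasure \<nu> Q" using \<Q>_sub by (intro emeasure_mono) auto
    also have "\<dots> \<le> ennreal N1 * emeasure lborel Q" using osc_Q by (simp add: \<nu>)
    finally have le: "ennreal A * emeasure lborel (\<Union>\<Q>) \<le> ennreal N1 * emeasure lborel Q" by simp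
    have finQ: "emeasure lborel Q = ennreal (measure lborel Q)"
      using h by (simp add: Q_def emeasure_cell measure_cell)
    have "emeasure lborel (\<Union>\<Q>) \<le> emeasure lborel Q" using \<Q>_sub by (intro emeasure_mono) auto
    also have "emeasure lborel Q < top" unfolding finQ by simp
    finally have finU: "emeasure lborel (\<Union>\<Q>) = ennreal (measure lborel (\<Union>\<Q>))"
      by (intro emeasure_eq_ennreal_measure) simp
    have "ennreal (A * measure lborel (\<Union>\<Q>)) \<le> ennreal (N1 * measure lborel Q)"
      using le[unfolded finU finQ] A N1 by (simp add: ennreal_mult)
    then have "A * measure lborel (\<Union>\<Q>) \<le> N1 * measure lborel Q"
      using N1 by (subst (asm) ennreal_le_iff) auto
    then have "2 * measure lborel (\<Union>\<Q>) \<le> measure lborel Q" using N1 by (simp add: A_def)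
    from half[OF h \<Q>_borel \<Q>_sub[unfolded Q_def] this[unfolded Q_def]]
    have half_Q: "emeasure M (\<Union>\<Q>) \<le> ennreal \<theta> * emeasure M Q" by (simp only: Q_def)
    have close: "norm (cell_center c a h l y - cell_center c a h j x) \<le> D"
      if R: "P l y" "\<forall>i<l. \<not> P i y" for l y
    proof -
      let ?R = "dyadic_cell a h l y"
      \<comment> \<open>The parent at level m is either Q itself or a subcell of Q that was not
        selected; in both cases its average is at most A.\<close>
      obtain m where m: "l = Suc m" "j \<le> m" using R by (cases l) (auto simp: P_def)
      have y: "y \<in> Q" using R by (simp add: P_def)
      have "(\<integral>\<^sup>+z\<in>dyadic_cell a h m y. ennreal (g z) \<partial>lborel) \<le> ennreal A * emeasure lborel (dyadic_cell a h m y)"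
      proof (cases "m = j")
        case True
        then have "dyadic_cell a h m y = Q" using y cell_eq[of y a h j x] by (simp add: Q_def)
        then have "(\<integral>\<^sup>+z\<in>dyadic_cell a h m y. ennreal (g z) \<partial>lborel) \<le> ennreal N1 * emeasure lborel (dyadic_cell a h m y)"
          using osc_Q by simp
        also have "\<dots> \<le> ennreal A * emeasure lborel (dyadic_cell a h m y)"
          using N1 by (intro mult_right_mono ennreal_leI) (auto simp: A_def)
        finally show ?thesis .
      next
        case False
        then show ?thesis using R(2) m y by (auto simp: P_def not_less)
      qed
      then have "(\<integral>\<^sup>+z\<in>dyadic_cell a h m y. ennreal (g z) \<partial>lborel) \<le> ennreal (A * 2 ^ DIM('a)) * emeasure lborel ?R"
        using A by (subst (asm) emeasure_cell_Suc[OF h]) (simp add: m ennreal_mult mult.assoc)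
      moreover have "(\<integral>\<^sup>+z\<in>?R. ennreal (g z) \<partial>lborel) \<le> (\<integral>\<^sup>+z\<in>dyadic_cell a h m y. ennreal (g z) \<partial>lborel)"
        using cell_Suc_subset[of a h m y] unfolding m
        by (intro nn_integral_mono mult_left_mono) (auto simp: indicator_def)
      ultimately have 2: "(\<integral>\<^sup>+z\<in>?R. ennreal (g z) \<partial>lborel) \<le> ennreal (A * 2 ^ DIM('a)) * emeasure lborel ?R"
        by order
      have 1: "(\<integral>\<^sup>+z\<in>?R. ennreal (norm (b z - cell_center c a h l y)) \<partial>lborel) \<le> ennreal N1 * emeasure lborel ?R"
        using cell_oscillation[OF b h] by (simp add: N1_def)
      have "0 < emeasure lborel ?R" "emeasure lborel ?R < top" using h by (simp_all add: emeasure_cell)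
      from center_diff_bound[OF _ _ this _ 1 _ 2[unfolded g_def]] show ?thesis
        using h N1 A by (simp add: D_def)
    qed
    \<comment> \<open>Off the stopping cells the averages over all finer cells are at most A, hence
      so is g almost everywhere. The exceptional set is also null for M by absolute
      continuity.\<close>
    have "AE y in lborel. y \<in> Q - \<Union>\<Q> \<longrightarrow> g y \<le> A"
    proof (rule cell_averages_bound[OF h, where j=j and a=a])
      show "g \<in> borel_measurable borel" "Q - \<Union>\<Q> \<in> sets borel" by measurable
      show "0 \<le> A" using A by simp
      have "emeasure lborel (Q - \<Union>\<Q>) \<le> emeasure lborel Q" by (rule emeasure_mono) auto
      also have "\<dots> < top" unfolding finQ by simp
      finally show "emeasure lborel (Q - \<Union>\<Q>) < top" .
      fix y l assume y: "y \<in> Q - \<Union>\<Q>" and "j < l"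
      then have "y \<in> Q" "\<not> P l y" unfolding \<Q>(3) by auto
      with \<open>j < l\<close> show "(\<integral>\<^sup>+z\<in>dyadic_cell a h l y. ennreal (g z) \<partial>lborel) \<le> ennreal A * emeasure lborel (dyadic_cell a h l y)"
        by (auto simp: P_def not_less)
    qed
    then have "AE y in M. y \<in> Q - \<Union>\<Q> \<longrightarrow> g y \<le> A"
      by (rule absolutely_continuous_AE[OF _ abs_cont, rotated]) simp
    then have "AE y in M. y \<in> {y\<in>Q. real (Suc k) * D < g y} \<longrightarrow> y \<in> {y\<in>\<Union>\<Q>. real (Suc k) * D < g y}"
    proof eventually_elim
      case (elim y)
      have "A \<le> real (Suc k) * D" using D by (simp add: algebra_simps add_increasing2)
      then show ?case using elim by auto
    qed
    then have "emeasure M {y\<in>Q. real (Suc k) * D < g y} \<le> emeasure M {y\<in>\<Union>\<Q>. real (Suc k) * D < g y}"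
    proof (rule emeasure_mono_AE)
      show "{y\<in>\<Union>\<Q>. real (Suc k) * D < g y} \<in> sets M" unfolding sets_M by measurable
    qed
    also have "{y\<in>\<Union>\<Q>. real (Suc k) * D < g y} = {y. real (Suc k) * D < g y} \<inter> \<Union>\<Q>" by auto
    also have "emeasure M \<dots> = (\<integral>\<^sup>+R. emeasure M ({y. real (Suc k) * D < g y} \<inter> R) \<partial>count_space \<Q>)"
    proof (rule emeasure_disjoint_Union[OF \<Q>(1,2)])
      show "{y. real (Suc k) * D < g y} \<in> sets M" unfolding sets_M by measurable
    qed (simp add: Q_borel)
    also have "\<dots> \<le> (\<integral>\<^sup>+R. ennreal (\<theta> ^ k) * emeasure M R \<partial>count_space \<Q>)"
    proof (intro nn_integral_mono)
      fix R assume "R \<in> space (count_space \<Q>)"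
      then obtain l y where R: "R = dyadic_cell a h l y" "P l y" "\<forall>i<l. \<not> P i y" using \<Q>(4)[of R] by auto
      \<comment> \<open>Passing to the center of R costs at most D, that is one level, so the
        induction hypothesis for k applies on R. The extra factor \<theta> then comes from the
        M-measure of the union of the stopping cells.\<close>
      have "{z. real (Suc k) * D < g z} \<inter> R \<subseteq> {z\<in>R. real k * D < norm (b z - cell_center c a h l y)}"
      proof clarify
        fix z assume z: "real (Suc k) * D < g z" "z \<in> R"
        have "g z \<le> norm (b z - cell_center c a h l y) + norm (cell_center c a h l y - cell_center c a h j x)"
          using norm_triangle_ineq[of "b z - cell_center c a h l y" "cell_center c a h l y - cell_center c a h j x"]
          by (simp add: g_def)
        also have "\<dots> \<le> norm (b z - cell_center c a h l y) + D" using close[OF R(2,3)] by simp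
        finally show "real k * D < norm (b z - cell_center c a h l y)" using z by (simp add: algebra_simps)
      qed
      moreover have [measurable]: "R \<in> sets borel" using R(1) h by simp
      have "{z\<in>R. real k * D < norm (b z - cell_center c a h l y)} \<in> sets M" unfolding sets_M by measurable
      ultimately have "emeasure M ({y. real (Suc k) * D < g y} \<inter> R) \<le> emeasure M {z\<in>R. real k * D < norm (b z - cell_center c a h l y)}"
        by (rule emeasure_mono)
      also have "\<dots> \<le> ennreal (\<theta> ^ k) * emeasure M R" unfolding R(1) by (rule Suc.IH)
      finally show "emeasure M ({y. real (Suc k) * D < g y} \<inter> R) \<le> ennreal (\<theta> ^ k) * emeasure M R" .
    qed
    also have "\<dots> = ennreal (\<theta> ^ k) * emeasure M (UNIV \<inter> \<Union>\<Q>)"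
      using \<Q>(1,2) Q_borel by (subst emeasure_disjoint_Union) (auto simp: nn_integral_cmult)
    also have "\<dots> \<le> ennreal (\<theta> ^ k) * (ennreal \<theta> * emeasure M Q)"
      using half_Q by (intro mult_left_mono) auto
    also have "\<dots> = ennreal (\<theta> ^ Suc k) * emeasure M Q"
      using \<theta> by (simp add: ennreal_mult ac_simps)
    finally show ?case by (simp add: g_def Q_def)
  qed
  show ?thesis by (rule that[OF D(2) \<theta> main])
qed

lemma doubling_iterate:
  assumes "\<And>z r. 0 < r \<Longrightarrow> measure M (ball z (2 * r)) \<le> D * measure M (ball z r)" "0 < r" "0 \<le> D"
  shows "measure M (ball z (2 ^ l * r)) \<le> D ^ l * measure M (ball z r)"
proof (induction l)
  case (Suc l)
  have "measure M (ball z (2 * (2 ^ l * r))) \<le> D * measure M (ball z (2 ^ l * r))"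
    using assms by (intro assms) auto
  also have "\<dots> \<le> D * (D ^ l * measure M (ball z r))"
    using Suc assms by (intro mult_left_mono)
  finally show ?case by (simp add: mult_ac)
qed simp

text \<open>Geometric decay of the level sets beats every power. Each ball is placed in a level 0
  cell of a grid made for it, and the constant of the cell is afterwards exchanged for that of the
  ball.\<close>

lemma John_Nirenberg_moment:
  fixes b :: "'a \<Rightarrow> 'b::euclidean_space"
  assumes b: "mean_oscillation_bound b c N" and m: "0 < m"
  obtains C where "0 < C"
    "\<And>z r. 0 < r \<Longrightarrow> (\<integral>\<^sup>+x\<in>ball z r. ennreal (norm (b x - c z r) powr m) \<partial>M) \<le> ennreal C * emeasure M (ball z r)"
proof -
  have [measurable]: "b \<in> borel_measurable borel" and N: "0 < N"
    and osc: "\<And>z r. 0 < r \<Longrightarrow> (\<integral>\<^sup>+x\<in>ball z r. ennreal (norm (b x - c z r)) \<partial>lborel) \<le> ennreal N * emeasure lborel (ball z r)"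
    using b by (auto simp: mean_oscillation_bound_def)
  obtain Dd where Dd: "1 \<le> Dd" "\<And>z r. 0 < r \<Longrightarrow> measure M (ball z (2 * r)) \<le> Dd * measure M (ball z r)"
    using doubling by blast
  \<comment> \<open>A cell of side 2 r around z stays within distance n * 2 r of z, hence in the
    ball of radius 2^l r, whose M-measure doubling controls.\<close>
  obtain l :: nat where l: "real DIM('a) * 2 < 2 ^ l" using real_arch_pow[of 2 "real DIM('a) * 2"] by auto
  obtain D \<theta> where D: "0 < D" and \<theta>: "0 < \<theta>" "\<theta> < 1" and JN:
    "\<And>(a::'a) h j x k. 0 < h \<Longrightarrow>
      emeasure M {y \<in> dyadic_cell a h j x. real k * D < norm (b y - cell_center c a h j x)}
      \<le> ennreal (\<theta> ^ k) * emeasure M (dyadic_cell a h j x)"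
    using John_Nirenberg_cells[OF b] by blast
  obtain C0 where C0: "0 < C0" "\<And>k::nat. (real k + 1) powr m * \<theta> ^ k \<le> C0 * sqrt \<theta> ^ k"
    using poly_geometric_bound[OF \<theta> m] by blast
  define S where "S = (D powr m * C0) / (1 - sqrt \<theta>)"
  have sq: "0 < sqrt \<theta>" "sqrt \<theta> < 1" using \<theta> by auto
  have S: "0 < S" using D C0 sq by (simp add: S_def)
  define N1 where "N1 = N * ball_cell_ratio TYPE('a)"
  have N1: "0 < N1" using N ball_cell_ratio_pos[where 'a='a] by (simp add: N1_def)
  define V where "V = unit_ball_vol (real DIM('a))"
  have V: "0 < V" by (simp add: V_def)
  \<comment> \<open>Bounds the distance between the constants of the cell and of the ball; both are
    compared with b on the ball.\<close>
  define D2 where "D2 = N1 * (2 ^ DIM('a) / V) + N"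
  have D2: "0 < D2" using N1 V N by (auto simp: D2_def intro!: add_pos_pos)
  define C where "C = 2 powr m * (S * Dd ^ l + D2 powr m)"
  have C: "0 < C" using S Dd D2 by (auto simp: C_def intro!: add_pos_nonneg mult_pos_pos zero_less_power)
  have "(\<integral>\<^sup>+x\<in>ball z r. ennreal (norm (b x - c z r) powr m) \<partial>M) \<le> ennreal C * emeasure M (ball z r)"
    if r: "0 < r" for z r
  proof -
    \<comment> \<open>This origin puts z at the middle of a level 0 cell of side 2 r.\<close>
    define a where "a = z - r *\<^sub>R One"
    define Q where "Q = dyadic_cell a (2 * r) 0 z"
    define cQ where "cQ = cell_center c a (2 * r) 0 z"
    define g where "g y = norm (b y - cQ)" for y
    have h: "0 < 2 * r" using r by simp
    have [measurable]: "g \<in> borel_measurable borel" unfolding g_def by measurable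
    have [measurable]: "Q \<in> sets borel" using h by (auto simp: Q_def)
    have sub: "ball z r \<subseteq> Q"
    proof
      fix y assume "y \<in> ball z r"
      then have y: "norm (y - z) < r" by (simp add: dist_norm norm_minus_commute)
      have "\<lfloor>((y - a) \<bullet> i) / (2 * r)\<rfloor> = 0" "\<lfloor>((z - a) \<bullet> i) / (2 * r)\<rfloor> = 0" if "i \<in> Basis" for i
      proof -
        have "\<bar>(y - z) \<bullet> i\<bar> < r" using y Basis_le_norm[OF that, of "y - z"] by linarith
        moreover have "(y - a) \<bullet> i = (y - z) \<bullet> i + r" "(z - a) \<bullet> i = r"
          using that by (simp_all add: a_def inner_diff_left inner_add_left)
        ultimately show "\<lfloor>((y - a) \<bullet> i) / (2 * r)\<rfloor> = 0" "\<lfloor>((z - a) \<bullet> i) / (2 * r)\<rfloor> = 0"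
          using r by (auto simp: floor_eq_iff abs_less_iff field_simps)
      qed
      then show "y \<in> Q" by (simp add: Q_def dyadic_cell_def)
    qed
    have "Q \<subseteq> ball z (2 ^ l * r)"
    proof
      fix y assume "y \<in> Q"
      then have "dist z y < real DIM('a) * (2 * r)"
        using dist_cell_less[OF h cell_self, of y a 0 z] by (simp add: Q_def)
      also have "\<dots> \<le> 2 ^ l * r" using l r by simp
      finally show "y \<in> ball z (2 ^ l * r)" by simp
    qed
    then have "emeasure M Q \<le> emeasure M (ball z (2 ^ l * r))" by (intro emeasure_mono) auto
    also have "\<dots> \<le> ennreal (Dd ^ l) * emeasure M (ball z r)"
      using doubling_iterate[of Dd r z l] Dd r by (simp add: emeasure_ball_eq flip: ennreal_mult)
    finally have MQ: "emeasure M Q \<le> ennreal (Dd ^ l) * emeasure M (ball z r)" .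
    have volQ: "emeasure lborel Q = ennreal (2 ^ DIM('a) / V) * emeasure lborel (ball z r)"
      using r V by (simp add: Q_def emeasure_cell emeasure_ball V_def[symmetric] power_mult_distrib flip: ennreal_mult)
    have "(\<integral>\<^sup>+x\<in>ball z r. ennreal (g x) \<partial>lborel) \<le> (\<integral>\<^sup>+x\<in>Q. ennreal (g x) \<partial>lborel)"
      using sub by (intro nn_integral_mono mult_left_mono) (auto simp: indicator_def)
    also have "\<dots> \<le> ennreal N1 * emeasure lborel Q"
      using cell_oscillation[OF b h, of a 0 z] by (simp add: g_def Q_def cQ_def N1_def)
    also have "\<dots> = ennreal (N1 * (2 ^ DIM('a) / V)) * emeasure lborel (ball z r)"
      unfolding volQ using N1 V by (subst ennreal_mult) (auto simp: mult.assoc)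
    finally have 1: "(\<integral>\<^sup>+x\<in>ball z r. ennreal (norm (b x - cQ)) \<partial>lborel) \<le> ennreal (N1 * (2 ^ DIM('a) / V)) * emeasure lborel (ball z r)"
      by (simp add: g_def)
    have "0 < emeasure lborel (ball z r)" "emeasure lborel (ball z r) < top"
      using r by (simp_all add: emeasure_ball)
    from center_diff_bound[OF _ _ this _ 1 _ osc[OF r]] have cdiff: "norm (cQ - c z r) \<le> D2"
      using N1 V N by (simp add: D2_def)
    have pw: "ennreal (g y powr m) \<le> (\<Sum>k. ennreal (((real k + 1) * D) powr m) * indicator {y. real k * D < g y} y)" for y
    proof (cases "g y = 0")
      case False
      then have gy: "0 < g y" by (simp add: g_def)
      \<comment> \<open>The index with k D < g y <= (k + 1) D. A ceiling is taken because the level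
        sets are strict.\<close>
      define k where "k = nat (\<lceil>g y / D\<rceil> - 1)"
      have "real k = of_int \<lceil>g y / D\<rceil> - 1" using gy D by (simp add: k_def)
      then have "real k < g y / D" "g y / D \<le> real k + 1" by linarith+
      then have k: "real k * D < g y" "g y \<le> (real k + 1) * D" using D by (auto simp: field_simps)
      have "ennreal (g y powr m) \<le> ennreal (((real k + 1) * D) powr m) * indicator {y. real k * D < g y} y"
        using k m gy by (auto intro!: ennreal_leI powr_mono2)
      also have "\<dots> \<le> (\<Sum>k. ennreal (((real k + 1) * D) powr m) * indicator {y. real k * D < g y} y)"
        by (rule term_le_suminf)
      finally show ?thesis .
    qed simp
    have "(\<integral>\<^sup>+y\<in>Q. ennreal (g y powr m) \<partial>M)
      \<le> (\<integral>\<^sup>+y. (\<Sum>k. ennreal (((real k + 1) * D) powr m) * indicator {y\<in>Q. real k * D < g y} y) \<partial>M)"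
    proof (intro nn_integral_mono)
      fix y show "ennreal (g y powr m) * indicator Q y \<le> (\<Sum>k. ennreal (((real k + 1) * D) powr m) * indicator {y\<in>Q. real k * D < g y} y)"
        using pw[of y] by (cases "y \<in> Q") (auto simp: indicator_def)
    qed
    also have "\<dots> = (\<Sum>k. ennreal (((real k + 1) * D) powr m) * emeasure M {y\<in>Q. real k * D < g y})"
      by (subst nn_integral_suminf) (auto simp: nn_integral_cmult_indicator)
    also have "\<dots> \<le> (\<Sum>k. ennreal (D powr m * C0 * sqrt \<theta> ^ k) * emeasure M Q)"
    proof (intro suminf_le summableI)
      fix k
      have "ennreal (((real k + 1) * D) powr m) * emeasure M {y\<in>Q. real k * D < g y}
        \<le> ennreal (((real k + 1) * D) powr m) * (ennreal (\<theta> ^ k) * emeasure M Q)"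
        unfolding Q_def g_def cQ_def using h by (intro mult_left_mono JN) auto
      also have "\<dots> = ennreal (D powr m * ((real k + 1) powr m * \<theta> ^ k)) * emeasure M Q"
        using D \<theta> by (simp add: powr_mult ennreal_mult mult_ac)
      also have "\<dots> \<le> ennreal (D powr m * (C0 * sqrt \<theta> ^ k)) * emeasure M Q"
        using C0 by (intro mult_right_mono ennreal_leI mult_left_mono) auto
      finally show "ennreal (((real k + 1) * D) powr m) * emeasure M {y\<in>Q. real k * D < g y}
        \<le> ennreal (D powr m * C0 * sqrt \<theta> ^ k) * emeasure M Q" by (simp add: mult_ac)
    qed
    also have "\<dots> = ennreal S * emeasure M Q"
    proof -
      have "(\<Sum>k. ennreal (D powr m * C0 * sqrt \<theta> ^ k)) = ennreal (\<Sum>k. D powr m * C0 * sqrt \<theta> ^ k)"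
        using sq C0 \<theta> by (intro suminf_ennreal2 summable_mult summable_geometric) auto
      also have "(\<Sum>k. D powr m * C0 * sqrt \<theta> ^ k) = S"
        using sq by (subst suminf_mult) (auto simp: S_def suminf_geometric intro!: summable_geometric)
      finally show ?thesis by (simp add: ennreal_suminf_multc)
    qed
    also have "\<dots> \<le> ennreal S * (ennreal (Dd ^ l) * emeasure M (ball z r))"
      using MQ by (intro mult_left_mono) auto
    finally have gQ: "(\<integral>\<^sup>+y\<in>Q. ennreal (g y powr m) \<partial>M) \<le> ennreal (S * Dd ^ l) * emeasure M (ball z r)"
      using S Dd by (simp add: ennreal_mult mult.assoc)
    have "(\<integral>\<^sup>+x\<in>ball z r. ennreal (norm (b x - c z r) powr m) \<partial>M)
      \<le> (\<integral>\<^sup>+x\<in>ball z r. ennreal (2 powr m) * (ennreal (g x powr m) + ennreal (D2 powr m)) \<partial>M)"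
    proof (intro nn_integral_mono mult_right_mono)
      fix x
      have le: "norm (b x - c z r) \<le> g x + D2"
        using norm_triangle_ineq[of "b x - cQ" "cQ - c z r"] cdiff by (simp add: g_def)
      have "ennreal (norm (b x - c z r) powr m) \<le> ennreal ((g x + D2) powr m)"
        using le m by (intro ennreal_leI powr_mono2) auto
      also have "\<dots> = (ennreal (g x) + ennreal D2) ennpowr m"
        using D2 m by (simp add: ennpowr_ennreal' g_def flip: ennreal_plus)
      also have "\<dots> \<le> ennreal (2 powr m) * (ennreal (g x) ennpowr m + ennreal D2 ennpowr m)"
        using m by (intro ennpowr_add_le) auto
      also have "\<dots> = ennreal (2 powr m) * (ennreal (g x powr m) + ennreal (D2 powr m))"
        using m D2 by (simp add: ennpowr_ennreal' g_def)
      finally show "ennreal (norm (b x - c z r) powr m) \<le> ennreal (2 powr m) * (ennreal (g x powr m) + ennreal (D2 powr m))" .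
    qed simp
    also have "\<dots> = ennreal (2 powr m) * ((\<integral>\<^sup>+x\<in>ball z r. ennreal (g x powr m) \<partial>M) + ennreal (D2 powr m) * emeasure M (ball z r))"
      by (simp add: mult.assoc distrib_right nn_integral_cmult nn_integral_add nn_integral_cmult_indicator)
    also have "\<dots> \<le> ennreal (2 powr m) * (ennreal (S * Dd ^ l) * emeasure M (ball z r) + ennreal (D2 powr m) * emeasure M (ball z r))"
    proof (intro mult_left_mono add_mono order_refl)
      have "(\<integral>\<^sup>+x\<in>ball z r. ennreal (g x powr m) \<partial>M) \<le> (\<integral>\<^sup>+y\<in>Q. ennreal (g y powr m) \<partial>M)"
        using sub by (intro nn_integral_mono mult_left_mono) (auto simp: indicator_def)
      then show "(\<integral>\<^sup>+x\<in>ball z r. ennreal (g x powr m) \<partial>M) \<le> ennreal (S * Dd ^ l) * emeasure M (ball z r)"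
        using gQ by order
    qed simp_all
    also have "\<dots> = ennreal C * emeasure M (ball z r)"
      using S Dd by (simp add: C_def ennreal_mult ring_distribs mult.assoc)
    finally show ?thesis .
  qed
  with C show ?thesis by (rule that)
qed

end

section \<open>A fractional embedding over balls\<close>

text \<open>Summation over dyadic scales and averaging over centers replaces the sum over a dyadic grid of cubes.\<close>

definition scale_radius :: "int \<Rightarrow> real" where
  "scale_radius k = 2 powr real_of_int k"

text \<open>The factor r^(-n) normalizes the centers: those of the balls of radius r that contain a
  given point fill a volume proportional to r^n, so all scales get the same total weight at each
  point.\<close>

definition scale_integral :: "(int \<Rightarrow> 'a::euclidean_space \<Rightarrow> ennreal) \<Rightarrow> ennreal" where
  "scale_integral h = (\<integral>\<^sup>+k. (\<integral>\<^sup>+z. h k z * ennreal (scale_radius k powr (- real DIM('a))) \<partial>lborel) \<partial>count_space UNIV)"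

lemma scale_radius_pos [simp]: "0 < scale_radius k"
  by (simp add: scale_radius_def)

lemma scale_radius_neq_0 [simp]: "scale_radius k \<noteq> 0"
  by (simp add: scale_radius_def)

lemma scale_radius_Suc: "scale_radius (k + 1) = 2 * scale_radius k"
  by (simp add: scale_radius_def powr_add)

lemma nn_integral_count_space_int:
  "(\<integral>\<^sup>+k. f k \<partial>count_space UNIV) = (\<Sum>i. f (int_decode i))" for f :: "int \<Rightarrow> ennreal"
  using nn_integral_bij_count_space[OF bij_int_decode, of f] by (simp add: nn_integral_count_space_nat)

lemma scale_integral_mono:
  "(\<And>k z. h k z \<le> h' k z) \<Longrightarrow> scale_integral h \<le> scale_integral h'"
  unfolding scale_integral_def by (intro nn_integral_mono mult_right_mono) auto

lemma scale_integral_cmult: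
  assumes "\<And>k. h k \<in> borel_measurable borel"
  shows "scale_integral (\<lambda>k z. c * h k z) = c * scale_integral h"
  unfolding scale_integral_def using assms by (simp add: mult.assoc nn_integral_cmult)

lemma scale_integral_add:
  assumes "\<And>k. h k \<in> borel_measurable borel" "\<And>k. h' k \<in> borel_measurable borel"
  shows "scale_integral (\<lambda>k z. h k z + h' k z) = scale_integral h + scale_integral h'"
  unfolding scale_integral_def using assms by (simp add: distrib_right nn_integral_add)

text \<open>Tonelli in z at each scale; the scales are enumerated as a series, which commutes with
  the integral over M.\<close>

lemma scale_integral_swap:
  fixes M :: "'b measure"
  assumes "sigma_finite_measure M"
    and meas: "\<And>k. (\<lambda>(z, x). H k z x) \<in> borel_measurable (borel \<Otimes>\<^sub>M M)"
  shows "scale_integral (\<lambda>k z. \<integral>\<^sup>+x. H k z x \<partial>M) = (\<integral>\<^sup>+x. scale_integral (\<lambda>k z. H k z x) \<partial>M)"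
proof -
  interpret sigma_finite_measure M by fact
  interpret P: pair_sigma_finite "lborel :: 'a measure" M ..
  have meas' [measurable]: "(\<lambda>(z, x). H k z x) \<in> borel_measurable (lborel \<Otimes>\<^sub>M M)" for k
    using meas[of k] by (subst measurable_cong_sets[OF sets_pair_measure_cong refl]) auto
  have [measurable]: "H k z \<in> borel_measurable M" for k z using meas'[of k] by measurable
  define w where "w k = ennreal (scale_radius k powr (- real DIM('a)))" for k
  have "(\<integral>\<^sup>+z. (\<integral>\<^sup>+x. H k z x \<partial>M) * w k \<partial>lborel) = (\<integral>\<^sup>+x. (\<integral>\<^sup>+z. H k z x * w k \<partial>lborel) \<partial>M)" for k
  proof -
    have "(\<integral>\<^sup>+z. (\<integral>\<^sup>+x. H k z x \<partial>M) * w k \<partial>lborel) = (\<integral>\<^sup>+z. (\<integral>\<^sup>+x. H k z x * w k \<partial>M) \<partial>lborel)"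
      by (simp add: nn_integral_multc)
    also have "\<dots> = (\<integral>\<^sup>+x. (\<integral>\<^sup>+z. H k z x * w k \<partial>lborel) \<partial>M)"
      by (rule P.Fubini'[symmetric]) measurable
    finally show ?thesis .
  qed
  moreover have [measurable]: "(\<lambda>(x, z). H k z x) \<in> borel_measurable (M \<Otimes>\<^sub>M lborel)" for k
    using measurable_pair_swap[OF meas'[of k]] by simp
  have "(\<lambda>x. \<integral>\<^sup>+z. H k z x * w k \<partial>lborel) \<in> borel_measurable M" for k by measurable
  ultimately show ?thesis
    unfolding scale_integral_def w_def[symmetric] nn_integral_count_space_int
    by (subst nn_integral_suminf) auto
qed

lemma ennpowr_le_self:
  assumes "x \<le> 1" "1 \<le> t" shows "x ennpowr t \<le> x"
proof (cases x rule: ennreal_pos_cases)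
  case (pos r)
  have "r powr t \<le> r powr 1" using assms pos by (intro powr_mono') (auto simp: ennreal_le_1)
  then show ?thesis using pos by (auto simp: ennpowr_ennreal)
qed (use assms in auto)

section \<open>Sums over all balls containing a point\<close>

context A_infty_measure
begin

text \<open>By doubling, every ball of radius r that contains x has M-measure comparable to that of
  \<open>ball x r\<close>, within the factor D. Averaging over the centers then costs only the
  volume of the unit ball, and a sum over concentric balls remains.\<close>

lemma overlap_sum:
  fixes \<phi> :: "real \<Rightarrow> ennreal" and \<psi> :: "real \<Rightarrow> ennreal"
  assumes D: "1 \<le> D" "\<And>z r. 0 < r \<Longrightarrow> measure M (ball z (2 * r)) \<le> D * measure M (ball z r)"
    and le: "\<And>u s. 0 < u \<Longrightarrow> 0 < s \<Longrightarrow> u \<le> D * s \<Longrightarrow> s \<le> D * u \<Longrightarrow> \<phi> u \<le> \<psi> s"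
  shows "scale_integral (\<lambda>k z. \<phi> (measure M (ball z (scale_radius k))) * indicator (ball z (scale_radius k)) x)
    \<le> ennreal (unit_ball_vol (real DIM('a))) * (\<integral>\<^sup>+k. \<psi> (measure M (ball x (scale_radius k))) \<partial>count_space UNIV)"
proof -
  define V where "V = ennreal (unit_ball_vol (real DIM('a)))"
  have "(\<integral>\<^sup>+z. \<phi> (measure M (ball z (scale_radius k))) * indicator (ball z (scale_radius k)) x * ennreal (scale_radius k powr (- real DIM('a))) \<partial>lborel)
     \<le> V * \<psi> (measure M (ball x (scale_radius k)))" for k
  proof -
    let ?r = "scale_radius k"
    have "(\<integral>\<^sup>+z. \<phi> (measure M (ball z ?r)) * indicator (ball z ?r) x * ennreal (?r powr (- real DIM('a))) \<partial>lborel)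
      \<le> (\<integral>\<^sup>+z. (\<psi> (measure M (ball x ?r)) * ennreal (?r powr (- real DIM('a)))) * indicator (ball x ?r) z \<partial>lborel)"
    proof (intro nn_integral_mono)
      fix z
      show "\<phi> (measure M (ball z ?r)) * indicator (ball z ?r) x * ennreal (?r powr (- real DIM('a)))
        \<le> (\<psi> (measure M (ball x ?r)) * ennreal (?r powr (- real DIM('a)))) * indicator (ball x ?r) z"
      proof (cases "dist x z < ?r")
        case True
        have sub: "ball z ?r \<subseteq> ball x (2 * ?r)" "ball x ?r \<subseteq> ball z (2 * ?r)"
          using True by (auto simp: ball_subset_ball_iff dist_commute)
        have "measure M (ball z ?r) \<le> D * measure M (ball x ?r)"
          using measure_ball_mono[OF sub(1)] D(2)[of ?r x] by simp
        moreover have "measure M (ball x ?r) \<le> D * measure M (ball z ?r)"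
          using measure_ball_mono[OF sub(2)] D(2)[of ?r z] by simp
        ultimately have "\<phi> (measure M (ball z ?r)) \<le> \<psi> (measure M (ball x ?r))"
          by (intro le measure_ball_pos) auto
        then show ?thesis using True by (simp add: dist_commute mult_right_mono)
      qed (simp add: dist_commute)
    qed
    also have "\<dots> = \<psi> (measure M (ball x ?r)) * ennreal (?r powr (- real DIM('a))) * emeasure lborel (ball x ?r)"
      by (simp add: nn_integral_cmult_indicator)
    also have "\<dots> = \<psi> (measure M (ball x ?r)) * (ennreal (?r powr (- real DIM('a))) * emeasure lborel (ball x ?r))"
      by (simp add: mult.assoc)
    also have "ennreal (?r powr (- real DIM('a))) * emeasure lborel (ball x ?r) = V"
    proof -
      have "?r powr (- real DIM('a)) * (unit_ball_vol (real DIM('a)) * ?r ^ DIM('a)) = unit_ball_vol (real DIM('a))"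
        by (simp add: powr_minus powr_realpow)
      moreover have "emeasure lborel (ball x ?r) = ennreal (unit_ball_vol (real DIM('a)) * ?r ^ DIM('a))"
        by (rule emeasure_ball) (simp add: less_imp_le)
      ultimately show ?thesis unfolding V_def by (metis ennreal_mult' powr_ge_zero)
    qed
    finally show ?thesis by (simp add: mult.commute)
  qed
  then have "scale_integral (\<lambda>k z. \<phi> (measure M (ball z (scale_radius k))) * indicator (ball z (scale_radius k)) x)
    \<le> (\<integral>\<^sup>+k. V * \<psi> (measure M (ball x (scale_radius k))) \<partial>count_space UNIV)"
    unfolding scale_integral_def by (intro nn_integral_mono)
  also have "\<dots> = V * (\<integral>\<^sup>+k. \<psi> (measure M (ball x (scale_radius k))) \<partial>count_space UNIV)"
    by (intro nn_integral_cmult) simp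
  finally show ?thesis by (simp add: V_def)
qed

text \<open>By reverse doubling the M-measures of concentric dyadic balls grow geometrically, so the
  sum over those above the threshold is comparable to its first term.\<close>

lemma overlap_large:
  assumes a: "0 < a"
  obtains C where "0 < C" "\<And>x t. 0 < t \<Longrightarrow>
    scale_integral (\<lambda>k z. ennreal (measure M (ball z (scale_radius k)) powr (- a)) * indicator {u. t \<le> u} (measure M (ball z (scale_radius k)))
      * indicator (ball z (scale_radius k)) x) \<le> ennreal (C * t powr (- a))"
proof -
  obtain D where D: "1 \<le> D" "\<And>z r. 0 < r \<Longrightarrow> measure M (ball z (2 * r)) \<le> D * measure M (ball z r)"
    using doubling by blast
  obtain \<theta> where \<theta>: "0 < \<theta>" "\<theta> < 1" "\<And>z r. 0 < r \<Longrightarrow> measure M (ball z r) \<le> \<theta> * measure M (ball z (2 * r))"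
    using reverse_doubling by blast
  have \<theta>a: "\<theta> powr a < 1" using \<theta> a powr_less_mono2[of a \<theta> 1] by simp
  define C where "C = unit_ball_vol (real DIM('a)) * (D powr a * (D powr a / (1 - \<theta> powr a)))"
  have "0 < C" using D \<theta>a by (auto simp: C_def intro!: mult_pos_pos divide_pos_pos)
  moreover have "scale_integral (\<lambda>k z. ennreal (measure M (ball z (scale_radius k)) powr (- a)) * indicator {u. t \<le> u} (measure M (ball z (scale_radius k)))
      * indicator (ball z (scale_radius k)) x) \<le> ennreal (C * t powr (- a))" if t: "0 < t" for x t
  proof -
    have "scale_integral (\<lambda>k z. (ennreal (measure M (ball z (scale_radius k)) powr (- a)) * indicator {u. t \<le> u} (measure M (ball z (scale_radius k))))
      * indicator (ball z (scale_radius k)) x) \<le> ennreal (unit_ball_vol (real DIM('a))) *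
        (\<integral>\<^sup>+k. ennreal (D powr a) * (ennreal (measure M (ball x (scale_radius k)) powr (- a)) * indicator {k. t / D \<le> measure M (ball x (scale_radius k))} k) \<partial>count_space UNIV)"
    proof (rule order_trans[OF overlap_sum[where D=D and \<phi>="\<lambda>u. ennreal (u powr (-a)) * indicator {u. t \<le> u} u" and
        \<psi>="\<lambda>s. ennreal (D powr a) * (ennreal (s powr (-a)) * indicator {s. t / D \<le> s} s)"]])
      fix u s :: real assume us: "0 < u" "0 < s" "u \<le> D * s" "s \<le> D * u"
      show "ennreal (u powr - a) * indicator {u. t \<le> u} u \<le> ennreal (D powr a) * (ennreal (s powr - a) * indicator {s. t / D \<le> s} s)"
      proof (cases "t \<le> u")
        case True
        \<comment> \<open>Recentering the ball at x changes its measure by a factor of at most D, so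
          the threshold drops to t / D.\<close>
        then have "t / D \<le> s" using us D by (simp add: field_simps)
        have "u powr (-a) \<le> (s / D) powr (-a)" using us D a by (intro powr_mono2') (auto simp: field_simps)
        also have "\<dots> = D powr a * s powr (-a)" using us D by (simp add: powr_divide powr_minus_divide)
        finally show ?thesis using \<open>t / D \<le> s\<close> D True by (simp add: ennreal_leI flip: ennreal_mult)
      qed simp
    qed (use D in \<open>auto simp: indicator_def\<close>)
    also have "\<dots> \<le> ennreal (unit_ball_vol (real DIM('a))) * (ennreal (D powr a) * ennreal ((t / D) powr (-a) / (1 - \<theta> powr a)))"
    proof (subst nn_integral_cmult)
      show "ennreal (unit_ball_vol (real DIM('a))) * (ennreal (D powr a) *
        (\<integral>\<^sup>+k. ennreal (measure M (ball x (scale_radius k)) powr (- a)) * indicator {k. t / D \<le> measure M (ball x (scale_radius k))} k \<partial>count_space UNIV))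
        \<le> ennreal (unit_ball_vol (real DIM('a))) * (ennreal (D powr a) * ennreal ((t / D) powr (-a) / (1 - \<theta> powr a)))"
        using \<theta> t D a
        by (intro mult_left_mono geometric_growth_sum_ge) (auto simp: scale_radius_Suc intro!: measure_ball_pos)
    qed simp
    also have "\<dots> = ennreal (C * t powr (-a))"
    proof -
      have "unit_ball_vol (real DIM('a)) * (D powr a * ((t / D) powr (-a) / (1 - \<theta> powr a))) = C * t powr (-a)"
        using t D by (simp add: C_def powr_divide powr_minus_divide)
      then show ?thesis using D \<theta>a by (simp add: ennreal_mult[symmetric])
    qed
    finally show ?thesis .
  qed
  ultimately show ?thesis by (rule that)
qed

text \<open>Companion of \<open>overlap_large\<close>: the sum runs towards small balls, where a
  positive power makes it converge.\<close>

lemma overlap_small: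
  assumes a: "0 < a"
  obtains C where "0 < C" "\<And>x t. 0 < t \<Longrightarrow>
    scale_integral (\<lambda>k z. ennreal (measure M (ball z (scale_radius k)) powr a) * indicator {u. u \<le> t} (measure M (ball z (scale_radius k)))
      * indicator (ball z (scale_radius k)) x) \<le> ennreal (C * t powr a)"
proof -
  obtain D where D: "1 \<le> D" "\<And>z r. 0 < r \<Longrightarrow> measure M (ball z (2 * r)) \<le> D * measure M (ball z r)"
    using doubling by blast
  obtain \<theta> where \<theta>: "0 < \<theta>" "\<theta> < 1" "\<And>z r. 0 < r \<Longrightarrow> measure M (ball z r) \<le> \<theta> * measure M (ball z (2 * r))"
    using reverse_doubling by blast
  have \<theta>a: "\<theta> powr a < 1" using \<theta> a powr_less_mono2[of a \<theta> 1] by simp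
  define C where "C = unit_ball_vol (real DIM('a)) * (D powr a * (D powr a / (1 - \<theta> powr a)))"
  have "0 < C" using D \<theta>a by (auto simp: C_def intro!: mult_pos_pos divide_pos_pos)
  moreover have "scale_integral (\<lambda>k z. ennreal (measure M (ball z (scale_radius k)) powr a) * indicator {u. u \<le> t} (measure M (ball z (scale_radius k)))
      * indicator (ball z (scale_radius k)) x) \<le> ennreal (C * t powr a)" if t: "0 < t" for x t
  proof -
    have "scale_integral (\<lambda>k z. (ennreal (measure M (ball z (scale_radius k)) powr a) * indicator {u. u \<le> t} (measure M (ball z (scale_radius k))))
      * indicator (ball z (scale_radius k)) x) \<le> ennreal (unit_ball_vol (real DIM('a))) *
        (\<integral>\<^sup>+k. ennreal (D powr a) * (ennreal (measure M (ball x (scale_radius k)) powr a) * indicator {k. measure M (ball x (scale_radius k)) \<le> D * t} k) \<partial>count_space UNIV)"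
    proof (rule order_trans[OF overlap_sum[where D=D and \<phi>="\<lambda>u. ennreal (u powr a) * indicator {u. u \<le> t} u" and
        \<psi>="\<lambda>s. ennreal (D powr a) * (ennreal (s powr a) * indicator {s. s \<le> D * t} s)"]])
      fix u s :: real assume us: "0 < u" "0 < s" "u \<le> D * s" "s \<le> D * u"
      show "ennreal (u powr a) * indicator {u. u \<le> t} u \<le> ennreal (D powr a) * (ennreal (s powr a) * indicator {s. s \<le> D * t} s)"
      proof (cases "u \<le> t")
        case True
        then have "D * u \<le> D * t" using D by simp
        then have "s \<le> D * t" using us by linarith
        have "u powr a \<le> (D * s) powr a" using us D a by (intro powr_mono2) auto
        also have "\<dots> = D powr a * s powr a" using us D by (simp add: powr_mult)
        finally show ?thesis using \<open>s \<le> D * t\<close> D True by (simp add: ennreal_leI flip: ennreal_mult)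
      qed simp
    qed (use D in \<open>auto simp: indicator_def\<close>)
    also have "\<dots> \<le> ennreal (unit_ball_vol (real DIM('a))) * (ennreal (D powr a) * ennreal ((D * t) powr a / (1 - \<theta> powr a)))"
    proof (subst nn_integral_cmult)
      show "ennreal (unit_ball_vol (real DIM('a))) * (ennreal (D powr a) *
        (\<integral>\<^sup>+k. ennreal (measure M (ball x (scale_radius k)) powr a) * indicator {k. measure M (ball x (scale_radius k)) \<le> D * t} k \<partial>count_space UNIV))
        \<le> ennreal (unit_ball_vol (real DIM('a))) * (ennreal (D powr a) * ennreal ((D * t) powr a / (1 - \<theta> powr a)))"
        using \<theta> t D a
        by (intro mult_left_mono geometric_growth_sum_le) (auto simp: scale_radius_Suc intro!: measure_ball_pos)
    qed simp
    also have "\<dots> = ennreal (C * t powr a)"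
    proof -
      have "unit_ball_vol (real DIM('a)) * (D powr a * ((D * t) powr a / (1 - \<theta> powr a))) = C * t powr a"
        using t D by (simp add: C_def powr_mult)
      then show ?thesis using D \<theta>a by (simp add: ennreal_mult[symmetric])
    qed
    finally show ?thesis .
  qed
  ultimately show ?thesis by (rule that)
qed


lemma Holder_ball:
  assumes [measurable]: "f \<in> borel_measurable borel" "g \<in> borel_measurable borel"
    and p: "1 < p" "1 / p + 1 / p' = 1"
  shows "(\<integral>\<^sup>+x\<in>ball z r. f x * g x \<partial>M) \<le>
    (\<integral>\<^sup>+x\<in>ball z r. f x ennpowr p \<partial>M) ennpowr (1 / p) * (\<integral>\<^sup>+x\<in>ball z r. g x ennpowr p' \<partial>M) ennpowr (1 / p')"
proof -
  have p': "1 < p'" using p by (rule conjugate_exponent_gt_1)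
  have "(\<integral>\<^sup>+x\<in>ball z r. f x * g x \<partial>M) = (\<integral>\<^sup>+x. (f x * indicator (ball z r) x) * (g x * indicator (ball z r) x) \<partial>M)"
    by (intro nn_integral_cong) (auto simp: indicator_def)
  also have "\<dots> \<le> (\<integral>\<^sup>+x. (f x * indicator (ball z r) x) ennpowr p \<partial>M) ennpowr (1 / p) *
     (\<integral>\<^sup>+x. (g x * indicator (ball z r) x) ennpowr p' \<partial>M) ennpowr (1 / p')"
    by (rule Holder_nn_integral[OF _ _ p]) measurable
  also have "(\<integral>\<^sup>+x. (f x * indicator (ball z r) x) ennpowr p \<partial>M) = (\<integral>\<^sup>+x\<in>ball z r. f x ennpowr p \<partial>M)"
    using p by (intro nn_integral_cong) (auto simp: indicator_def)
  also have "(\<integral>\<^sup>+x. (g x * indicator (ball z r) x) ennpowr p' \<partial>M) = (\<integral>\<^sup>+x\<in>ball z r. g x ennpowr p' \<partial>M)"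
    using p' by (intro nn_integral_cong) (auto simp: indicator_def)
  finally show ?thesis .
qed

lemma Holder_ball_const:
  assumes [measurable]: "f \<in> borel_measurable borel" and p: "1 < p" and r: "0 < r"
  shows "(\<integral>\<^sup>+x\<in>ball z r. f x \<partial>M) \<le>
    ennreal (measure M (ball z r) powr (1 - 1 / p)) * (\<integral>\<^sup>+x\<in>ball z r. f x ennpowr p \<partial>M) ennpowr (1 / p)"
proof -
  define p' where "p' = p / (p - 1)"
  have pp: "1 / p + 1 / p' = 1" "1 / p' = 1 - 1 / p" using p by (auto simp: p'_def field_simps)
  have "(\<integral>\<^sup>+x\<in>ball z r. f x * 1 \<partial>M) \<le>
    (\<integral>\<^sup>+x\<in>ball z r. f x ennpowr p \<partial>M) ennpowr (1 / p) * (\<integral>\<^sup>+x\<in>ball z r. 1 ennpowr p' \<partial>M) ennpowr (1 / p')"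
    by (rule Holder_ball[OF _ _ p pp(1)]) measurable
  also have "(\<integral>\<^sup>+x\<in>ball z r. 1 ennpowr p' \<partial>M) ennpowr (1 / p') = ennreal (measure M (ball z r) powr (1 - 1 / p))"
    using measure_ball_pos[OF r, of z] by (simp add: emeasure_ball_eq ennpowr_ennreal pp(2))
  finally show ?thesis by (simp add: mult.commute)
qed

lemma Jensen_ball:
  assumes [measurable]: "f \<in> borel_measurable borel" and p: "1 < p" and r: "0 < r"
  shows "(\<integral>\<^sup>+x\<in>ball z r. f x \<partial>M) ennpowr p \<le>
    ennreal (measure M (ball z r) powr (p - 1)) * (\<integral>\<^sup>+x\<in>ball z r. f x ennpowr p \<partial>M)"
proof -
  have "(\<integral>\<^sup>+x\<in>ball z r. f x \<partial>M) ennpowr p \<le>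
    (ennreal (measure M (ball z r) powr (1 - 1 / p)) * (\<integral>\<^sup>+x\<in>ball z r. f x ennpowr p \<partial>M) ennpowr (1 / p)) ennpowr p"
    using p r by (intro ennpowr_mono Holder_ball_const) auto
  also have "\<dots> = ennreal (measure M (ball z r) powr (p - 1)) * (\<integral>\<^sup>+x\<in>ball z r. f x ennpowr p \<partial>M)"
  proof -
    have "(1 - 1 / p) * p = p - 1" using p by (simp add: field_simps)
    then show ?thesis using p measure_ball_pos[OF r, of z]
      by (simp add: ennpowr_mult ennpowr_ennpowr ennpowr_ennreal powr_powr)
  qed
  finally show ?thesis .
qed

text \<open>
  Split F at height \<open>M(B) powr (-1/P)\<close>. The large part contributes at most 1 per ball, so its power
  is dominated by its first power; the small part is handled by Jensen's inequality.
  After exchanging the integrals both leave a geometric sum over the scales.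
\<close>

lemma fractional_embedding:
  assumes P: "1 < P" "P < \<tau>"
  obtains C where "0 < C"
    "\<And>F. F \<in> borel_measurable borel \<Longrightarrow> (\<And>x. 0 \<le> F x) \<Longrightarrow> (\<integral>\<^sup>+x. ennreal (F x powr P) \<partial>M) \<le> 1 \<Longrightarrow>
      scale_integral (\<lambda>k z. (ennreal (measure M (ball z (scale_radius k)) powr (1 / P - 1)) *
        (\<integral>\<^sup>+x\<in>ball z (scale_radius k). ennreal (F x) \<partial>M)) ennpowr \<tau>) \<le> ennreal C"
proof -
  define \<mu> where "\<mu> k z = measure M (ball z (scale_radius k))" for k z
  have \<mu>_pos: "0 < \<mu> k z" for k z by (simp add: \<mu>_def measure_ball_pos)
  have [measurable]: "\<mu> k \<in> borel_measurable borel" for k unfolding \<mu>_def by measurable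
  have exps: "0 < 1 - 1 / P" "0 < \<tau> / P - 1" using P by (auto simp: field_simps)
  obtain C1 where C1: "0 < C1" "\<And>x t. 0 < t \<Longrightarrow>
    scale_integral (\<lambda>k z. ennreal (\<mu> k z powr (- (1 - 1 / P))) * indicator {u. t \<le> u} (\<mu> k z)
      * indicator (ball z (scale_radius k)) x) \<le> ennreal (C1 * t powr (- (1 - 1 / P)))"
    unfolding \<mu>_def by (rule overlap_large[OF exps(1)]) blast
  obtain C2 where C2: "0 < C2" "\<And>x t. 0 < t \<Longrightarrow>
    scale_integral (\<lambda>k z. ennreal (\<mu> k z powr (\<tau> / P - 1)) * indicator {u. u \<le> t} (\<mu> k z)
      * indicator (ball z (scale_radius k)) x) \<le> ennreal (C2 * t powr (\<tau> / P - 1))"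
    unfolding \<mu>_def by (rule overlap_small[OF exps(2)]) blast
  define C where "C = 2 powr \<tau> * (C1 + C2)"
  have "0 < C" using C1 C2 by (simp add: C_def)
  moreover have "scale_integral (\<lambda>k z. (ennreal (\<mu> k z powr (1 / P - 1)) *
        (\<integral>\<^sup>+x\<in>ball z (scale_radius k). ennreal (F x) \<partial>M)) ennpowr \<tau>) \<le> ennreal C"
    if F [measurable]: "F \<in> borel_measurable borel" and F0: "\<And>x. 0 \<le> F x"
      and F1: "(\<integral>\<^sup>+x. ennreal (F x powr P) \<partial>M) \<le> 1" for F
  proof -
    define Fb where "Fb k z x = ennreal (F x) * indicator {t. \<mu> k z powr (- (1 / P)) < t} (F x)" for k z x
    define Fs where "Fs k z x = ennreal (F x) * indicator {t. t \<le> \<mu> k z powr (- (1 / P))} (F x)" for k z x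
    have [measurable]: "(\<lambda>p. Fb k (fst p) (snd p)) \<in> borel_measurable (borel \<Otimes>\<^sub>M borel)"
      "(\<lambda>p. Fs k (fst p) (snd p)) \<in> borel_measurable (borel \<Otimes>\<^sub>M borel)"
      "Fb k z \<in> borel_measurable borel" "Fs k z \<in> borel_measurable borel" for k z
      unfolding Fb_def Fs_def by measurable
    define b where "b k z = ennreal (\<mu> k z powr (1 / P - 1)) * (\<integral>\<^sup>+x\<in>ball z (scale_radius k). Fb k z x \<partial>M)" for k z
    define s where "s k z = ennreal (\<mu> k z powr (1 / P - 1)) * (\<integral>\<^sup>+x\<in>ball z (scale_radius k). Fs k z x \<partial>M)" for k z
    \<comment> \<open>The condition on the height of F x is turned into one on the mass of the ball,
      F x powr (-P) <= \<mu>. After the exchange of integrals x is fixed, and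
      \<open>overlap_large\<close> applies with this threshold; \<open>Hs\<close> is the counterpart
      for \<open>overlap_small\<close>.\<close>
    define Hb where "Hb k z x = ennreal (F x) * (ennreal (\<mu> k z powr (- (1 - 1 / P))) * indicator {u. F x powr (- P) \<le> u} (\<mu> k z)
      * indicator (ball z (scale_radius k)) x)" for k z x
    define Hs where "Hs k z x = ennreal (F x powr \<tau>) * (ennreal (\<mu> k z powr (\<tau> / P - 1)) * indicator {u. u \<le> F x powr (- P)} (\<mu> k z)
      * indicator (ball z (scale_radius k)) x)" for k z x
    have ind: "indicator {u. F x powr (- P) \<le> u} (\<mu> k z) = (indicator {p. F (snd p) powr (- P) \<le> \<mu> k (fst p)} (z, x) :: ennreal)"
       "indicator {u. u \<le> F x powr (- P)} (\<mu> k z) = (indicator {p. \<mu> k (fst p) \<le> F (snd p) powr (- P)} (z, x) :: ennreal)" for x k z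
      by (auto simp: indicator_def)
    have [measurable]: "(\<lambda>(z, x). Hb k z x) \<in> borel_measurable (borel \<Otimes>\<^sub>M M)"
      "(\<lambda>(z, x). Hs k z x) \<in> borel_measurable (borel \<Otimes>\<^sub>M M)" for k
      unfolding Hb_def Hs_def ind by measurable
    have split: "ennreal (\<mu> k z powr (1 / P - 1)) * (\<integral>\<^sup>+x\<in>ball z (scale_radius k). ennreal (F x) \<partial>M) = b k z + s k z" for k z
    proof -
      have "(\<integral>\<^sup>+x\<in>ball z (scale_radius k). ennreal (F x) \<partial>M) =
        (\<integral>\<^sup>+x\<in>ball z (scale_radius k). Fb k z x \<partial>M) + (\<integral>\<^sup>+x\<in>ball z (scale_radius k). Fs k z x \<partial>M)"
        by (subst nn_integral_add[symmetric]) (auto simp: Fb_def Fs_def indicator_def intro!: nn_integral_cong)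
      then show ?thesis by (simp add: b_def s_def distrib_left)
    qed
    \<comment> \<open>On the large part F <= \<mu>^(1 - 1/P) F^P, so the normalized integral over
      the ball is at most the whole integral of F^P.\<close>
    have b1: "b k z \<le> 1" for k z
    proof -
      have "(\<integral>\<^sup>+x\<in>ball z (scale_radius k). Fb k z x \<partial>M) \<le> (\<integral>\<^sup>+x. ennreal (\<mu> k z powr (1 - 1 / P)) * ennreal (F x powr P) \<partial>M)"
      proof (intro nn_integral_mono)
        fix x
        have "F x \<le> \<mu> k z powr (1 - 1 / P) * F x powr P" if "\<mu> k z powr (- (1 / P)) < F x"
        proof -
          have pos: "0 < F x" using that by (smt (verit) powr_ge_zero)
          have "F x = F x powr (1 - P) * F x powr P" using pos by (simp flip: powr_add)
          also have "\<dots> \<le> (\<mu> k z powr (- (1 / P))) powr (1 - P) * F x powr P"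
            using that P \<mu>_pos[of k z] by (intro mult_right_mono powr_mono2') auto
          also have "(\<mu> k z powr (- (1 / P))) powr (1 - P) = \<mu> k z powr (1 - 1 / P)"
          proof -
            have "- (1 / P) * (1 - P) = 1 - 1 / P" using P by (simp add: field_simps)
            then show ?thesis by (simp only: powr_powr)
          qed
          finally show ?thesis .
        qed
        then show "Fb k z x * indicator (ball z (scale_radius k)) x \<le> ennreal (\<mu> k z powr (1 - 1 / P)) * ennreal (F x powr P)"
          by (auto simp: Fb_def indicator_def ennreal_leI simp flip: ennreal_mult)
      qed
      also have "\<dots> = ennreal (\<mu> k z powr (1 - 1 / P)) * (\<integral>\<^sup>+x. ennreal (F x powr P) \<partial>M)"
        by (simp add: nn_integral_cmult)
      also have "\<dots> \<le> ennreal (\<mu> k z powr (1 - 1 / P)) * 1" using F1 by (intro mult_left_mono) auto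
      finally have "b k z \<le> ennreal (\<mu> k z powr (1 / P - 1)) * ennreal (\<mu> k z powr (1 - 1 / P))"
        unfolding b_def by (intro mult_left_mono) auto
      also have "\<dots> = 1" using \<mu>_pos[of k z] by (simp flip: ennreal_mult powr_add)
      finally show ?thesis .
    qed
    have b2: "b k z ennpowr \<tau> \<le> (\<integral>\<^sup>+x. Hb k z x \<partial>M)" for k z
    proof -
      have "b k z ennpowr \<tau> \<le> b k z" using P by (intro ennpowr_le_self b1) auto
      also have "\<dots> = (\<integral>\<^sup>+x. ennreal (\<mu> k z powr (1 / P - 1)) * (Fb k z x * indicator (ball z (scale_radius k)) x) \<partial>M)"
        by (simp add: b_def nn_integral_cmult)
      also have "\<dots> \<le> (\<integral>\<^sup>+x. Hb k z x \<partial>M)"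
      proof (intro nn_integral_mono)
        fix x
        have "F x powr (- P) \<le> \<mu> k z" if "\<mu> k z powr (- (1 / P)) < F x"
        proof -
          have "F x powr (- P) \<le> (\<mu> k z powr (- (1 / P))) powr (- P)"
            using that P \<mu>_pos[of k z] by (intro powr_mono2') auto
          also have "\<dots> = \<mu> k z" using P \<mu>_pos[of k z] by (simp add: powr_powr)
          finally show ?thesis .
        qed
        then show "ennreal (\<mu> k z powr (1 / P - 1)) * (Fb k z x * indicator (ball z (scale_radius k)) x) \<le> Hb k z x"
          by (auto simp: Fb_def Hb_def indicator_def mult.commute)
      qed
      finally show ?thesis .
    qed
    have s2: "s k z ennpowr \<tau> \<le> (\<integral>\<^sup>+x. Hs k z x \<partial>M)" for k z
    proof -
      have "s k z ennpowr \<tau> = ennreal (\<mu> k z powr (\<tau> / P - \<tau>)) * (\<integral>\<^sup>+x\<in>ball z (scale_radius k). Fs k z x \<partial>M) ennpowr \<tau>"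
      proof -
        have "(1 / P - 1) * \<tau> = \<tau> / P - \<tau>" by (simp add: field_simps)
        then show ?thesis
          using P \<mu>_pos[of k z] by (simp add: s_def ennpowr_mult ennpowr_ennreal powr_powr)
      qed
      also have "\<dots> \<le> ennreal (\<mu> k z powr (\<tau> / P - \<tau>)) * (ennreal (\<mu> k z powr (\<tau> - 1)) * (\<integral>\<^sup>+x\<in>ball z (scale_radius k). Fs k z x ennpowr \<tau> \<partial>M))"
        unfolding \<mu>_def using P by (intro mult_left_mono Jensen_ball) auto
      also have "\<dots> = ennreal (\<mu> k z powr (\<tau> / P - 1)) * (\<integral>\<^sup>+x\<in>ball z (scale_radius k). Fs k z x ennpowr \<tau> \<partial>M)"
        using \<mu>_pos[of k z] by (simp add: mult.assoc[symmetric] flip: ennreal_mult powr_add)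
      also have "\<dots> = (\<integral>\<^sup>+x. ennreal (\<mu> k z powr (\<tau> / P - 1)) * (Fs k z x ennpowr \<tau> * indicator (ball z (scale_radius k)) x) \<partial>M)"
        by (simp add: nn_integral_cmult)
      also have "\<dots> \<le> (\<integral>\<^sup>+x. Hs k z x \<partial>M)"
      proof (intro nn_integral_mono)
        fix x
        \<comment> \<open>F x = 0 is excluded: \<open>0 powr (- P)\<close> is 0, so the converted
          condition would fail there, but then the integrand vanishes anyway.\<close>
        have "\<mu> k z \<le> F x powr (- P)" if "F x \<le> \<mu> k z powr (- (1 / P))" "F x \<noteq> 0"
        proof -
          have "\<mu> k z = (\<mu> k z powr (- (1 / P))) powr (- P)"
            using P \<mu>_pos[of k z] by (simp add: powr_powr)
          also have "\<dots> \<le> F x powr (- P)"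
            using that P F0[of x] by (intro powr_mono2') auto
          finally show ?thesis .
        qed
        moreover have "Fs k z x ennpowr \<tau> = ennreal (F x powr \<tau>) * indicator {t. t \<le> \<mu> k z powr (- (1 / P))} (F x)"
          using P F0[of x] by (auto simp: Fs_def indicator_def ennpowr_ennreal')
        ultimately show "ennreal (\<mu> k z powr (\<tau> / P - 1)) * (Fs k z x ennpowr \<tau> * indicator (ball z (scale_radius k)) x) \<le> Hs k z x"
          by (cases "F x = 0") (auto simp: Hs_def indicator_def mult.commute)
      qed
      finally show ?thesis .
    qed
    have Jb: "scale_integral (\<lambda>k z. \<integral>\<^sup>+x. Hb k z x \<partial>M) \<le> ennreal C1"
    proof -
      have "scale_integral (\<lambda>k z. \<integral>\<^sup>+x. Hb k z x \<partial>M) = (\<integral>\<^sup>+x. scale_integral (\<lambda>k z. Hb k z x) \<partial>M)"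
        by (rule scale_integral_swap[OF sigma_finite_M]) measurable
      also have "\<dots> \<le> (\<integral>\<^sup>+x. ennreal C1 * ennreal (F x powr P) \<partial>M)"
      proof (intro nn_integral_mono)
        fix x
        show "scale_integral (\<lambda>k z. Hb k z x) \<le> ennreal C1 * ennreal (F x powr P)"
        proof (cases "F x = 0")
          case False
          then have pos: "0 < F x" using F0[of x] by simp
          have "scale_integral (\<lambda>k z. Hb k z x) = ennreal (F x) * scale_integral (\<lambda>k z. ennreal (\<mu> k z powr (- (1 - 1 / P))) *
            indicator {u. F x powr (- P) \<le> u} (\<mu> k z) * indicator (ball z (scale_radius k)) x)"
            unfolding Hb_def by (rule scale_integral_cmult) measurable
          also have "\<dots> \<le> ennreal (F x) * ennreal (C1 * (F x powr (- P)) powr (- (1 - 1 / P)))"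
            using pos by (intro mult_left_mono C1) auto
          also have "\<dots> = ennreal (F x * (C1 * (F x powr (- P)) powr (- (1 - 1 / P))))"
            using pos by (simp only: ennreal_mult' less_imp_le)
          also have "(F x powr (- P)) powr (- (1 - 1 / P)) = F x powr (P - 1)"
          proof -
            have "- P * - (1 - 1 / P) = P - 1" using P by (simp add: field_simps)
            then show ?thesis by (simp only: powr_powr)
          qed
          also have "F x * (C1 * F x powr (P - 1)) = C1 * F x powr P"
            using pos powr_mult_base[of "F x" "P - 1"] by simp
          finally show ?thesis using C1(1) by (simp only: ennreal_mult' less_imp_le)
        qed (simp add: Hb_def scale_integral_def)
      qed
      also have "\<dots> = ennreal C1 * (\<integral>\<^sup>+x. ennreal (F x powr P) \<partial>M)" by (simp add: nn_integral_cmult)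
      also have "\<dots> \<le> ennreal C1 * 1" using F1 by (intro mult_left_mono) auto
      finally show ?thesis by simp
    qed
    have Js: "scale_integral (\<lambda>k z. \<integral>\<^sup>+x. Hs k z x \<partial>M) \<le> ennreal C2"
    proof -
      have "scale_integral (\<lambda>k z. \<integral>\<^sup>+x. Hs k z x \<partial>M) = (\<integral>\<^sup>+x. scale_integral (\<lambda>k z. Hs k z x) \<partial>M)"
        by (rule scale_integral_swap[OF sigma_finite_M]) measurable
      also have "\<dots> \<le> (\<integral>\<^sup>+x. ennreal C2 * ennreal (F x powr P) \<partial>M)"
      proof (intro nn_integral_mono)
        fix x
        show "scale_integral (\<lambda>k z. Hs k z x) \<le> ennreal C2 * ennreal (F x powr P)"
        proof (cases "F x = 0")
          case False
          then have pos: "0 < F x" using F0[of x] by simp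
          have "scale_integral (\<lambda>k z. Hs k z x) = ennreal (F x powr \<tau>) * scale_integral (\<lambda>k z. ennreal (\<mu> k z powr (\<tau> / P - 1)) *
            indicator {u. u \<le> F x powr (- P)} (\<mu> k z) * indicator (ball z (scale_radius k)) x)"
            unfolding Hs_def by (rule scale_integral_cmult) measurable
          also have "\<dots> \<le> ennreal (F x powr \<tau>) * ennreal (C2 * (F x powr (- P)) powr (\<tau> / P - 1))"
            using pos by (intro mult_left_mono C2) auto
          also have "\<dots> = ennreal (F x powr \<tau> * (C2 * (F x powr (- P)) powr (\<tau> / P - 1)))"
            by (simp only: ennreal_mult' powr_ge_zero)
          also have "(F x powr (- P)) powr (\<tau> / P - 1) = F x powr (P - \<tau>)"
          proof -
            have "- P * (\<tau> / P - 1) = P - \<tau>" using P by (simp add: field_simps)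
            then show ?thesis by (simp only: powr_powr)
          qed
          also have "F x powr \<tau> * (C2 * F x powr (P - \<tau>)) = C2 * F x powr P"
            using pos by (simp flip: powr_add)
          finally show ?thesis using C2(1) by (simp only: ennreal_mult' less_imp_le)
        qed (simp add: Hs_def scale_integral_def)
      qed
      also have "\<dots> = ennreal C2 * (\<integral>\<^sup>+x. ennreal (F x powr P) \<partial>M)" by (simp add: nn_integral_cmult)
      also have "\<dots> \<le> ennreal C2 * 1" using F1 by (intro mult_left_mono) auto
      finally show ?thesis by simp
    qed
    interpret sigma_finite_measure M by (rule sigma_finite_M)
    have [measurable]: "(\<lambda>z. \<integral>\<^sup>+x. Hb k z x \<partial>M) \<in> borel_measurable borel" "(\<lambda>z. \<integral>\<^sup>+x. Hs k z x \<partial>M) \<in> borel_measurable borel" for k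
      by measurable
    have "scale_integral (\<lambda>k z. (ennreal (\<mu> k z powr (1 / P - 1)) * (\<integral>\<^sup>+x\<in>ball z (scale_radius k). ennreal (F x) \<partial>M)) ennpowr \<tau>)
      \<le> scale_integral (\<lambda>k z. ennreal (2 powr \<tau>) * ((\<integral>\<^sup>+x. Hb k z x \<partial>M) + (\<integral>\<^sup>+x. Hs k z x \<partial>M)))"
    proof (rule scale_integral_mono)
      fix k z
      have "(b k z + s k z) ennpowr \<tau> \<le> ennreal (2 powr \<tau>) * (b k z ennpowr \<tau> + s k z ennpowr \<tau>)"
        using P by (intro ennpowr_add_le) auto
      also have "\<dots> \<le> ennreal (2 powr \<tau>) * ((\<integral>\<^sup>+x. Hb k z x \<partial>M) + (\<integral>\<^sup>+x. Hs k z x \<partial>M))"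
        by (intro mult_left_mono add_mono b2 s2) auto
      finally show "(ennreal (\<mu> k z powr (1 / P - 1)) * (\<integral>\<^sup>+x\<in>ball z (scale_radius k). ennreal (F x) \<partial>M)) ennpowr \<tau>
        \<le> ennreal (2 powr \<tau>) * ((\<integral>\<^sup>+x. Hb k z x \<partial>M) + (\<integral>\<^sup>+x. Hs k z x \<partial>M))" by (simp add: split)
    qed
    also have "\<dots> = ennreal (2 powr \<tau>) * (scale_integral (\<lambda>k z. \<integral>\<^sup>+x. Hb k z x \<partial>M) + scale_integral (\<lambda>k z. \<integral>\<^sup>+x. Hs k z x \<partial>M))"
      by (subst scale_integral_cmult) (auto simp: scale_integral_add)
    also have "\<dots> \<le> ennreal (2 powr \<tau>) * (ennreal C1 + ennreal C2)"
      by (intro mult_left_mono add_mono Jb Js) auto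
    also have "\<dots> = ennreal C" using C1 C2 by (simp add: C_def flip: ennreal_mult ennreal_plus)
    finally show ?thesis .
  qed
  ultimately show ?thesis unfolding \<mu>_def by (rule that)
qed

end

section \<open>The two-weight commutator estimate\<close>

text \<open>A single dyadic scale of size comparable to |x - y| already gives the bound, since a
  whole ball of centers z has both points in \<open>ball z r\<close>. On the diagonal the left side
  is 0, the value of \<open>powr\<close> at base 0.\<close>

lemma kernel_le_scale_integral:
  assumes "\<gamma> < real DIM('a::euclidean_space)"
  obtains C where "0 < C" "\<And>x y::'a. ennreal (norm (x - y) powr (\<gamma> - real DIM('a))) \<le>
    ennreal C * scale_integral (\<lambda>k z. ennreal (scale_radius k powr (\<gamma> - real DIM('a))) *
      (indicator (ball z (scale_radius k)) x * indicator (ball z (scale_radius k)) y))"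
proof -
  let ?n = "real DIM('a)"
  define V where "V = unit_ball_vol ?n"
  have V: "0 < V" by (simp add: V_def)
  \<comment> \<open>4^(n - \<gamma>) pays for r <= 4 d, and 2^n / V for the volume of the centers in
    \<open>ball x (r / 2)\<close>.\<close>
  define C where "C = 4 powr (?n - \<gamma>) * 2 ^ DIM('a) / V"
  have C: "0 < C" using V by (simp add: C_def)
  moreover have "ennreal (norm (x - y) powr (\<gamma> - ?n)) \<le>
    ennreal C * scale_integral (\<lambda>k z. ennreal (scale_radius k powr (\<gamma> - ?n)) *
      (indicator (ball z (scale_radius k)) x * indicator (ball z (scale_radius k)) y))" for x y :: 'a
  proof (cases "x = y")
    case False
    define d where "d = dist x y"
    have d: "0 < d" using False by (simp add: d_def)
    \<comment> \<open>The shift by 2 gives 2 d < r <= 4 d: the lower bound lets every z in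
      \<open>ball x (r / 2)\<close> reach y, the upper one compares r with the kernel.\<close>
    define k where "k = \<lfloor>log 2 d\<rfloor> + 2"
    define r where "r = scale_radius k"
    have r: "0 < r" by (simp add: r_def)
    have "2 powr (real_of_int k - 2) \<le> 2 powr (log 2 d)" by (intro powr_mono) (auto simp: k_def)
    then have r1: "r \<le> 4 * d" using d by (simp add: r_def scale_radius_def powr_diff)
    have "2 powr (log 2 d) < 2 powr (real_of_int k - 1)" by (intro powr_less_mono) (simp_all add: k_def, linarith)
    then have r2: "d < r / 2" using d by (simp add: r_def scale_radius_def powr_diff)
    have "d powr (\<gamma> - ?n) = 4 powr (?n - \<gamma>) * (4 * d) powr (\<gamma> - ?n)"
      using d by (simp add: powr_mult powr_add[symmetric])
    also have "\<dots> \<le> 4 powr (?n - \<gamma>) * r powr (\<gamma> - ?n)"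
      using r r1 assms by (intro mult_left_mono powr_mono2') auto
    also have "\<dots> = C * (r powr (\<gamma> - ?n) * r powr (- ?n) * (V * (r / 2) ^ DIM('a)))"
      using r V by (simp add: C_def powr_minus powr_realpow power_divide)
    finally have "ennreal (d powr (\<gamma> - ?n)) \<le> ennreal (C * (r powr (\<gamma> - ?n) * r powr (- ?n) * (V * (r / 2) ^ DIM('a))))"
      by (rule ennreal_leI)
    also have "\<dots> = ennreal C * (ennreal (r powr (\<gamma> - ?n) * r powr (- ?n)) * emeasure lborel (ball x (r / 2)))"
      using C V r by (simp only: emeasure_ball V_def[symmetric] ennreal_mult' less_imp_le powr_ge_zero mult_nonneg_nonneg half_gt_zero)
    also have "\<dots> = ennreal C * (\<integral>\<^sup>+z. ennreal (r powr (\<gamma> - ?n) * r powr (- ?n)) * indicator (ball x (r / 2)) z \<partial>lborel)"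
      by (simp add: nn_integral_cmult_indicator)
    also have "\<dots> \<le> ennreal C * (\<integral>\<^sup>+z. ennreal (r powr (\<gamma> - ?n)) * (indicator (ball z r) x * indicator (ball z r) y) * ennreal (r powr (- ?n)) \<partial>lborel)"
    proof (intro mult_left_mono nn_integral_mono)
      fix z
      have "x \<in> ball z r \<and> y \<in> ball z r" if "z \<in> ball x (r / 2)"
        using that r2 r dist_triangle[of z y x] by (auto simp: d_def dist_commute)
      then show "ennreal (r powr (\<gamma> - ?n) * r powr (- ?n)) * indicator (ball x (r / 2)) z \<le>
        ennreal (r powr (\<gamma> - ?n)) * (indicator (ball z r) x * indicator (ball z r) y) * ennreal (r powr (- ?n))"
        by (cases "z \<in> ball x (r / 2)") (simp_all add: ennreal_mult)
    qed simp
    also have "\<dots> \<le> ennreal C * scale_integral (\<lambda>k z. ennreal (scale_radius k powr (\<gamma> - ?n)) *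
      (indicator (ball z (scale_radius k)) x * indicator (ball z (scale_radius k)) y))"
      unfolding scale_integral_def r_def
      by (intro mult_left_mono nn_integral_ge_point) auto
    finally show ?thesis by (simp add: d_def dist_norm)
  qed simp
  ultimately show ?thesis by (rule that)
qed

section \<open>Averages with an oscillation factor, and their embedding\<close>

context A_infty_measure
begin

text \<open>The oscillation is absorbed by its moment of conjugate order m', finite by
  \<open>John_Nirenberg_moment\<close>. The price is an L^m average of G in place of an L^1 average,
  with any m > 1.\<close>

lemma oscillation_Holder:
  fixes b :: "'a \<Rightarrow> 'b::euclidean_space"
  assumes b: "mean_oscillation_bound b c N" and m: "1 < m"
  obtains C where "0 < C"
    "\<And>G z r. G \<in> borel_measurable borel \<Longrightarrow> 0 < r \<Longrightarrow>
      (\<integral>\<^sup>+x\<in>ball z r. G x * ennreal (norm (b x - c z r)) \<partial>M) \<le>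
      ennreal C * (ennreal (measure M (ball z r) powr (1 - 1 / m)) * (\<integral>\<^sup>+x\<in>ball z r. G x ennpowr m \<partial>M) ennpowr (1 / m))"
proof -
  have [measurable]: "b \<in> borel_measurable borel" using b by (simp add: mean_oscillation_bound_def)
  define m' where "m' = m / (m - 1)"
  have mm: "1 / m + 1 / m' = 1" "1 / m' = 1 - 1 / m" and m': "1 < m'"
    using m by (auto simp: m'_def field_simps)
  have "0 < m'" using m' by simp
  from John_Nirenberg_moment[OF b this] obtain C where C: "0 < C"
    "\<And>z r. 0 < r \<Longrightarrow> (\<integral>\<^sup>+x\<in>ball z r. ennreal (norm (b x - c z r) powr m') \<partial>M) \<le> ennreal C * emeasure M (ball z r)"
    by blast
  have "0 < C powr (1 / m')" using C by simp
  moreover have "(\<integral>\<^sup>+x\<in>ball z r. G x * ennreal (norm (b x - c z r)) \<partial>M) \<le>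
      ennreal (C powr (1 / m')) * (ennreal (measure M (ball z r) powr (1 - 1 / m)) * (\<integral>\<^sup>+x\<in>ball z r. G x ennpowr m \<partial>M) ennpowr (1 / m))"
    if [measurable]: "G \<in> borel_measurable borel" and r: "0 < r" for G z r
  proof -
    have "(\<integral>\<^sup>+x\<in>ball z r. G x * ennreal (norm (b x - c z r)) \<partial>M) \<le>
      (\<integral>\<^sup>+x\<in>ball z r. G x ennpowr m \<partial>M) ennpowr (1 / m) *
      (\<integral>\<^sup>+x\<in>ball z r. ennreal (norm (b x - c z r)) ennpowr m' \<partial>M) ennpowr (1 / m')"
      by (rule Holder_ball[OF _ _ m mm(1)]) measurable
    also have "\<dots> \<le> (\<integral>\<^sup>+x\<in>ball z r. G x ennpowr m \<partial>M) ennpowr (1 / m) * (ennreal C * emeasure M (ball z r)) ennpowr (1 / m')"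
      using C(2)[OF r, of z] m' by (intro mult_left_mono ennpowr_mono) (auto simp: ennpowr_ennreal')
    also have "(ennreal C * emeasure M (ball z r)) ennpowr (1 / m') = ennreal (C powr (1 / m')) * ennreal (measure M (ball z r) powr (1 - 1 / m))"
      using C(1) m' measure_ball_pos[OF r, of z]
      by (simp add: emeasure_ball_eq ennpowr_mult ennpowr_ennreal flip: mm(2))
    finally show ?thesis by (simp only: mult_ac)
  qed
  ultimately show ?thesis by (rule that)
qed

text \<open>\<open>fractional_embedding\<close> for the function F^l with the exponents p / l and t
  / l.\<close>

lemma embedding_Holder_average:
  assumes l: "1 \<le> l" "l < p" "p < t"
  obtains C where "0 < C"
    "\<And>F. F \<in> borel_measurable borel \<Longrightarrow> (\<And>x. 0 \<le> F x) \<Longrightarrow> (\<integral>\<^sup>+x. ennreal (F x powr p) \<partial>M) \<le> 1 \<Longrightarrow>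
      scale_integral (\<lambda>k z. (ennreal (measure M (ball z (scale_radius k)) powr (1 / p - 1 / l)) *
        (\<integral>\<^sup>+x\<in>ball z (scale_radius k). ennreal (F x) ennpowr l \<partial>M) ennpowr (1 / l)) ennpowr t) \<le> ennreal C"
proof -
  have "1 < p / l" "p / l < t / l" using l by (auto simp: divide_strict_right_mono)
  from fractional_embedding[OF this] obtain C where C: "0 < C"
    "\<And>F. F \<in> borel_measurable borel \<Longrightarrow> (\<And>x. 0 \<le> F x) \<Longrightarrow> (\<integral>\<^sup>+x. ennreal (F x powr (p / l)) \<partial>M) \<le> 1 \<Longrightarrow>
      scale_integral (\<lambda>k z. (ennreal (measure M (ball z (scale_radius k)) powr (1 / (p / l) - 1)) *
        (\<integral>\<^sup>+x\<in>ball z (scale_radius k). ennreal (F x) \<partial>M)) ennpowr (t / l)) \<le> ennreal C" by blast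
  have "scale_integral (\<lambda>k z. (ennreal (measure M (ball z (scale_radius k)) powr (1 / p - 1 / l)) *
        (\<integral>\<^sup>+x\<in>ball z (scale_radius k). ennreal (F x) ennpowr l \<partial>M) ennpowr (1 / l)) ennpowr t) \<le> ennreal C"
    if [measurable]: "F \<in> borel_measurable borel" and F0: "\<And>x. 0 \<le> F x" and F1: "(\<integral>\<^sup>+x. ennreal (F x powr p) \<partial>M) \<le> 1" for F
  proof -
    have "scale_integral (\<lambda>k z. (ennreal (measure M (ball z (scale_radius k)) powr (1 / (p / l) - 1)) *
        (\<integral>\<^sup>+x\<in>ball z (scale_radius k). ennreal (F x powr l) \<partial>M)) ennpowr (t / l)) \<le> ennreal C"
      using F1 l by (intro C(2)) (auto simp: powr_powr)
    also have "(\<lambda>k z. (ennreal (measure M (ball z (scale_radius k)) powr (1 / (p / l) - 1)) *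
        (\<integral>\<^sup>+x\<in>ball z (scale_radius k). ennreal (F x powr l) \<partial>M)) ennpowr (t / l)) =
      (\<lambda>k z. (ennreal (measure M (ball z (scale_radius k)) powr (1 / p - 1 / l)) *
        (\<integral>\<^sup>+x\<in>ball z (scale_radius k). ennreal (F x) ennpowr l \<partial>M) ennpowr (1 / l)) ennpowr t)"
    proof (intro ext)
      fix k :: int and z :: 'a
      define u where "u = measure M (ball z (scale_radius k))"
      have u: "0 < u" by (simp add: u_def measure_ball_pos)
      define I where "I = (\<integral>\<^sup>+x\<in>ball z (scale_radius k). ennreal (F x powr l) \<partial>M)"
      have I: "(\<integral>\<^sup>+x\<in>ball z (scale_radius k). ennreal (F x) ennpowr l \<partial>M) = I"
        using l F0 by (simp add: I_def ennpowr_ennreal')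
      have e: "(1 / (p / l) - 1) * (t / l) = (1 / p - 1 / l) * t" using l by (simp add: field_simps)
      have "(ennreal (u powr (1 / (p / l) - 1)) * I) ennpowr (t / l) = ennreal (u powr ((1 / p - 1 / l) * t)) * I ennpowr (t / l)"
        using l u by (simp only: e[symmetric]) (simp add: ennpowr_mult ennpowr_ennreal powr_powr)
      also have "\<dots> = (ennreal (u powr (1 / p - 1 / l)) * I ennpowr (1 / l)) ennpowr t"
        using l u by (simp add: ennpowr_mult ennpowr_ennpowr ennpowr_ennreal powr_powr)
      finally show "(ennreal (measure M (ball z (scale_radius k)) powr (1 / (p / l) - 1)) *
        (\<integral>\<^sup>+x\<in>ball z (scale_radius k). ennreal (F x powr l) \<partial>M)) ennpowr (t / l) =
        (ennreal (measure M (ball z (scale_radius k)) powr (1 / p - 1 / l)) *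
        (\<integral>\<^sup>+x\<in>ball z (scale_radius k). ennreal (F x) ennpowr l \<partial>M) ennpowr (1 / l)) ennpowr t"
        unfolding I by (simp only: u_def I_def)
    qed
    finally show ?thesis .
  qed
  with C(1) show ?thesis by (rule that)
qed

end

text \<open>MU stands for w^q dx and MS for w^(-p') dx. The assumption \<open>ball_bound\<close> is
  A_{p,q} solved for the size of the kernel at scale r, with 1 - 1/p written for 1/p'.\<close>

locale two_weight_commutator =
  U: A_infty_measure MU KU \<kappa>U + S: A_infty_measure MS KS \<kappa>S
  for MU :: "'a::euclidean_space measure" and KU \<kappa>U and MS :: "'a measure" and KS \<kappa>S +
  fixes \<gamma> p q K0 :: real and b :: "'a \<Rightarrow> 'b::euclidean_space" and c :: "'a \<Rightarrow> real \<Rightarrow> 'b" and N :: real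
  assumes osc: "mean_oscillation_bound b c N"
    and \<gamma>_less: "\<gamma> < real DIM('a)"
    and p_gt_1: "1 < p" and p_less_q: "p < q"
    and K0_pos: "0 < K0"
    and ball_bound: "0 < r \<Longrightarrow> r powr (\<gamma> - real DIM('a)) \<le>
      K0 * (measure MU (ball z r) powr (- (1 / q)) * measure MS (ball z r) powr (- (1 - 1 / p)))"
begin

lemma b_measurable [measurable]: "b \<in> borel_measurable borel"
  using osc by (simp add: mean_oscillation_bound_def)

definition commutator_kernel :: "'a \<Rightarrow> 'a \<Rightarrow> ennreal" where
  "commutator_kernel x y = ennreal (norm (b x - b y)) * ennreal (norm (x - y) powr (\<gamma> - real DIM('a)))"

text \<open>With F = |f| w^p' the measure F dMS is |f(y)| dy, so this is the positive operator with
  kernel |b x - b y| |x - y|^(\<gamma> - n) applied to |f|.\<close>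

definition abs_commutator :: "('a \<Rightarrow> real) \<Rightarrow> 'a \<Rightarrow> ennreal" where
  "abs_commutator F x = (\<integral>\<^sup>+y. commutator_kernel x y * ennreal (F y) \<partial>MS)"

lemma commutator_kernel_measurable [measurable (raw)]:
  assumes [measurable]: "f \<in> borel_measurable L" "g \<in> borel_measurable L"
  shows "(\<lambda>p. commutator_kernel (f p) (g p)) \<in> borel_measurable L"
proof -
  have [measurable]: "(\<lambda>p. b (f p)) \<in> borel_measurable L" "(\<lambda>p. b (g p)) \<in> borel_measurable L"
    by (auto intro!: measurable_compose[OF _ b_measurable])
  show ?thesis unfolding commutator_kernel_def by measurable
qed

lemma abs_commutator_measurable [measurable]:
  assumes [measurable]: "F \<in> borel_measurable borel"
  shows "abs_commutator F \<in> borel_measurable borel"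
proof -
  interpret sigma_finite_measure MS by (rule S.sigma_finite_M)
  show ?thesis unfolding abs_commutator_def by measurable
qed

text \<open>A constant a inserted between b x and b y separates the variables; in each of the two
  products only one factor carries an oscillation.\<close>

lemma ball_form_le:
  assumes [measurable]: "F \<in> borel_measurable borel" "G \<in> borel_measurable borel"
  shows "(\<integral>\<^sup>+x. (\<integral>\<^sup>+y. ennreal (norm (b x - b y)) * ennreal (F y) * ennreal (G x) *
      (indicator (ball z r) x * indicator (ball z r) y) \<partial>MS) \<partial>MU)
    \<le> (\<integral>\<^sup>+x\<in>ball z r. ennreal (G x) * ennreal (norm (b x - a)) \<partial>MU) * (\<integral>\<^sup>+y\<in>ball z r. ennreal (F y) \<partial>MS)
     + (\<integral>\<^sup>+x\<in>ball z r. ennreal (G x) \<partial>MU) * (\<integral>\<^sup>+y\<in>ball z r. ennreal (F y) * ennreal (norm (b y - a)) \<partial>MS)"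
proof -
  let ?i = "indicator (ball z r) :: 'a \<Rightarrow> ennreal"
  have "(\<integral>\<^sup>+x. (\<integral>\<^sup>+y. ennreal (norm (b x - b y)) * ennreal (F y) * ennreal (G x) * (?i x * ?i y) \<partial>MS) \<partial>MU)
    \<le> (\<integral>\<^sup>+x. (\<integral>\<^sup>+y. (ennreal (G x) * ennreal (norm (b x - a)) * ?i x) * (ennreal (F y) * ?i y)
        + (ennreal (G x) * ?i x) * (ennreal (F y) * ennreal (norm (b y - a)) * ?i y) \<partial>MS) \<partial>MU)"
  proof (intro nn_integral_mono)
    fix x y
    have "ennreal (norm (b x - b y)) \<le> ennreal (norm (b x - a)) + ennreal (norm (b y - a))"
      using norm_triangle_ineq4[of "b x - a" "b y - a"] by (simp flip: ennreal_plus add: ennreal_leI)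
    then have "ennreal (norm (b x - b y)) * (ennreal (F y) * ennreal (G x) * (?i x * ?i y)) \<le>
      (ennreal (norm (b x - a)) + ennreal (norm (b y - a))) * (ennreal (F y) * ennreal (G x) * (?i x * ?i y))"
      by (rule mult_right_mono) simp
    then show "ennreal (norm (b x - b y)) * ennreal (F y) * ennreal (G x) * (?i x * ?i y) \<le>
      (ennreal (G x) * ennreal (norm (b x - a)) * ?i x) * (ennreal (F y) * ?i y)
        + (ennreal (G x) * ?i x) * (ennreal (F y) * ennreal (norm (b y - a)) * ?i y)"
      by (simp add: ring_distribs mult_ac)
  qed
  also have "\<dots> = (\<integral>\<^sup>+x. (ennreal (G x) * ennreal (norm (b x - a)) * ?i x) * (\<integral>\<^sup>+y\<in>ball z r. ennreal (F y) \<partial>MS)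
        + (ennreal (G x) * ?i x) * (\<integral>\<^sup>+y\<in>ball z r. ennreal (F y) * ennreal (norm (b y - a)) \<partial>MS) \<partial>MU)"
    by (simp add: nn_integral_add nn_integral_cmult)
  also have "\<dots> = (\<integral>\<^sup>+x\<in>ball z r. ennreal (G x) * ennreal (norm (b x - a)) \<partial>MU) * (\<integral>\<^sup>+y\<in>ball z r. ennreal (F y) \<partial>MS)
     + (\<integral>\<^sup>+x\<in>ball z r. ennreal (G x) \<partial>MU) * (\<integral>\<^sup>+y\<in>ball z r. ennreal (F y) * ennreal (norm (b y - a)) \<partial>MS)"
    by (simp add: nn_integral_add nn_integral_multc)
  finally show ?thesis .
qed

text \<open>The ball average of the kernel is put into the bilinear form, and two applications of
  Tonelli leave one local form for each ball.\<close>

lemma commutator_form_le_scale_integral: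
  obtains C where "0 < C" "\<And>F G. F \<in> borel_measurable borel \<Longrightarrow> G \<in> borel_measurable borel \<Longrightarrow>
    (\<integral>\<^sup>+x. abs_commutator F x * ennreal (G x) \<partial>MU) \<le> ennreal C * scale_integral (\<lambda>k z. ennreal (scale_radius k powr (\<gamma> - real DIM('a))) *
      (\<integral>\<^sup>+x. (\<integral>\<^sup>+y. ennreal (norm (b x - b y)) * ennreal (F y) * ennreal (G x) *
        (indicator (ball z (scale_radius k)) x * indicator (ball z (scale_radius k)) y) \<partial>MS) \<partial>MU))"
proof -
  interpret SU: sigma_finite_measure MU by (rule U.sigma_finite_M)
  interpret SS: sigma_finite_measure MS by (rule S.sigma_finite_M)
  obtain C where C: "0 < C" "\<And>x y::'a. ennreal (norm (x - y) powr (\<gamma> - real DIM('a))) \<le>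
    ennreal C * scale_integral (\<lambda>k z. ennreal (scale_radius k powr (\<gamma> - real DIM('a))) *
      (indicator (ball z (scale_radius k)) x * indicator (ball z (scale_radius k)) y))"
    using kernel_le_scale_integral[OF \<gamma>_less] by blast
  have "(\<integral>\<^sup>+x. abs_commutator F x * ennreal (G x) \<partial>MU) \<le> ennreal C * scale_integral (\<lambda>k z. ennreal (scale_radius k powr (\<gamma> - real DIM('a))) *
      (\<integral>\<^sup>+x. (\<integral>\<^sup>+y. ennreal (norm (b x - b y)) * ennreal (F y) * ennreal (G x) *
        (indicator (ball z (scale_radius k)) x * indicator (ball z (scale_radius k)) y) \<partial>MS) \<partial>MU))"
    if [measurable]: "F \<in> borel_measurable borel" "G \<in> borel_measurable borel" for F G
  proof -
    define w where "w k = ennreal (scale_radius k powr (\<gamma> - real DIM('a)))" for k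
    define i where "i k z x y = (indicator (ball z (scale_radius k)) x * indicator (ball z (scale_radius k)) y :: ennreal)" for k and z x y :: 'a
    have [measurable]: "(\<lambda>p. i k (f p) (g p) (h p)) \<in> borel_measurable L"
      if [measurable]: "f \<in> borel_measurable L" "g \<in> borel_measurable L" "h \<in> borel_measurable L" for k f g h L
      unfolding i_def by measurable
    have [measurable]: "(\<lambda>z. i k z x y) \<in> borel_measurable borel" for k x y
      unfolding i_def by measurable
    define A where "A x y = ennreal (norm (b x - b y)) * ennreal (F y) * ennreal (G x)" for x y
    have [measurable]: "(\<lambda>p. A (f p) (g p)) \<in> borel_measurable L"
      if [measurable]: "f \<in> borel_measurable L" "g \<in> borel_measurable L" for f g L
      unfolding A_def by measurable
    have "(\<integral>\<^sup>+x. abs_commutator F x * ennreal (G x) \<partial>MU) = (\<integral>\<^sup>+x. (\<integral>\<^sup>+y. commutator_kernel x y * ennreal (F y) * ennreal (G x) \<partial>MS) \<partial>MU)"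
      unfolding abs_commutator_def by (intro nn_integral_cong nn_integral_multc[symmetric]) measurable
    also have "\<dots> \<le> (\<integral>\<^sup>+x. (\<integral>\<^sup>+y. ennreal C * scale_integral (\<lambda>k z. w k * (A x y * i k z x y)) \<partial>MS) \<partial>MU)"
    proof (intro nn_integral_mono)
      fix x y
      have "commutator_kernel x y * ennreal (F y) * ennreal (G x) = A x y * ennreal (norm (x - y) powr (\<gamma> - real DIM('a)))"
        by (simp add: commutator_kernel_def A_def mult_ac)
      also have "\<dots> \<le> A x y * (ennreal C * scale_integral (\<lambda>k z. w k * i k z x y))"
        unfolding w_def i_def by (intro mult_left_mono C(2)) simp
      also have "\<dots> = ennreal C * (A x y * scale_integral (\<lambda>k z. w k * i k z x y))"
        by (simp only: mult_ac)
      also have "A x y * scale_integral (\<lambda>k z. w k * i k z x y) = scale_integral (\<lambda>k z. A x y * (w k * i k z x y))"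
        by (rule scale_integral_cmult[symmetric]) measurable
      finally show "commutator_kernel x y * ennreal (F y) * ennreal (G x) \<le> ennreal C * scale_integral (\<lambda>k z. w k * (A x y * i k z x y))"
        by (simp only: mult_ac)
    qed
    also have "\<dots> = (\<integral>\<^sup>+x. ennreal C * (\<integral>\<^sup>+y. scale_integral (\<lambda>k z. w k * (A x y * i k z x y)) \<partial>MS) \<partial>MU)"
    proof (intro nn_integral_cong nn_integral_cmult)
      fix x
      show "(\<lambda>y. scale_integral (\<lambda>k z. w k * (A x y * i k z x y))) \<in> borel_measurable MS"
        unfolding scale_integral_def nn_integral_count_space_int by measurable
    qed
    also have "\<dots> = (\<integral>\<^sup>+x. ennreal C * scale_integral (\<lambda>k z. \<integral>\<^sup>+y. w k * (A x y * i k z x y) \<partial>MS) \<partial>MU)"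
      by (intro nn_integral_cong arg_cong2[where f="(*)"] refl scale_integral_swap[OF S.sigma_finite_M, symmetric]) measurable
    also have "\<dots> = ennreal C * (\<integral>\<^sup>+x. scale_integral (\<lambda>k z. \<integral>\<^sup>+y. w k * (A x y * i k z x y) \<partial>MS) \<partial>MU)"
    proof (rule nn_integral_cmult)
      show "(\<lambda>x. scale_integral (\<lambda>k z. \<integral>\<^sup>+y. w k * (A x y * i k z x y) \<partial>MS)) \<in> borel_measurable MU"
        unfolding scale_integral_def nn_integral_count_space_int by measurable
    qed
    also have "(\<integral>\<^sup>+x. scale_integral (\<lambda>k z. \<integral>\<^sup>+y. w k * (A x y * i k z x y) \<partial>MS) \<partial>MU)
      = scale_integral (\<lambda>k z. \<integral>\<^sup>+x. (\<integral>\<^sup>+y. w k * (A x y * i k z x y) \<partial>MS) \<partial>MU)"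
      by (rule scale_integral_swap[OF U.sigma_finite_M, symmetric]) measurable
    also have "(\<lambda>k z. \<integral>\<^sup>+x. (\<integral>\<^sup>+y. w k * (A x y * i k z x y) \<partial>MS) \<partial>MU) = (\<lambda>k z. w k * (\<integral>\<^sup>+x. (\<integral>\<^sup>+y. A x y * i k z x y \<partial>MS) \<partial>MU))"
    proof (intro ext)
      fix k z
      have "(\<integral>\<^sup>+x. (\<integral>\<^sup>+y. w k * (A x y * i k z x y) \<partial>MS) \<partial>MU) = (\<integral>\<^sup>+x. w k * (\<integral>\<^sup>+y. A x y * i k z x y \<partial>MS) \<partial>MU)"
        by (intro nn_integral_cong nn_integral_cmult) measurable
      also have "\<dots> = w k * (\<integral>\<^sup>+x. (\<integral>\<^sup>+y. A x y * i k z x y \<partial>MS) \<partial>MU)"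
        by (rule nn_integral_cmult) measurable
      finally show "(\<integral>\<^sup>+x. (\<integral>\<^sup>+y. w k * (A x y * i k z x y) \<partial>MS) \<partial>MU) = w k * (\<integral>\<^sup>+x. (\<integral>\<^sup>+y. A x y * i k z x y \<partial>MS) \<partial>MU)" .
    qed
    finally show ?thesis by (simp only: w_def A_def i_def)
  qed
  with C(1) show ?thesis by (rule that)
qed

text \<open>On each ball the form is at most a constant times a product of normalized L^l and L^m
  averages. Young's inequality with exponents t and t' separates them, and the embedding bounds the
  sum over all balls of each.\<close>

lemma commutator_form_bound:
  obtains C where "0 < C" "\<And>F G. F \<in> borel_measurable borel \<Longrightarrow> G \<in> borel_measurable borel \<Longrightarrow>
    (\<And>x. 0 \<le> F x) \<Longrightarrow> (\<And>x. 0 \<le> G x) \<Longrightarrow> (\<integral>\<^sup>+x. ennreal (F x powr p) \<partial>MS) \<le> 1 \<Longrightarrow>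
    (\<integral>\<^sup>+x. ennreal (G x powr (q / (q - 1))) \<partial>MU) \<le> 1 \<Longrightarrow>
    (\<integral>\<^sup>+x. abs_commutator F x * ennreal (G x) \<partial>MU) \<le> ennreal C"
proof -
  define q' where "q' = q / (q - 1)"
  have q': "1 < q'" "1 / q' = 1 - 1 / q" using p_gt_1 p_less_q by (auto simp: q'_def field_simps)
  \<comment> \<open>The oscillation is absorbed for exponents above 1 and the embedding works for
    exponents below p, so any l in between serves; the same holds for m between 1 and q'.\<close>
  define l where "l = (1 + p) / 2"
  have l: "1 < l" "l < p" using p_gt_1 by (auto simp: l_def)
  define m where "m = (1 + q') / 2"
  have m: "1 < m" "m < q'" using q' by (auto simp: m_def)
  \<comment> \<open>Between p and q, so that t > p and, by conjugation, t' > q'; both embeddings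
    then apply.\<close>
  define t where "t = (p + q) / 2"
  have t: "1 < t" "p < t" "t < q" using p_gt_1 p_less_q by (auto simp: t_def)
  define t' where "t' = t / (t - 1)"
  have tt: "1 / t + 1 / t' = 1" using t by (auto simp: t'_def field_simps)
  have t': "q' < t'" using t p_gt_1 by (auto simp: t'_def q'_def field_simps)
  obtain C0 where C0: "0 < C0" "\<And>F G. F \<in> borel_measurable borel \<Longrightarrow> G \<in> borel_measurable borel \<Longrightarrow>
    (\<integral>\<^sup>+x. abs_commutator F x * ennreal (G x) \<partial>MU) \<le> ennreal C0 * scale_integral (\<lambda>k z. ennreal (scale_radius k powr (\<gamma> - real DIM('a))) *
      (\<integral>\<^sup>+x. (\<integral>\<^sup>+y. ennreal (norm (b x - b y)) * ennreal (F y) * ennreal (G x) *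
        (indicator (ball z (scale_radius k)) x * indicator (ball z (scale_radius k)) y) \<partial>MS) \<partial>MU))"
    by (rule commutator_form_le_scale_integral) blast
  obtain CU where CU: "0 < CU"
    "\<And>G z r. G \<in> borel_measurable borel \<Longrightarrow> 0 < r \<Longrightarrow>
      (\<integral>\<^sup>+x\<in>ball z r. G x * ennreal (norm (b x - c z r)) \<partial>MU) \<le>
      ennreal CU * (ennreal (measure MU (ball z r) powr (1 - 1 / m)) * (\<integral>\<^sup>+x\<in>ball z r. G x ennpowr m \<partial>MU) ennpowr (1 / m))"
    by (rule U.oscillation_Holder[OF osc m(1)]) blast
  obtain CS where CS: "0 < CS"
    "\<And>G z r. G \<in> borel_measurable borel \<Longrightarrow> 0 < r \<Longrightarrow>
      (\<integral>\<^sup>+x\<in>ball z r. G x * ennreal (norm (b x - c z r)) \<partial>MS) \<le>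
      ennreal CS * (ennreal (measure MS (ball z r) powr (1 - 1 / l)) * (\<integral>\<^sup>+x\<in>ball z r. G x ennpowr l \<partial>MS) ennpowr (1 / l))"
    by (rule S.oscillation_Holder[OF osc l(1)]) blast
  obtain C1 where C1: "0 < C1"
    "\<And>F. F \<in> borel_measurable borel \<Longrightarrow> (\<And>x. 0 \<le> F x) \<Longrightarrow> (\<integral>\<^sup>+x. ennreal (F x powr p) \<partial>MS) \<le> 1 \<Longrightarrow>
      scale_integral (\<lambda>k z. (ennreal (measure MS (ball z (scale_radius k)) powr (1 / p - 1 / l)) *
        (\<integral>\<^sup>+x\<in>ball z (scale_radius k). ennreal (F x) ennpowr l \<partial>MS) ennpowr (1 / l)) ennpowr t) \<le> ennreal C1"
    by (rule S.embedding_Holder_average[OF less_imp_le[OF l(1)] l(2) t(2)]) blast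
  obtain C2 where C2: "0 < C2"
    "\<And>F. F \<in> borel_measurable borel \<Longrightarrow> (\<And>x. 0 \<le> F x) \<Longrightarrow> (\<integral>\<^sup>+x. ennreal (F x powr q') \<partial>MU) \<le> 1 \<Longrightarrow>
      scale_integral (\<lambda>k z. (ennreal (measure MU (ball z (scale_radius k)) powr (1 / q' - 1 / m)) *
        (\<integral>\<^sup>+x\<in>ball z (scale_radius k). ennreal (F x) ennpowr m \<partial>MU) ennpowr (1 / m)) ennpowr t') \<le> ennreal C2"
    by (rule U.embedding_Holder_average[OF less_imp_le[OF m(1)] m(2) t']) blast
  define C where "C = C0 * ((CU + CS) * K0 * (C1 + C2))"
  have "0 < C" using C0(1) CU(1) CS(1) K0_pos C1(1) C2(1) by (simp add: C_def)
  moreover have "(\<integral>\<^sup>+x. abs_commutator F x * ennreal (G x) \<partial>MU) \<le> ennreal C"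
    if [measurable]: "F \<in> borel_measurable borel" "G \<in> borel_measurable borel"
      and F0: "\<And>x. 0 \<le> F x" and G0: "\<And>x. 0 \<le> G x" and F1: "(\<integral>\<^sup>+x. ennreal (F x powr p) \<partial>MS) \<le> 1"
      and G1: "(\<integral>\<^sup>+x. ennreal (G x powr q') \<partial>MU) \<le> 1" for F G
  proof -
    define A where "A k z = ennreal (measure MS (ball z (scale_radius k)) powr (1 / p - 1 / l)) *
        (\<integral>\<^sup>+x\<in>ball z (scale_radius k). ennreal (F x) ennpowr l \<partial>MS) ennpowr (1 / l)" for k z
    define B where "B k z = ennreal (measure MU (ball z (scale_radius k)) powr (1 / q' - 1 / m)) *
        (\<integral>\<^sup>+x\<in>ball z (scale_radius k). ennreal (G x) ennpowr m \<partial>MU) ennpowr (1 / m)" for k z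
    have A_meas [measurable]: "A k \<in> borel_measurable borel" for k
    proof -
      have [measurable]: "(\<lambda>z. \<integral>\<^sup>+x\<in>ball z (scale_radius k). ennreal (F x) ennpowr l \<partial>MS) \<in> borel_measurable borel"
        by (rule S.borel_measurable_integral_ball) measurable
      show ?thesis unfolding A_def by measurable
    qed
    have B_meas [measurable]: "B k \<in> borel_measurable borel" for k
    proof -
      have [measurable]: "(\<lambda>z. \<integral>\<^sup>+x\<in>ball z (scale_radius k). ennreal (G x) ennpowr m \<partial>MU) \<in> borel_measurable borel"
        by (rule U.borel_measurable_integral_ball) measurable
      show ?thesis unfolding B_def by measurable
    qed
    have key: "ennreal (scale_radius k powr (\<gamma> - real DIM('a))) *
      (\<integral>\<^sup>+x. (\<integral>\<^sup>+y. ennreal (norm (b x - b y)) * ennreal (F y) * ennreal (G x) *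
        (indicator (ball z (scale_radius k)) x * indicator (ball z (scale_radius k)) y) \<partial>MS) \<partial>MU)
      \<le> ennreal ((CU + CS) * K0) * (A k z ennpowr t + B k z ennpowr t')" for k z
    proof -
      define r where "r = scale_radius k"
      have r: "0 < r" by (simp add: r_def)
      define mU where "mU = measure MU (ball z r)"
      define mS where "mS = measure MS (ball z r)"
      have mU: "0 < mU" and mS: "0 < mS" using r by (simp_all add: mU_def mS_def U.measure_ball_pos S.measure_ball_pos)
      define IF where "IF = (\<integral>\<^sup>+x\<in>ball z r. ennreal (F x) ennpowr l \<partial>MS) ennpowr (1 / l)"
      define IG where "IG = (\<integral>\<^sup>+x\<in>ball z r. ennreal (G x) ennpowr m \<partial>MU) ennpowr (1 / m)"
      define \<Phi>S where "\<Phi>S = ennreal (mS powr (1 - 1 / l)) * IF"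
      define \<Phi>U where "\<Phi>U = ennreal (mU powr (1 - 1 / m)) * IG"
      have "(\<integral>\<^sup>+x. (\<integral>\<^sup>+y. ennreal (norm (b x - b y)) * ennreal (F y) * ennreal (G x) *
        (indicator (ball z r) x * indicator (ball z r) y) \<partial>MS) \<partial>MU)
        \<le> (\<integral>\<^sup>+x\<in>ball z r. ennreal (G x) * ennreal (norm (b x - c z r)) \<partial>MU) * (\<integral>\<^sup>+y\<in>ball z r. ennreal (F y) \<partial>MS)
         + (\<integral>\<^sup>+x\<in>ball z r. ennreal (G x) \<partial>MU) * (\<integral>\<^sup>+y\<in>ball z r. ennreal (F y) * ennreal (norm (b y - c z r)) \<partial>MS)"
        by (rule ball_form_le) measurable
      also have "\<dots> \<le> (ennreal CU * \<Phi>U) * \<Phi>S + \<Phi>U * (ennreal CS * \<Phi>S)"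
        unfolding \<Phi>U_def \<Phi>S_def IF_def IG_def mU_def mS_def using r l m
        by (intro add_mono mult_mono CU(2) CS(2) U.Holder_ball_const S.Holder_ball_const) auto
      also have "\<dots> = ennreal (CU + CS) * (\<Phi>U * \<Phi>S)"
        using CU(1) CS(1) by (simp add: ennreal_plus less_imp_le ring_distribs mult_ac del: ennreal_plus[symmetric])
      \<comment> \<open>The powers of the two masses from \<open>ball_bound\<close> combine with
        those from Hoelder's inequality into the normalizations of A and B.\<close>
      finally have "ennreal (r powr (\<gamma> - real DIM('a))) * (\<integral>\<^sup>+x. (\<integral>\<^sup>+y. ennreal (norm (b x - b y)) * ennreal (F y) * ennreal (G x) *
        (indicator (ball z r) x * indicator (ball z r) y) \<partial>MS) \<partial>MU)
        \<le> ennreal (K0 * (mU powr (- (1 / q)) * mS powr (- (1 - 1 / p)))) * (ennreal (CU + CS) * (\<Phi>U * \<Phi>S))"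
        unfolding mU_def mS_def by (intro mult_mono ennreal_leI ball_bound r) auto
      also have "\<dots> = ennreal ((CU + CS) * K0) * ((ennreal (mS powr (- (1 - 1 / p))) * ennreal (mS powr (1 - 1 / l)) * IF) *
         (ennreal (mU powr (- (1 / q))) * ennreal (mU powr (1 - 1 / m)) * IG))"
        using K0_pos CU(1) CS(1) by (simp add: \<Phi>U_def \<Phi>S_def ennreal_mult mult_ac del: ennreal_plus)
      also have "ennreal (mS powr (- (1 - 1 / p))) * ennreal (mS powr (1 - 1 / l)) * IF = A k z"
      proof -
        have "- (1 - 1 / p) + (1 - 1 / l) = 1 / p - 1 / l" by simp
        then have "mS powr (- (1 - 1 / p)) * mS powr (1 - 1 / l) = mS powr (1 / p - 1 / l)" by (simp only: powr_add[symmetric])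
        then have "ennreal (mS powr (- (1 - 1 / p))) * ennreal (mS powr (1 - 1 / l)) = ennreal (mS powr (1 / p - 1 / l))"
          by (simp only: ennreal_mult[symmetric] powr_ge_zero)
        then show ?thesis unfolding A_def IF_def mS_def r_def by (simp only:)
      qed
      also have "ennreal (mU powr (- (1 / q))) * ennreal (mU powr (1 - 1 / m)) * IG = B k z"
      proof -
        have "- (1 / q) + (1 - 1 / m) = 1 / q' - 1 / m" using q'(2) by simp
        then have "mU powr (- (1 / q)) * mU powr (1 - 1 / m) = mU powr (1 / q' - 1 / m)" by (simp only: powr_add[symmetric])
        then have "ennreal (mU powr (- (1 / q))) * ennreal (mU powr (1 - 1 / m)) = ennreal (mU powr (1 / q' - 1 / m))"
          by (simp only: ennreal_mult[symmetric] powr_ge_zero)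
        then show ?thesis unfolding B_def IG_def mU_def r_def by (simp only:)
      qed
      also have "ennreal ((CU + CS) * K0) * (A k z * B k z) \<le> ennreal ((CU + CS) * K0) * (A k z ennpowr t + B k z ennpowr t')"
        by (intro mult_left_mono ennreal_Young[OF t(1) tt]) simp
      finally show ?thesis by (simp only: r_def)
    qed
    have "(\<integral>\<^sup>+x. abs_commutator F x * ennreal (G x) \<partial>MU) \<le> ennreal C0 * scale_integral (\<lambda>k z. ennreal (scale_radius k powr (\<gamma> - real DIM('a))) *
      (\<integral>\<^sup>+x. (\<integral>\<^sup>+y. ennreal (norm (b x - b y)) * ennreal (F y) * ennreal (G x) *
        (indicator (ball z (scale_radius k)) x * indicator (ball z (scale_radius k)) y) \<partial>MS) \<partial>MU))"
      by (rule C0(2)) measurable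
    also have "\<dots> \<le> ennreal C0 * scale_integral (\<lambda>k z. ennreal ((CU + CS) * K0) * (A k z ennpowr t + B k z ennpowr t'))"
      by (intro mult_left_mono scale_integral_mono key) simp
    also have "\<dots> = ennreal C0 * (ennreal ((CU + CS) * K0) * (scale_integral (\<lambda>k z. A k z ennpowr t) + scale_integral (\<lambda>k z. B k z ennpowr t')))"
      by (subst scale_integral_cmult, measurable) (subst scale_integral_add, measurable)
    also have "\<dots> \<le> ennreal C0 * (ennreal ((CU + CS) * K0) * (ennreal C1 + ennreal C2))"
      unfolding A_def B_def using F0 G0 F1 G1 by (intro mult_left_mono add_mono C1(2) C2(2)) auto
    also have "\<dots> = ennreal C"
      using C0(1) CU(1) CS(1) K0_pos C1(1) C2(1) by (simp add: C_def ennreal_mult flip: ennreal_plus)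
    finally show ?thesis .
  qed
  ultimately show ?thesis unfolding q'_def by (rule that)
qed


text \<open>Duality: test the bilinear form on the power \<open>q - 1\<close> of truncations, which have finite norm.\<close>

lemma strong_type_normalized:
  obtains C where "0 < C" "\<And>F. F \<in> borel_measurable borel \<Longrightarrow> (\<And>x. 0 \<le> F x) \<Longrightarrow>
    (\<integral>\<^sup>+x. ennreal (F x powr p) \<partial>MS) \<le> 1 \<Longrightarrow> (\<integral>\<^sup>+x. abs_commutator F x ennpowr q \<partial>MU) \<le> ennreal C"
proof -
  have q1: "1 < q" using p_gt_1 p_less_q by simp
  define q' where "q' = q / (q - 1)"
  have q': "1 < q'" "1 / q' = 1 - 1 / q" "(q - 1) * q' = q" using q1 by (auto simp: q'_def field_simps)
  obtain C where C: "0 < C" "\<And>F G. F \<in> borel_measurable borel \<Longrightarrow> G \<in> borel_measurable borel \<Longrightarrow>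
    (\<And>x. 0 \<le> F x) \<Longrightarrow> (\<And>x. 0 \<le> G x) \<Longrightarrow> (\<integral>\<^sup>+x. ennreal (F x powr p) \<partial>MS) \<le> 1 \<Longrightarrow>
    (\<integral>\<^sup>+x. ennreal (G x powr q') \<partial>MU) \<le> 1 \<Longrightarrow>
    (\<integral>\<^sup>+x. abs_commutator F x * ennreal (G x) \<partial>MU) \<le> ennreal C"
    unfolding q'_def by (rule commutator_form_bound) blast
  have "0 < C powr q" using C(1) by simp
  moreover have "(\<integral>\<^sup>+x. abs_commutator F x ennpowr q \<partial>MU) \<le> ennreal (C powr q)"
    if [measurable]: "F \<in> borel_measurable borel" and F0: "\<And>x. 0 \<le> F x"
      and F1: "(\<integral>\<^sup>+x. ennreal (F x powr p) \<partial>MS) \<le> 1" for F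
  proof -
    \<comment> \<open>Cut off in height and in space, so that the q-norm is finite beforehand and
      may be divided by.\<close>
    define g where "g m x = min (abs_commutator F x) (of_nat m) * indicator (ball 0 (real m)) x" for m :: nat and x :: 'a
    define h where "h m x = enn2real (g m x)" for m x
    have [measurable]: "g m \<in> borel_measurable borel" "h m \<in> borel_measurable borel" for m
      unfolding h_def g_def by measurable
    have g_le: "g m x \<le> of_nat m" "g m x \<le> abs_commutator F x" for m x
      by (auto simp: g_def indicator_def)
    have h0: "0 \<le> h m x" for m x by (simp add: h_def)
    have hg: "ennreal (h m x) = g m x" for m x
      unfolding h_def by (intro ennreal_enn2real le_less_trans[OF g_le(1)] of_nat_less_top)
    have bound: "(\<integral>\<^sup>+x. g m x ennpowr q \<partial>MU) \<le> ennreal (C powr q)" for m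
    proof -
      define I where "I = (\<integral>\<^sup>+x. ennreal (h m x powr q) \<partial>MU)"
      have I_eq: "I = (\<integral>\<^sup>+x. g m x ennpowr q \<partial>MU)"
        using q1 h0 by (simp add: I_def ennpowr_ennreal' flip: hg)
      have "I \<le> (\<integral>\<^sup>+x. (of_nat m) ennpowr q * indicator (ball 0 (real m)) x \<partial>MU)"
        unfolding I_eq
      proof (intro nn_integral_mono)
        fix x
        have "g m x ennpowr q \<le> (of_nat m) ennpowr q" using q1 by (intro ennpowr_mono g_le) auto
        then show "g m x ennpowr q \<le> (of_nat m) ennpowr q * indicator (ball 0 (real m)) x"
          using q1 by (auto simp: g_def indicator_def)
      qed
      also have "\<dots> = (of_nat m) ennpowr q * emeasure MU (ball 0 (real m))"
        by (simp add: nn_integral_cmult_indicator)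
      also have "\<dots> < top"
      proof -
        have "(of_nat m :: ennreal) ennpowr q < top" using q1 by (simp add: ennpowr_less_top_iff of_nat_less_top)
        then show ?thesis using U.ball_finite by (simp add: ennreal_mult_less_top)
      qed
      finally have "I < top" .
      then consider "I = 0" | i where "0 < i" "I = ennreal i"
        by (cases I rule: ennreal_pos_cases) auto
      then show ?thesis
      proof cases
        case 2
        \<comment> \<open>The extremal function of Hoelder's inequality for h, normalized in the
          dual exponent q'.\<close>
        define G where "G x = h m x powr (q - 1) * i powr (- (1 / q'))" for x
        have [measurable]: "G \<in> borel_measurable borel" unfolding G_def by measurable
        have G0: "0 \<le> G x" for x by (simp add: G_def)
        have "(\<integral>\<^sup>+x. ennreal (G x powr q') \<partial>MU) = (\<integral>\<^sup>+x. ennreal (1 / i) * ennreal (h m x powr q) \<partial>MU)"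
        proof (intro nn_integral_cong)
          fix x
          have "G x powr q' = (h m x powr (q - 1)) powr q' * (i powr (- (1 / q'))) powr q'"
            unfolding G_def by (rule powr_mult)
          also have "\<dots> = h m x powr q * i powr (- 1)"
            using q'(1,3) by (simp add: powr_powr)
          also have "\<dots> = 1 / i * h m x powr q" using 2 by (simp add: powr_minus_divide)
          finally show "ennreal (G x powr q') = ennreal (1 / i) * ennreal (h m x powr q)"
            using 2 by (simp only: ennreal_mult' zero_le_divide_1_iff less_imp_le)
        qed
        also have "\<dots> = ennreal (1 / i) * I" unfolding I_def by (rule nn_integral_cmult) measurable
        also have "\<dots> = 1" using 2 by (simp flip: ennreal_mult)
        finally have G1: "(\<integral>\<^sup>+x. ennreal (G x powr q') \<partial>MU) \<le> 1" by simp
        have "ennreal (i powr (1 / q)) = ennreal (i powr (- (1 / q'))) * I"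
        proof -
          have "i powr (- (1 / q')) * i = i powr (- (1 / q')) * i powr 1" using 2 by simp
          also have "\<dots> = i powr (1 / q)" unfolding powr_add[symmetric] q'(2) by simp
          finally show ?thesis using 2 by (simp flip: ennreal_mult)
        qed
        also have "\<dots> = (\<integral>\<^sup>+x. ennreal (i powr (- (1 / q'))) * ennreal (h m x powr q) \<partial>MU)"
          unfolding I_def by (rule nn_integral_cmult[symmetric]) measurable
        also have "\<dots> \<le> (\<integral>\<^sup>+x. abs_commutator F x * ennreal (G x) \<partial>MU)"
        proof (intro nn_integral_mono)
          fix x
          have "h m x powr q = h m x * h m x powr (q - 1)"
            using powr_mult_base[OF h0[of m x], of "q - 1"] by simp
          then have "i powr (- (1 / q')) * h m x powr q = h m x * G x" by (simp add: G_def)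
          then have "ennreal (i powr (- (1 / q'))) * ennreal (h m x powr q) = ennreal (h m x) * ennreal (G x)"
            using h0 G0 by (simp only: ennreal_mult[symmetric] powr_ge_zero)
          also have "\<dots> \<le> abs_commutator F x * ennreal (G x)"
            unfolding hg by (intro mult_right_mono g_le) simp
          finally show "ennreal (i powr (- (1 / q'))) * ennreal (h m x powr q) \<le> abs_commutator F x * ennreal (G x)" .
        qed
        also have "\<dots> \<le> ennreal C" by (rule C(2)) (use F0 F1 G0 G1 in auto)
        finally have "i powr (1 / q) \<le> C" using C(1) by (simp add: ennreal_le_iff)
        then have "(i powr (1 / q)) powr q \<le> C powr q" using q1 by (intro powr_mono2) auto
        then have "i \<le> C powr q" using 2 q1 by (simp add: powr_powr)
        then show ?thesis using 2 I_eq by (simp add: ennreal_leI)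
      qed (simp add: I_eq)
    qed
    have "abs_commutator F x ennpowr q \<le> (SUP m. g m x ennpowr q)" for x
    proof (cases "abs_commutator F x" rule: ennreal_cases)
      case (real t)
      obtain m :: nat where "max t (norm x) < real m" using reals_Archimedean2 by blast
      then have m: "t \<le> real m" "norm x < real m" by auto
      have "ennreal t \<le> of_nat m" using m(1) by (metis ennreal_leI ennreal_of_nat_eq_real_of_nat)
      then have "g m x = abs_commutator F x" using m real by (simp add: g_def min_absorb1)
      then show ?thesis by (intro SUP_upper2[of m]) auto
    next
      case top
      \<comment> \<open>Where the operator is infinite, the truncation equals m as soon as the
        cut-off ball contains x, so its powers are unbounded.\<close>
      have SUP_top: "(SUP m. g m x ennpowr q) = top"
      proof (rule ennreal_SUP_eq_top)
        fix k :: nat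
        obtain m :: nat where "max (norm x) (real (Suc k)) < real m" using reals_Archimedean2 by blast
        then have m: "norm x < real m" "k \<le> m" "1 \<le> m" by auto
        have "real k \<le> real m powr 1" using m by simp
        also have "\<dots> \<le> real m powr q" using m q1 by (intro powr_mono) auto
        finally have "of_nat k \<le> ennreal (real m powr q)" by (metis ennreal_leI ennreal_of_nat_eq_real_of_nat)
        also have "\<dots> = g m x ennpowr q"
          using m q1 top by (simp add: g_def min_absorb2 ennpowr_ennreal' ennreal_of_nat_eq_real_of_nat)
        finally show "\<exists>m\<in>UNIV. of_nat k \<le> g m x ennpowr q" by auto
      qed
      show ?thesis unfolding SUP_top by (rule top_greatest)
    qed
    then have "(\<integral>\<^sup>+x. abs_commutator F x ennpowr q \<partial>MU) \<le> (\<integral>\<^sup>+x. (SUP m. g m x ennpowr q) \<partial>MU)"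
      by (intro nn_integral_mono)
    also have "\<dots> = (SUP m. \<integral>\<^sup>+x. g m x ennpowr q \<partial>MU)"
    proof (rule nn_integral_monotone_convergence_SUP)
      show "incseq (\<lambda>m x. g m x ennpowr q)"
      proof (intro incseq_SucI le_funI ennpowr_mono)
        fix m and x :: 'a
        have "(indicator (ball 0 (real m)) x :: ennreal) \<le> indicator (ball 0 (real (Suc m))) x"
          by (auto simp: indicator_def)
        moreover have "min (abs_commutator F x) (of_nat m) \<le> min (abs_commutator F x) (of_nat (Suc m))"
          by (intro min.mono) (auto simp: add_increasing)
        ultimately show "g m x \<le> g (Suc m) x" unfolding g_def by (intro mult_mono) auto
      qed (use q1 in simp)
    qed measurable
    also have "\<dots> \<le> ennreal (C powr q)" by (intro SUP_least bound)
    finally show ?thesis .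
  qed
  ultimately show ?thesis by (rule that)
qed

lemma abs_commutator_cmult:
  assumes [measurable]: "F \<in> borel_measurable borel" and "0 \<le> a"
  shows "abs_commutator (\<lambda>x. a * F x) x = ennreal a * abs_commutator F x"
proof -
  have "abs_commutator (\<lambda>x. a * F x) x = (\<integral>\<^sup>+y. ennreal a * (commutator_kernel x y * ennreal (F y)) \<partial>MS)"
    unfolding abs_commutator_def using assms(2) by (intro nn_integral_cong) (simp add: ennreal_mult' mult_ac)
  also have "\<dots> = ennreal a * abs_commutator F x"
    unfolding abs_commutator_def by (rule nn_integral_cmult) measurable
  finally show ?thesis .
qed

text \<open>Homogeneity, with the degenerate norms apart: if F vanishes almost everywhere the
  operator gives 0, and an infinite norm makes the right side infinite.\<close>

lemma strong_type:
  obtains C where "0 < C" "\<And>F. F \<in> borel_measurable borel \<Longrightarrow> (\<And>x. 0 \<le> F x) \<Longrightarrow>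
    (\<integral>\<^sup>+x. abs_commutator F x ennpowr q \<partial>MU) ennpowr (1 / q) \<le>
    ennreal C * (\<integral>\<^sup>+x. ennreal (F x powr p) \<partial>MS) ennpowr (1 / p)"
proof -
  have q1: "1 < q" using p_gt_1 p_less_q by simp
  obtain C where C: "0 < C" "\<And>F. F \<in> borel_measurable borel \<Longrightarrow> (\<And>x. 0 \<le> F x) \<Longrightarrow>
    (\<integral>\<^sup>+x. ennreal (F x powr p) \<partial>MS) \<le> 1 \<Longrightarrow> (\<integral>\<^sup>+x. abs_commutator F x ennpowr q \<partial>MU) \<le> ennreal C"
    by (rule strong_type_normalized) blast
  have "0 < C powr (1 / q)" using C(1) by simp
  moreover have "(\<integral>\<^sup>+x. abs_commutator F x ennpowr q \<partial>MU) ennpowr (1 / q) \<le>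
    ennreal (C powr (1 / q)) * (\<integral>\<^sup>+x. ennreal (F x powr p) \<partial>MS) ennpowr (1 / p)"
    if [measurable]: "F \<in> borel_measurable borel" and F0: "\<And>x. 0 \<le> F x" for F
  proof (cases "\<integral>\<^sup>+x. ennreal (F x powr p) \<partial>MS" rule: ennreal_pos_cases)
    case zero
    then have "AE x in MS. ennreal (F x powr p) = 0" by (subst (asm) nn_integral_0_iff_AE) auto
    then have "AE y in MS. commutator_kernel x y * ennreal (F y) = 0" for x
      by eventually_elim (use F0 in \<open>auto simp: ennreal_eq_0_iff powr_def split: if_splits\<close>)
    then have "abs_commutator F x = 0" for x
      unfolding abs_commutator_def by (subst nn_integral_0_iff_AE) auto
    then show ?thesis using q1 by simp
  next
    case top
    then show ?thesis using C(1) p_gt_1 by (simp add: ennreal_mult_top)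
  next
    case (pos A)
    define a where "a = A powr (- (1 / p))"
    have a: "0 < a" using pos by (simp add: a_def)
    have "a powr p = A powr (- 1)" using p_gt_1 by (simp add: a_def powr_powr)
    then have ap: "a powr p = 1 / A" using pos by (simp add: powr_minus_divide)
    have "(\<integral>\<^sup>+x. ennreal ((a * F x) powr p) \<partial>MS) = (\<integral>\<^sup>+x. ennreal (1 / A) * ennreal (F x powr p) \<partial>MS)"
      using a F0 pos by (intro nn_integral_cong) (simp add: powr_mult ap flip: ennreal_mult)
    also have "\<dots> = ennreal (1 / A) * ennreal A" by (simp add: nn_integral_cmult pos)
    also have "\<dots> = 1" using pos by (simp flip: ennreal_mult)
    finally have "(\<integral>\<^sup>+x. abs_commutator (\<lambda>x. a * F x) x ennpowr q \<partial>MU) \<le> ennreal C"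
      using a F0 by (intro C(2)) auto
    then have "(\<integral>\<^sup>+x. (ennreal a * abs_commutator F x) ennpowr q \<partial>MU) \<le> ennreal C"
      using a by (simp add: abs_commutator_cmult)
    moreover have "(\<integral>\<^sup>+x. (ennreal a * abs_commutator F x) ennpowr q \<partial>MU) = ennreal a ennpowr q * (\<integral>\<^sup>+x. abs_commutator F x ennpowr q \<partial>MU)"
      using q1 by (simp add: ennpowr_mult nn_integral_cmult)
    ultimately have "(ennreal a ennpowr q * (\<integral>\<^sup>+x. abs_commutator F x ennpowr q \<partial>MU)) ennpowr (1 / q) \<le> ennreal C ennpowr (1 / q)"
      using q1 by (intro ennpowr_mono) auto
    then have "ennreal a * (\<integral>\<^sup>+x. abs_commutator F x ennpowr q \<partial>MU) ennpowr (1 / q) \<le> ennreal (C powr (1 / q))"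
      using q1 C(1) by (simp add: ennpowr_mult ennpowr_ennpowr ennpowr_ennreal)
    then have "ennreal (1 / a) * (ennreal a * (\<integral>\<^sup>+x. abs_commutator F x ennpowr q \<partial>MU) ennpowr (1 / q)) \<le> ennreal (1 / a) * ennreal (C powr (1 / q))"
      by (rule mult_left_mono) simp
    moreover have "ennreal (1 / a) * ennreal a = 1" using a by (simp flip: ennreal_mult)
    moreover have "ennreal (1 / a) = ennreal A ennpowr (1 / p)"
      using pos by (simp add: a_def powr_minus_divide ennpowr_ennreal)
    ultimately show ?thesis unfolding pos by (simp add: mult.assoc[symmetric]) (simp add: mult.commute)
  qed
  ultimately show ?thesis by (rule that)
qed

text \<open>Each doubling of the radius moves the constant by at most N (1 + 2^n), seen by
  comparison with b on the smaller ball. The growth is linear in the number of doublings, slow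
  enough for the geometric gain from reverse doubling.\<close>

lemma center_drift:
  assumes r: "0 < r"
  shows "norm (c y r - c y (2 ^ k * r)) \<le> real k * (N * (1 + 2 ^ DIM('a)))"
proof (induction k)
  case (Suc k)
  define \<rho> where "\<rho> = 2 ^ k * r"
  have \<rho>: "0 < \<rho>" using r by (simp add: \<rho>_def)
  have N: "0 < N" and o: "\<And>z r. 0 < r \<Longrightarrow> (\<integral>\<^sup>+x\<in>ball z r. ennreal (norm (b x - c z r)) \<partial>lborel) \<le> ennreal N * emeasure lborel (ball z r)"
    using osc by (auto simp: mean_oscillation_bound_def)
  have "(\<integral>\<^sup>+x\<in>ball y \<rho>. ennreal (norm (b x - c y (2 * \<rho>))) \<partial>lborel) \<le> (\<integral>\<^sup>+x\<in>ball y (2 * \<rho>). ennreal (norm (b x - c y (2 * \<rho>))) \<partial>lborel)"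
    using \<rho> by (intro nn_integral_mono mult_left_mono) (auto simp: indicator_def)
  also have "\<dots> \<le> ennreal N * emeasure lborel (ball y (2 * \<rho>))" using \<rho> by (intro o) auto
  also have "\<dots> = ennreal (N * 2 ^ DIM('a)) * emeasure lborel (ball y \<rho>)"
    using \<rho> N by (simp add: emeasure_ball power_mult_distrib mult_ac flip: ennreal_mult)
  finally have 1: "(\<integral>\<^sup>+x\<in>ball y \<rho>. ennreal (norm (b x - c y (2 * \<rho>))) \<partial>lborel) \<le> ennreal (N * 2 ^ DIM('a)) * emeasure lborel (ball y \<rho>)" .
  have "0 < emeasure lborel (ball y \<rho>)" "emeasure lborel (ball y \<rho>) < top" using \<rho> by (simp_all add: emeasure_ball)
  from center_diff_bound[OF _ _ this _ o[OF \<rho>] _ 1]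
  have "norm (c y \<rho> - c y (2 * \<rho>)) \<le> N + N * 2 ^ DIM('a)" using N by simp
  moreover have "norm (c y r - c y (2 * \<rho>)) \<le> norm (c y r - c y \<rho>) + norm (c y \<rho> - c y (2 * \<rho>))"
    using norm_triangle_ineq[of "c y r - c y \<rho>" "c y \<rho> - c y (2 * \<rho>)"] by simp
  ultimately show ?case using Suc by (simp add: \<rho>_def mult.assoc algebra_simps)
qed simp

text \<open>Serves both parts of the local estimate: the term j = 0 belongs to the double ball and
  takes the near part, the terms with larger j take the shells of the far part. The factor j + 1
  comes from \<open>center_drift\<close>.\<close>

definition dilated_ball_sum :: "('a \<Rightarrow> real) \<Rightarrow> 'a \<Rightarrow> real \<Rightarrow> ennreal" where
  "dilated_ball_sum F y r = (\<Sum>j. ennreal ((real j + 1) * measure MU (ball y (2 ^ (j + 1) * r)) powr (- (1 / q))) *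
    (\<integral>\<^sup>+x\<in>ball y (2 ^ (j + 1) * r). ennreal (F x powr p) \<partial>MS) ennpowr (1 / p))"

text \<open>A point z with 2^j r <= dist y z < 2^(j+1) r lies in the ball of index j, and its
  distance to x is at least a quarter of the radius of that ball; hence the factor 4^(n - \<gamma>).
  One term of the series is thus enough.\<close>

lemma far_kernel_le:
  assumes x: "x \<in> ball y r" and z: "z \<notin> ball y (2 * r)"
  shows "ennreal (norm (x - z) powr (\<gamma> - real DIM('a))) \<le>
    (\<Sum>j. ennreal (4 powr (real DIM('a) - \<gamma>) * (2 ^ (j + 1) * r) powr (\<gamma> - real DIM('a))) * indicator (ball y (2 ^ (j + 1) * r)) z)"
proof -
  have r: "0 < r" using x by (auto simp: dist_norm intro: le_less_trans[OF norm_ge_zero])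
  obtain m :: nat where "dist y z / r < 2 ^ m" using real_arch_pow[of 2 "dist y z / r"] by auto
  then have ex: "dist y z < 2 ^ m * r" using r by (simp add: field_simps)
  define l where "l = (LEAST m. dist y z < 2 ^ m * r)"
  have l: "dist y z < 2 ^ l * r" unfolding l_def using ex by (rule LeastI)
  have "\<not> l \<le> 1"
  proof
    assume "l \<le> 1"
    then have "(2::real) ^ l \<le> 2 ^ 1" by (intro power_increasing) auto
    then have "2 ^ l * r \<le> 2 * r" using r by simp
    then show False using l z by simp
  qed
  \<comment> \<open>Outside the double ball l is at least 2; the term used is the one of index l - 1
    = \<open>Suc i\<close>.\<close>
  then obtain i where i: "l = Suc (Suc i)" by (cases l; cases "l - 1") auto
  then have "\<not> dist y z < 2 ^ (Suc i) * r" using not_less_Least[of "Suc i" "\<lambda>m. dist y z < 2 ^ m * r"] by (simp add: l_def)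
  then have lower: "2 * 2 ^ i * r \<le> dist y z" by simp
  define R where "R = 2 ^ (Suc i + 1) * r"
  have R: "0 < R" using r by (simp add: R_def)
  have "(1::real) \<le> 2 ^ i" by simp
  then have "r \<le> 2 ^ i * r" using r by simp
  moreover have "dist y z \<le> dist x y + dist x z" by (metis dist_commute dist_triangle)
  ultimately have "R / 4 \<le> dist x z" using lower x unfolding R_def by (simp add: dist_commute)
  then have "norm (x - z) powr (\<gamma> - real DIM('a)) \<le> (R / 4) powr (\<gamma> - real DIM('a))"
    unfolding dist_norm[symmetric] using R \<gamma>_less by (intro powr_mono2') auto
  also have "\<dots> = 4 powr (real DIM('a) - \<gamma>) * R powr (\<gamma> - real DIM('a))"
    using R by (simp add: powr_divide powr_diff)
  finally have "ennreal (norm (x - z) powr (\<gamma> - real DIM('a))) \<le>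
    ennreal (4 powr (real DIM('a) - \<gamma>) * (2 ^ (Suc i + 1) * r) powr (\<gamma> - real DIM('a))) * indicator (ball y (2 ^ (Suc i + 1) * r)) z"
    using l i by (simp add: R_def ennreal_leI)
  also have "\<dots> \<le> (\<Sum>j. ennreal (4 powr (real DIM('a) - \<gamma>) * (2 ^ (j + 1) * r) powr (\<gamma> - real DIM('a))) * indicator (ball y (2 ^ (j + 1) * r)) z)"
    by (rule term_le_suminf)
  finally show ?thesis .
qed


text \<open>b x - b z is split at the constants of \<open>ball y r\<close> and of the j-th ball. The
  first piece remains as the only dependence on x, the drift is linear in j, and the last piece is
  absorbed in L^p(MS).\<close>

lemma far_bound:
  obtains C where "0 < C" "\<And>F y r x. F \<in> borel_measurable borel \<Longrightarrow> (\<And>x. 0 \<le> F x) \<Longrightarrow> x \<in> ball y r \<Longrightarrow>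
    abs_commutator (\<lambda>z. F z * indicat_real (- ball y (2 * r)) z) x
      \<le> ennreal (C * (norm (b x - c y r) + 1)) * dilated_ball_sum F y r"
proof -
  let ?n = "real DIM('a)"
  have N: "0 < N" using osc by (simp add: mean_oscillation_bound_def)
  define D where "D = N * (1 + 2 ^ DIM('a))"
  have D: "0 < D" using N by (auto simp: D_def intro!: mult_pos_pos add_pos_pos)
  obtain CS where CS: "0 < CS"
    "\<And>G z r. G \<in> borel_measurable borel \<Longrightarrow> 0 < r \<Longrightarrow>
      (\<integral>\<^sup>+x\<in>ball z r. G x * ennreal (norm (b x - c z r)) \<partial>MS) \<le>
      ennreal CS * (ennreal (measure MS (ball z r) powr (1 - 1 / p)) * (\<integral>\<^sup>+x\<in>ball z r. G x ennpowr p \<partial>MS) ennpowr (1 / p))"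
    by (rule S.oscillation_Holder[OF osc p_gt_1]) blast
  define C where "C = 4 powr (?n - \<gamma>) * K0 * (1 + D + CS)"
  have "0 < C" using K0_pos D CS(1) by (simp add: C_def)
  moreover have "abs_commutator (\<lambda>z. F z * indicat_real (- ball y (2 * r)) z) x
      \<le> ennreal (C * (norm (b x - c y r) + 1)) * dilated_ball_sum F y r"
    if [measurable]: "F \<in> borel_measurable borel" and F0: "\<And>x. 0 \<le> F x" and x: "x \<in> ball y r" for F y r x
  proof -
    have r: "0 < r" using x by (auto simp: dist_norm intro: le_less_trans[OF norm_ge_zero])
    define R where "R j = 2 ^ (j + 1) * r" for j :: nat
    have R: "0 < R j" for j using r by (simp add: R_def)
    define k where "k j = 4 powr (?n - \<gamma>) * R j powr (\<gamma> - ?n)" for j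
    define \<delta> where "\<delta> = norm (b x - c y r)"
    have \<delta>: "0 \<le> \<delta>" by (simp add: \<delta>_def)
    define I where "I j = (\<integral>\<^sup>+z\<in>ball y (R j). ennreal (F z powr p) \<partial>MS) ennpowr (1 / p)" for j
    have I_eq: "(\<integral>\<^sup>+z\<in>ball y (R j). ennreal (F z) ennpowr p \<partial>MS) ennpowr (1 / p) = I j" for j
      using F0 p_gt_1 by (simp add: I_def ennpowr_ennreal')
    define J where "J j = (\<integral>\<^sup>+z\<in>ball y (R j). ennreal (norm (b x - b z)) * ennreal (F z) \<partial>MS)" for j
    have J: "ennreal (k j) * J j \<le> ennreal (C * (\<delta> + 1)) * (ennreal ((real j + 1) * measure MU (ball y (R j)) powr (- (1 / q))) * I j)" for j
    proof -
      define mU where "mU = measure MU (ball y (R j))"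
      define mS where "mS = measure MS (ball y (R j))"
      have mS: "0 < mS" using R by (simp add: mS_def S.measure_ball_pos)
      \<comment> \<open>One product that dominates 1, the oscillation at x and j + 1, so that the
        three contributions merge.\<close>
      define T where "T = (\<delta> + 1) * (real j + 1)"
      have T: "1 \<le> T" "\<delta> \<le> T" "real j + 1 \<le> T"
        using \<delta> by (auto simp: T_def algebra_simps)
      have "J j \<le> (\<integral>\<^sup>+z. ennreal (\<delta> + (real j + 1) * D) * (ennreal (F z) * indicator (ball y (R j)) z)
        + ennreal (F z) * ennreal (norm (b z - c y (R j))) * indicator (ball y (R j)) z \<partial>MS)"
        unfolding J_def
      proof (intro nn_integral_mono)
        fix z
        have "norm (b x - b z) \<le> norm (b x - c y r) + norm (c y r - c y (R j)) + norm (b z - c y (R j))"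
        proof -
          have "norm (b x - b z) \<le> norm ((b x - c y r) + (c y r - c y (R j))) + norm (b z - c y (R j))"
            using norm_triangle_ineq4[of "(b x - c y r) + (c y r - c y (R j))" "b z - c y (R j)"] by simp
          then show ?thesis using norm_triangle_ineq[of "b x - c y r" "c y r - c y (R j)"] by linarith
        qed
        also have "\<dots> \<le> \<delta> + (real j + 1) * D + norm (b z - c y (R j))"
          using center_drift[OF r, of y "j + 1"] by (simp add: \<delta>_def D_def R_def add.commute)
        finally have "ennreal (norm (b x - b z)) \<le> ennreal (\<delta> + (real j + 1) * D) + ennreal (norm (b z - c y (R j)))"
          using \<delta> D by (simp add: ennreal_leI flip: ennreal_plus)
        then have "ennreal (norm (b x - b z)) * (ennreal (F z) * indicator (ball y (R j)) z) \<le>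
          (ennreal (\<delta> + (real j + 1) * D) + ennreal (norm (b z - c y (R j)))) * (ennreal (F z) * indicator (ball y (R j)) z)"
          by (rule mult_right_mono) simp
        then show "ennreal (norm (b x - b z)) * ennreal (F z) * indicator (ball y (R j)) z
          \<le> ennreal (\<delta> + (real j + 1) * D) * (ennreal (F z) * indicator (ball y (R j)) z)
            + ennreal (F z) * ennreal (norm (b z - c y (R j))) * indicator (ball y (R j)) z"
          by (simp only: ring_distribs mult_ac)
      qed
      also have "\<dots> = ennreal (\<delta> + (real j + 1) * D) * (\<integral>\<^sup>+z\<in>ball y (R j). ennreal (F z) \<partial>MS)
        + (\<integral>\<^sup>+z\<in>ball y (R j). ennreal (F z) * ennreal (norm (b z - c y (R j))) \<partial>MS)"
        by (simp add: nn_integral_add nn_integral_cmult)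
      also have "\<dots> \<le> ennreal (\<delta> + (real j + 1) * D) * (ennreal (mS powr (1 - 1 / p)) * I j)
        + ennreal CS * (ennreal (mS powr (1 - 1 / p)) * I j)"
        unfolding mS_def I_eq[symmetric] using R p_gt_1
        by (intro add_mono mult_left_mono CS(2) S.Holder_ball_const) auto
      also have "\<dots> = ennreal (\<delta> + (real j + 1) * D + CS) * (ennreal (mS powr (1 - 1 / p)) * I j)"
        using \<delta> D CS(1) by (simp only: ennreal_plus[symmetric] distrib_right[symmetric] add_nonneg_nonneg mult_nonneg_nonneg less_imp_le of_nat_0_le_iff zero_le_one)
      also have "\<dots> \<le> ennreal (T * (1 + D + CS)) * (ennreal (mS powr (1 - 1 / p)) * I j)"
      proof (intro mult_right_mono ennreal_leI)
        have "\<delta> + (real j + 1) * D + CS \<le> T + T * D + T * CS"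
          using T D CS(1) mult_right_mono[of 1 T CS] by (intro add_mono mult_right_mono) auto
        then show "\<delta> + (real j + 1) * D + CS \<le> T * (1 + D + CS)" by (simp add: ring_distribs)
      qed simp
      finally have JT: "J j \<le> ennreal (T * (1 + D + CS)) * (ennreal (mS powr (1 - 1 / p)) * I j)" .
      have "k j \<le> 4 powr (?n - \<gamma>) * (K0 * (mU powr (- (1 / q)) * mS powr (- (1 - 1 / p))))"
        unfolding k_def mU_def mS_def by (intro mult_left_mono ball_bound R) auto
      then have "ennreal (k j) * J j \<le> ennreal (4 powr (?n - \<gamma>) * (K0 * (mU powr (- (1 / q)) * mS powr (- (1 - 1 / p))))) *
        (ennreal (T * (1 + D + CS)) * (ennreal (mS powr (1 - 1 / p)) * I j))"
        by (intro mult_mono ennreal_leI JT) auto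
      also have "\<dots> = ennreal ((4 powr (?n - \<gamma>) * (K0 * (mU powr (- (1 / q)) * mS powr (- (1 - 1 / p))))) * (T * (1 + D + CS)) * mS powr (1 - 1 / p)) * I j"
        using K0_pos T D CS(1) by (simp add: ennreal_mult mult.assoc)
      also have "(4 powr (?n - \<gamma>) * (K0 * (mU powr (- (1 / q)) * mS powr (- (1 - 1 / p))))) * (T * (1 + D + CS)) * mS powr (1 - 1 / p)
        = C * (\<delta> + 1) * ((real j + 1) * mU powr (- (1 / q)))"
      proof -
        \<comment> \<open>Hoelder's inequality produces the MS-mass with the power inverse to that
          in \<open>ball_bound\<close>; it cancels and only the MU-mass survives.\<close>
        have one: "mS powr (- (1 - 1 / p)) * mS powr (1 - 1 / p) = 1" using mS by (simp flip: powr_add)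
        have "(4 powr (?n - \<gamma>) * (K0 * (mU powr (- (1 / q)) * mS powr (- (1 - 1 / p))))) * (T * (1 + D + CS)) * mS powr (1 - 1 / p)
          = (4 powr (?n - \<gamma>) * K0 * mU powr (- (1 / q)) * T * (1 + D + CS)) * (mS powr (- (1 - 1 / p)) * mS powr (1 - 1 / p))"
          by (simp only: mult_ac)
        also have "\<dots> = C * (\<delta> + 1) * ((real j + 1) * mU powr (- (1 / q)))"
          unfolding one C_def T_def by (simp only: mult_ac mult_1_left)
        finally show ?thesis .
      qed
      also have "ennreal (C * (\<delta> + 1) * ((real j + 1) * mU powr (- (1 / q)))) * I j
        = ennreal (C * (\<delta> + 1)) * (ennreal ((real j + 1) * mU powr (- (1 / q))) * I j)"
        using \<open>0 < C\<close> \<delta> by (subst ennreal_mult) (auto simp: mult.assoc)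
      finally show ?thesis by (simp only: mU_def)
    qed
    have "abs_commutator (\<lambda>z. F z * indicat_real (- ball y (2 * r)) z) x
      \<le> (\<integral>\<^sup>+z. (\<Sum>j. ennreal (k j) * (ennreal (norm (b x - b z)) * ennreal (F z) * indicator (ball y (R j)) z)) \<partial>MS)"
      unfolding abs_commutator_def
    proof (intro nn_integral_mono)
      fix z
      show "commutator_kernel x z * ennreal (F z * indicat_real (- ball y (2 * r)) z)
        \<le> (\<Sum>j. ennreal (k j) * (ennreal (norm (b x - b z)) * ennreal (F z) * indicator (ball y (R j)) z))"
      proof (cases "z \<in> ball y (2 * r)")
        case False
        have "commutator_kernel x z * ennreal (F z * indicat_real (- ball y (2 * r)) z)
          = (ennreal (norm (b x - b z)) * ennreal (F z)) * ennreal (norm (x - z) powr (\<gamma> - ?n))"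
          using False by (simp add: commutator_kernel_def mult_ac)
        also have "\<dots> \<le> (ennreal (norm (b x - b z)) * ennreal (F z)) * (\<Sum>j. ennreal (k j) * indicator (ball y (R j)) z)"
          unfolding k_def R_def by (intro mult_left_mono far_kernel_le[OF x False]) simp
        also have "\<dots> = (\<Sum>j. (ennreal (norm (b x - b z)) * ennreal (F z)) * (ennreal (k j) * indicator (ball y (R j)) z))"
          by (rule ennreal_suminf_cmult[symmetric])
        also have "\<dots> = (\<Sum>j. ennreal (k j) * (ennreal (norm (b x - b z)) * ennreal (F z) * indicator (ball y (R j)) z))"
          by (simp only: mult_ac)
        finally show ?thesis .
      qed simp
    qed
    also have "\<dots> = (\<Sum>j. ennreal (k j) * J j)"
      unfolding J_def by (subst nn_integral_suminf, measurable) (simp add: nn_integral_cmult)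
    also have "\<dots> \<le> (\<Sum>j. ennreal (C * (\<delta> + 1)) * (ennreal ((real j + 1) * measure MU (ball y (R j)) powr (- (1 / q))) * I j))"
      by (intro suminf_le summableI J)
    also have "\<dots> = ennreal (C * (\<delta> + 1)) * dilated_ball_sum F y r"
      unfolding dilated_ball_sum_def I_def R_def by (rule ennreal_suminf_cmult)
    finally show ?thesis by (simp only: \<delta>_def)
  qed
  ultimately show ?thesis by (rule that)
qed

text \<open>Near part: the global estimate and doubling. Far part: the pointwise bound, in which x
  enters only through an oscillation with controlled q-th moment on the ball.\<close>

lemma local_bound:
  obtains C where "0 < C" "\<And>F y r. F \<in> borel_measurable borel \<Longrightarrow> (\<And>x. 0 \<le> F x) \<Longrightarrow> 0 < r \<Longrightarrow>
    (\<integral>\<^sup>+x\<in>ball y r. abs_commutator F x ennpowr q \<partial>MU) ennpowr (1 / q)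
      \<le> ennreal (C * measure MU (ball y r) powr (1 / q)) * dilated_ball_sum F y r"
proof -
  have q1: "1 < q" using p_gt_1 p_less_q by simp
  obtain C1 where C1: "0 < C1" "\<And>F. F \<in> borel_measurable borel \<Longrightarrow> (\<And>x. 0 \<le> F x) \<Longrightarrow>
    (\<integral>\<^sup>+x. abs_commutator F x ennpowr q \<partial>MU) ennpowr (1 / q) \<le>
    ennreal C1 * (\<integral>\<^sup>+x. ennreal (F x powr p) \<partial>MS) ennpowr (1 / p)"
    by (rule strong_type) blast
  obtain C2 where C2: "0 < C2" "\<And>F y r x. F \<in> borel_measurable borel \<Longrightarrow> (\<And>x. 0 \<le> F x) \<Longrightarrow> x \<in> ball y r \<Longrightarrow>
    abs_commutator (\<lambda>z. F z * indicat_real (- ball y (2 * r)) z) x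
      \<le> ennreal (C2 * (norm (b x - c y r) + 1)) * dilated_ball_sum F y r"
    by (rule far_bound) blast
  obtain D where D: "1 \<le> D" "\<And>z r. 0 < r \<Longrightarrow> measure MU (ball z (2 * r)) \<le> D * measure MU (ball z r)"
    by (rule U.doubling) blast
  have "0 < q" using q1 by simp
  from U.John_Nirenberg_moment[OF osc this] obtain CJ where CJ: "0 < CJ"
    "\<And>z r. 0 < r \<Longrightarrow> (\<integral>\<^sup>+x\<in>ball z r. ennreal (norm (b x - c z r) powr q) \<partial>MU) \<le> ennreal CJ * emeasure MU (ball z r)"
    by blast
  define C3 where "C3 = C2 * (2 powr q * (CJ + 1)) powr (1 / q)"
  have C3: "0 < C3" using C2(1) CJ(1) by (simp add: C3_def)
  define C4 where "C4 = C1 * D powr (1 / q)"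
  have C4: "0 < C4" using C1(1) D(1) by (simp add: C4_def)
  define C where "C = (2 powr q) powr (1 / q) * (2 powr (1 / q) * (C4 + C3))"
  have "0 < C" using C3 C4 by (simp add: C_def)
  moreover have "(\<integral>\<^sup>+x\<in>ball y r. abs_commutator F x ennpowr q \<partial>MU) ennpowr (1 / q)
      \<le> ennreal (C * measure MU (ball y r) powr (1 / q)) * dilated_ball_sum F y r"
    if [measurable]: "F \<in> borel_measurable borel" and F0: "\<And>x. 0 \<le> F x" and r: "0 < r" for F y r
  proof -
    define mU where "mU = measure MU (ball y r)"
    have mU: "0 < mU" using r by (simp add: mU_def U.measure_ball_pos)
    define F1 where "F1 z = F z * indicat_real (ball y (2 * r)) z" for z
    define F2 where "F2 z = F z * indicat_real (- ball y (2 * r)) z" for z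
    have [measurable]: "F1 \<in> borel_measurable borel" "F2 \<in> borel_measurable borel"
      unfolding F1_def F2_def by (auto intro!: borel_measurable_times borel_measurable_indicator)
    have F12: "0 \<le> F1 z" "0 \<le> F2 z" "F z = F1 z + F2 z" for z
      using F0[of z] by (auto simp: F1_def F2_def indicator_def)
    have [measurable]: "abs_commutator F1 \<in> borel_measurable borel" "abs_commutator F2 \<in> borel_measurable borel"
      by measurable
    have T_split: "abs_commutator F x = abs_commutator F1 x + abs_commutator F2 x" for x
    proof -
      have "abs_commutator F x = (\<integral>\<^sup>+z. commutator_kernel x z * ennreal (F1 z) + commutator_kernel x z * ennreal (F2 z) \<partial>MS)"
        unfolding abs_commutator_def by (simp add: F12 ring_distribs)
      also have "\<dots> = abs_commutator F1 x + abs_commutator F2 x"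
        unfolding abs_commutator_def by (rule nn_integral_add) measurable
      finally show ?thesis .
    qed
    have near: "(\<integral>\<^sup>+x. abs_commutator F1 x ennpowr q \<partial>MU) ennpowr (1 / q) \<le> ennreal (C4 * mU powr (1 / q)) * dilated_ball_sum F y r"
    proof -
      define I0 where "I0 = (\<integral>\<^sup>+x\<in>ball y (2 * r). ennreal (F x powr p) \<partial>MS) ennpowr (1 / p)"
      have "(\<integral>\<^sup>+x. abs_commutator F1 x ennpowr q \<partial>MU) ennpowr (1 / q) \<le> ennreal C1 * (\<integral>\<^sup>+x. ennreal (F1 x powr p) \<partial>MS) ennpowr (1 / p)"
        by (rule C1(2)) (use F12 in auto)
      also have "(\<integral>\<^sup>+x. ennreal (F1 x powr p) \<partial>MS) = (\<integral>\<^sup>+x\<in>ball y (2 * r). ennreal (F x powr p) \<partial>MS)"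
        by (intro nn_integral_cong) (auto simp: F1_def indicator_def)
      also have "ennreal C1 * (\<integral>\<^sup>+x\<in>ball y (2 * r). ennreal (F x powr p) \<partial>MS) ennpowr (1 / p) = ennreal C1 * I0"
        by (simp only: I0_def)
      \<comment> \<open>The power of the mass of the double ball is inserted to match the term j = 0
        of the sum; doubling compensates for it by the mass of the ball itself.\<close>
      also have "\<dots> \<le> ennreal (C4 * mU powr (1 / q) * measure MU (ball y (2 * r)) powr (- (1 / q))) * I0"
      proof (intro mult_right_mono ennreal_leI)
        define m2 where "m2 = measure MU (ball y (2 * r))"
        have m2: "0 < m2" "m2 \<le> D * mU" using r D by (auto simp: m2_def mU_def U.measure_ball_pos)
        have "1 = m2 powr (1 / q) * m2 powr (- (1 / q))" using m2 by (simp flip: powr_add)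
        also have "\<dots> \<le> (D * mU) powr (1 / q) * m2 powr (- (1 / q))"
          using m2 q1 by (intro mult_right_mono powr_mono2) auto
        also have "\<dots> = D powr (1 / q) * mU powr (1 / q) * m2 powr (- (1 / q))" using D mU by (simp add: powr_mult)
        finally show "C1 \<le> C4 * mU powr (1 / q) * measure MU (ball y (2 * r)) powr (- (1 / q))"
          unfolding m2_def[symmetric] using C1(1) by (simp add: C4_def mult_ac mult_le_cancel_left1)
      qed simp
      also have "\<dots> = ennreal (C4 * mU powr (1 / q)) * (ennreal (measure MU (ball y (2 * r)) powr (- (1 / q))) * I0)"
        using C4 by (subst ennreal_mult) (auto simp: mult.assoc)
      also have "\<dots> \<le> ennreal (C4 * mU powr (1 / q)) * dilated_ball_sum F y r"
      proof (intro mult_left_mono)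
        show "ennreal (measure MU (ball y (2 * r)) powr (- (1 / q))) * I0 \<le> dilated_ball_sum F y r"
          unfolding dilated_ball_sum_def I0_def by (rule order_trans[OF _ term_le_suminf[of _ 0]]) simp
      qed simp
      finally show ?thesis .
    qed
    have far: "(\<integral>\<^sup>+x\<in>ball y r. abs_commutator F2 x ennpowr q \<partial>MU) ennpowr (1 / q) \<le> ennreal (C3 * mU powr (1 / q)) * dilated_ball_sum F y r"
    proof -
      define \<Sigma> where "\<Sigma> = dilated_ball_sum F y r"
      have "(\<integral>\<^sup>+x\<in>ball y r. abs_commutator F2 x ennpowr q \<partial>MU)
        \<le> (\<integral>\<^sup>+x. (ennreal C2 * \<Sigma>) ennpowr q * ((ennreal (2 powr q) * (ennreal (norm (b x - c y r) powr q) + 1)) * indicator (ball y r) x) \<partial>MU)"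
      proof (intro nn_integral_mono)
        fix x
        show "abs_commutator F2 x ennpowr q * indicator (ball y r) x \<le>
          (ennreal C2 * \<Sigma>) ennpowr q * ((ennreal (2 powr q) * (ennreal (norm (b x - c y r) powr q) + 1)) * indicator (ball y r) x)"
        proof (cases "x \<in> ball y r")
          case True
          have "abs_commutator F2 x \<le> ennreal (C2 * (norm (b x - c y r) + 1)) * \<Sigma>"
            unfolding F2_def \<Sigma>_def by (rule C2(2)) (use F0 True in auto)
          also have "\<dots> = (ennreal C2 * \<Sigma>) * (ennreal (norm (b x - c y r)) + 1)"
          proof -
            have "ennreal (C2 * (norm (b x - c y r) + 1)) = ennreal C2 * (ennreal (norm (b x - c y r)) + 1)"
              using C2(1) by (simp add: ennreal_mult ennreal_plus)
            then show ?thesis by (simp only: mult_ac)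
          qed
          finally have "abs_commutator F2 x ennpowr q \<le> ((ennreal C2 * \<Sigma>) * (ennreal (norm (b x - c y r)) + 1)) ennpowr q"
            using q1 by (intro ennpowr_mono) auto
          also have "\<dots> = (ennreal C2 * \<Sigma>) ennpowr q * (ennreal (norm (b x - c y r)) + 1) ennpowr q"
            using q1 by (intro ennpowr_mult) auto
          also have "\<dots> \<le> (ennreal C2 * \<Sigma>) ennpowr q * (ennreal (2 powr q) * (ennreal (norm (b x - c y r)) ennpowr q + 1 ennpowr q))"
            using q1 by (intro mult_left_mono ennpowr_add_le) auto
          also have "ennreal (norm (b x - c y r)) ennpowr q = ennreal (norm (b x - c y r) powr q)"
            using q1 by (intro ennpowr_ennreal') auto
          finally show ?thesis using True by simp
        qed simp
      qed
      also have "\<dots> = (ennreal C2 * \<Sigma>) ennpowr q * (ennreal (2 powr q) * ((\<integral>\<^sup>+x\<in>ball y r. ennreal (norm (b x - c y r) powr q) \<partial>MU) + emeasure MU (ball y r)))"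
        by (simp add: nn_integral_cmult mult.assoc distrib_right nn_integral_add)
      also have "\<dots> \<le> (ennreal C2 * \<Sigma>) ennpowr q * (ennreal (2 powr q) * (ennreal CJ * emeasure MU (ball y r) + emeasure MU (ball y r)))"
        by (intro mult_left_mono add_mono CJ(2) r) auto
      also have "ennreal (2 powr q) * (ennreal CJ * emeasure MU (ball y r) + emeasure MU (ball y r)) = ennreal (2 powr q * (CJ + 1) * mU)"
        unfolding U.emeasure_ball_eq mU_def[symmetric] using CJ(1) mU
        by (simp add: ennreal_mult ennreal_plus distrib_right mult.assoc)
      finally have "(\<integral>\<^sup>+x\<in>ball y r. abs_commutator F2 x ennpowr q \<partial>MU) ennpowr (1 / q)
        \<le> ((ennreal C2 * \<Sigma>) ennpowr q * ennreal (2 powr q * (CJ + 1) * mU)) ennpowr (1 / q)"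
        using q1 by (intro ennpowr_mono) auto
      also have "\<dots> = (ennreal C2 * \<Sigma>) * ennreal ((2 powr q * (CJ + 1)) powr (1 / q) * mU powr (1 / q))"
      proof -
        have "0 < 2 powr q * (CJ + 1) * mU" using CJ(1) mU by simp
        then have "ennreal (2 powr q * (CJ + 1) * mU) ennpowr (1 / q) = ennreal ((2 powr q * (CJ + 1) * mU) powr (1 / q))"
          by (rule ennpowr_ennreal)
        also have "(2 powr q * (CJ + 1) * mU) powr (1 / q) = (2 powr q * (CJ + 1)) powr (1 / q) * mU powr (1 / q)"
          by (rule powr_mult)
        finally show ?thesis using q1 by (simp add: ennpowr_mult ennpowr_ennpowr)
      qed
      also have "\<dots> = (ennreal C2 * ennreal ((2 powr q * (CJ + 1)) powr (1 / q) * mU powr (1 / q))) * \<Sigma>"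
        by (simp only: mult_ac)
      also have "ennreal C2 * ennreal ((2 powr q * (CJ + 1)) powr (1 / q) * mU powr (1 / q)) = ennreal (C3 * mU powr (1 / q))"
        using C2(1) by (simp only: ennreal_mult'[symmetric] less_imp_le C3_def mult.assoc)
      finally show ?thesis by (simp only: \<Sigma>_def)
    qed
    have "(\<integral>\<^sup>+x\<in>ball y r. abs_commutator F x ennpowr q \<partial>MU)
      \<le> (\<integral>\<^sup>+x. ennreal (2 powr q) * (abs_commutator F1 x ennpowr q + abs_commutator F2 x ennpowr q * indicator (ball y r) x) \<partial>MU)"
    proof (intro nn_integral_mono)
      fix x
      show "abs_commutator F x ennpowr q * indicator (ball y r) x \<le>
        ennreal (2 powr q) * (abs_commutator F1 x ennpowr q + abs_commutator F2 x ennpowr q * indicator (ball y r) x)"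
        unfolding T_split using q1 ennpowr_add_le[of q "abs_commutator F1 x" "abs_commutator F2 x"] by (auto simp: indicator_def)
    qed
    also have "\<dots> = ennreal (2 powr q) * ((\<integral>\<^sup>+x. abs_commutator F1 x ennpowr q \<partial>MU) + (\<integral>\<^sup>+x\<in>ball y r. abs_commutator F2 x ennpowr q \<partial>MU))"
      by (simp add: nn_integral_cmult nn_integral_add)
    finally have "(\<integral>\<^sup>+x\<in>ball y r. abs_commutator F x ennpowr q \<partial>MU) ennpowr (1 / q) \<le>
      (ennreal (2 powr q) * ((\<integral>\<^sup>+x. abs_commutator F1 x ennpowr q \<partial>MU) + (\<integral>\<^sup>+x\<in>ball y r. abs_commutator F2 x ennpowr q \<partial>MU))) ennpowr (1 / q)"
      using q1 by (intro ennpowr_mono) auto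
    also have "\<dots> = ennreal ((2 powr q) powr (1 / q)) * ((\<integral>\<^sup>+x. abs_commutator F1 x ennpowr q \<partial>MU) + (\<integral>\<^sup>+x\<in>ball y r. abs_commutator F2 x ennpowr q \<partial>MU)) ennpowr (1 / q)"
      using q1 by (subst ennpowr_mult) (auto simp: ennpowr_ennreal)
    also have "\<dots> \<le> ennreal ((2 powr q) powr (1 / q)) * (ennreal (2 powr (1 / q)) *
       ((\<integral>\<^sup>+x. abs_commutator F1 x ennpowr q \<partial>MU) ennpowr (1 / q) + (\<integral>\<^sup>+x\<in>ball y r. abs_commutator F2 x ennpowr q \<partial>MU) ennpowr (1 / q)))"
      using q1 by (intro mult_left_mono ennpowr_add_le) auto
    also have "\<dots> \<le> ennreal ((2 powr q) powr (1 / q)) * (ennreal (2 powr (1 / q)) *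
       (ennreal (C4 * mU powr (1 / q)) * dilated_ball_sum F y r + ennreal (C3 * mU powr (1 / q)) * dilated_ball_sum F y r))"
      by (intro mult_left_mono add_mono near far) auto
    also have "\<dots> = ennreal (C * mU powr (1 / q)) * dilated_ball_sum F y r"
    proof -
      have "ennreal ((2 powr q) powr (1 / q)) * (ennreal (2 powr (1 / q)) * (ennreal (C4 * mU powr (1 / q)) + ennreal (C3 * mU powr (1 / q))))
        = ennreal ((2 powr q) powr (1 / q) * (2 powr (1 / q) * (C4 * mU powr (1 / q) + C3 * mU powr (1 / q))))"
        using C3 C4 by (simp only: ennreal_mult' ennreal_plus powr_ge_zero mult_nonneg_nonneg less_imp_le)
      also have "\<dots> = ennreal (C * mU powr (1 / q))" by (simp add: C_def ring_distribs mult_ac)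
      finally have eq: "ennreal ((2 powr q) powr (1 / q)) * (ennreal (2 powr (1 / q)) * (ennreal (C4 * mU powr (1 / q)) + ennreal (C3 * mU powr (1 / q))))
        = ennreal (C * mU powr (1 / q))" .
      show ?thesis unfolding eq[symmetric] by (simp only: distrib_right mult.assoc)
    qed
    finally show ?thesis by (simp only: mU_def)
  qed
  ultimately show ?thesis by (rule that)
qed

text \<open>Reverse doubling turns the polynomial growth in the number of dilations into geometric decay.\<close>

lemma amalgam_pointwise_bound:
  assumes e: "0 < e + 1 / q"
  obtains C \<theta> where "0 < C" "0 < \<theta>" "\<theta> < 1" "\<And>F y r. F \<in> borel_measurable borel \<Longrightarrow> (\<And>x. 0 \<le> F x) \<Longrightarrow> 0 < r \<Longrightarrow>
    ennreal (measure MU (ball y r) powr e) * (\<integral>\<^sup>+x\<in>ball y r. abs_commutator F x ennpowr q \<partial>MU) ennpowr (1 / q)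
      \<le> (\<Sum>j. ennreal (C * \<theta> ^ j) * (ennreal (measure MU (ball y (2 ^ (j + 1) * r)) powr e) *
          (\<integral>\<^sup>+x\<in>ball y (2 ^ (j + 1) * r). ennreal (F x powr p) \<partial>MS) ennpowr (1 / p)))"
proof -
  obtain C1 where C1: "0 < C1" "\<And>F y r. F \<in> borel_measurable borel \<Longrightarrow> (\<And>x. 0 \<le> F x) \<Longrightarrow> 0 < r \<Longrightarrow>
    (\<integral>\<^sup>+x\<in>ball y r. abs_commutator F x ennpowr q \<partial>MU) ennpowr (1 / q)
      \<le> ennreal (C1 * measure MU (ball y r) powr (1 / q)) * dilated_ball_sum F y r"
    by (rule local_bound) blast
  obtain \<eta> where \<eta>: "0 < \<eta>" "\<eta> < 1" "\<And>z r. 0 < r \<Longrightarrow> measure MU (ball z r) \<le> \<eta> * measure MU (ball z (2 * r))"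
    by (rule U.reverse_doubling) blast
  \<comment> \<open>The total power of the mass of \<open>ball y r\<close> after
    \<open>local_bound\<close> is applied. It is positive, so passing to the j-th dilate gains the
    factor \<eta> powr (j * \<delta>).\<close>
  define \<delta> where "\<delta> = e + 1 / q"
  have \<delta>: "0 < \<delta>" using e by (simp add: \<delta>_def)
  define \<phi> where "\<phi> = \<eta> powr \<delta>"
  have \<phi>: "0 < \<phi>" "\<phi> < 1" using \<eta> \<delta> powr_less_mono2[of \<delta> \<eta> 1] by (auto simp: \<phi>_def)
  obtain C2 where C2: "0 < C2" "\<And>k::nat. (real k + 1) powr 1 * \<phi> ^ k \<le> C2 * sqrt \<phi> ^ k"
    using poly_geometric_bound[OF \<phi>, of 1] by auto
  have "0 < C1 * C2" using C1(1) C2(1) by simp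
  moreover have "0 < sqrt \<phi>" "sqrt \<phi> < 1" using \<phi> by auto
  moreover have "ennreal (measure MU (ball y r) powr e) * (\<integral>\<^sup>+x\<in>ball y r. abs_commutator F x ennpowr q \<partial>MU) ennpowr (1 / q)
      \<le> (\<Sum>j. ennreal (C1 * C2 * sqrt \<phi> ^ j) * (ennreal (measure MU (ball y (2 ^ (j + 1) * r)) powr e) *
          (\<integral>\<^sup>+x\<in>ball y (2 ^ (j + 1) * r). ennreal (F x powr p) \<partial>MS) ennpowr (1 / p)))"
    if [measurable]: "F \<in> borel_measurable borel" and F0: "\<And>x. 0 \<le> F x" and r: "0 < r" for F y r
  proof -
    define m where "m = measure MU (ball y r)"
    have m: "0 < m" using r by (simp add: m_def U.measure_ball_pos)
    define M where "M j = measure MU (ball y (2 ^ (j + 1) * r))" for j :: nat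
    have M: "0 < M j" for j using r by (simp add: M_def U.measure_ball_pos)
    define I where "I j = (\<integral>\<^sup>+x\<in>ball y (2 ^ (j + 1) * r). ennreal (F x powr p) \<partial>MS) ennpowr (1 / p)" for j :: nat
    have grow: "m \<le> \<eta> ^ j * measure MU (ball y (2 ^ j * r))" for j :: nat
    proof (induction j)
      case (Suc j)
      have "m \<le> \<eta> ^ j * measure MU (ball y (2 ^ j * r))" by (rule Suc)
      also have "\<dots> \<le> \<eta> ^ j * (\<eta> * measure MU (ball y (2 * (2 ^ j * r))))"
        using \<eta> r by (intro mult_left_mono \<eta>(3)) auto
      finally show ?case by (simp add: mult_ac)
    qed (simp add: m_def)
    have coeff: "m powr \<delta> * ((real j + 1) * M j powr (- (1 / q))) \<le> C2 * sqrt \<phi> ^ j * M j powr e" for j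
    proof -
      have "m \<le> \<eta> ^ (j + 1) * M j" using grow[of "j + 1"] by (simp add: M_def)
      \<comment> \<open>One factor \<eta> is given away so that the exponent agrees with the index
        j.\<close>
      also have "\<dots> \<le> \<eta> ^ j * M j" using \<eta> M[of j] by (intro mult_right_mono) (auto simp: mult_left_le_one_le)
      finally have "m powr \<delta> \<le> (\<eta> ^ j * M j) powr \<delta>" using m \<delta> by (intro powr_mono2) auto
      also have "\<dots> = \<phi> ^ j * M j powr \<delta>"
        using \<eta> by (simp add: powr_mult \<phi>_def powr_powr mult.commute flip: powr_realpow)
      finally have "m powr \<delta> * ((real j + 1) * M j powr (- (1 / q))) \<le> (\<phi> ^ j * M j powr \<delta>) * ((real j + 1) * M j powr (- (1 / q)))"
        by (rule mult_right_mono) simp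
      also have "\<dots> = ((real j + 1) * \<phi> ^ j) * (M j powr \<delta> * M j powr (- (1 / q)))" by (simp only: mult_ac)
      also have "M j powr \<delta> * M j powr (- (1 / q)) = M j powr e" by (simp add: \<delta>_def flip: powr_add)
      also have "((real j + 1) * \<phi> ^ j) * M j powr e \<le> (C2 * sqrt \<phi> ^ j) * M j powr e"
        using C2(2)[of j] by (intro mult_right_mono) auto
      finally show ?thesis .
    qed
    have "ennreal (m powr e) * (\<integral>\<^sup>+x\<in>ball y r. abs_commutator F x ennpowr q \<partial>MU) ennpowr (1 / q)
      \<le> ennreal (m powr e) * (ennreal (C1 * m powr (1 / q)) * dilated_ball_sum F y r)"
      unfolding m_def by (intro mult_left_mono C1(2)) (use F0 r in auto)
    also have "\<dots> = ennreal (C1 * m powr \<delta>) * dilated_ball_sum F y r"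
    proof -
      have "m powr e * (C1 * m powr (1 / q)) = C1 * m powr \<delta>" by (simp add: \<delta>_def powr_add)
      then have "ennreal (m powr e) * ennreal (C1 * m powr (1 / q)) = ennreal (C1 * m powr \<delta>)"
        by (metis ennreal_mult' powr_ge_zero)
      then show ?thesis by (simp add: mult.assoc[symmetric])
    qed
    also have "\<dots> = (\<Sum>j. ennreal (C1 * m powr \<delta>) * (ennreal ((real j + 1) * M j powr (- (1 / q))) * I j))"
      unfolding dilated_ball_sum_def M_def I_def by (rule ennreal_suminf_cmult[symmetric])
    also have "\<dots> \<le> (\<Sum>j. ennreal (C1 * C2 * sqrt \<phi> ^ j) * (ennreal (M j powr e) * I j))"
    proof (intro suminf_le summableI)
      fix j
      have "ennreal (C1 * m powr \<delta>) * (ennreal ((real j + 1) * M j powr (- (1 / q))) * I j)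
        = ennreal (C1 * (m powr \<delta> * ((real j + 1) * M j powr (- (1 / q))))) * I j"
        using C1(1) by (simp add: ennreal_mult mult.assoc)
      also have "\<dots> \<le> ennreal (C1 * (C2 * sqrt \<phi> ^ j * M j powr e)) * I j"
        using C1(1) by (intro mult_right_mono ennreal_leI mult_left_mono coeff) auto
      also have "\<dots> = ennreal (C1 * C2 * sqrt \<phi> ^ j) * (ennreal (M j powr e) * I j)"
        using C1(1) C2(1) \<phi> by (simp add: ennreal_mult mult.assoc)
      finally show "ennreal (C1 * m powr \<delta>) * (ennreal ((real j + 1) * M j powr (- (1 / q))) * I j)
        \<le> ennreal (C1 * C2 * sqrt \<phi> ^ j) * (ennreal (M j powr e) * I j)" .
    qed
    finally show ?thesis by (simp only: m_def M_def I_def)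
  qed
  ultimately show ?thesis by (rule that)
qed

end

section \<open>Transfer to the amalgam spaces\<close>

text \<open>Jensen's inequality for the measure with mass c j at j, obtained from Hoelder's
  inequality for the counting measure.\<close>

lemma suminf_ennpowr_le:
  fixes c :: "nat \<Rightarrow> real" and a :: "nat \<Rightarrow> ennreal"
  assumes c: "\<And>j. 0 \<le> c j" "summable c" "0 < suminf c" and t: "1 < t"
  shows "(\<Sum>j. ennreal (c j) * a j) ennpowr t \<le> ennreal (suminf c powr (t - 1)) * (\<Sum>j. ennreal (c j) * a j ennpowr t)"
proof -
  define t' where "t' = t / (t - 1)"
  have tt: "1 / t + 1 / t' = 1" "1 / t' = 1 - 1 / t" and t': "0 < t'" using t by (auto simp: t'_def field_simps)
  define f where "f j = ennreal (c j powr (1 / t)) * a j" for j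
  define g where "g j = ennreal (c j powr (1 - 1 / t))" for j
  have ex: "0 < 1 / t" "0 < 1 - 1 / t" "(1 - 1 / t) * t' = 1" using t by (auto simp: t'_def field_simps)
  have fg: "f j * g j = ennreal (c j) * a j" for j
  proof -
    have "c j powr (1 / t) * c j powr (1 - 1 / t) = c j" using c(1)[of j] by (simp flip: powr_add)
    then have "ennreal (c j powr (1 / t)) * ennreal (c j powr (1 - 1 / t)) = ennreal (c j)"
      by (metis ennreal_mult' powr_ge_zero)
    then show ?thesis by (simp add: f_def g_def mult_ac)
  qed
  have ft: "f j ennpowr t = ennreal (c j) * a j ennpowr t" for j
    using t c(1)[of j] by (simp add: f_def ennpowr_mult ennpowr_ennreal' powr_powr)
  have gt: "g j ennpowr t' = ennreal (c j)" for j
    using t' c(1)[of j] ex(3) by (simp add: g_def ennpowr_ennreal' powr_powr)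
  have "(\<integral>\<^sup>+j. f j * g j \<partial>count_space UNIV) \<le> (\<integral>\<^sup>+j. f j ennpowr t \<partial>count_space UNIV) ennpowr (1 / t) *
    (\<integral>\<^sup>+j. g j ennpowr t' \<partial>count_space UNIV) ennpowr (1 / t')"
    by (rule Holder_nn_integral[OF _ _ t tt(1)]) auto
  then have "(\<Sum>j. ennreal (c j) * a j) \<le> (\<Sum>j. ennreal (c j) * a j ennpowr t) ennpowr (1 / t) * (\<Sum>j. ennreal (c j)) ennpowr (1 / t')"
    by (simp add: nn_integral_count_space_nat fg ft gt)
  also have "(\<Sum>j. ennreal (c j)) = ennreal (suminf c)" using c by (intro suminf_ennreal2) auto
  finally have "(\<Sum>j. ennreal (c j) * a j) ennpowr t \<le>
    ((\<Sum>j. ennreal (c j) * a j ennpowr t) ennpowr (1 / t) * ennreal (suminf c) ennpowr (1 / t')) ennpowr t"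
    using t by (intro ennpowr_mono) auto
  also have "\<dots> = (\<Sum>j. ennreal (c j) * a j ennpowr t) * ennreal (suminf c powr (t - 1))"
  proof -
    have "(1 - 1 / t) * t = t - 1" using t by (simp add: field_simps)
    then show ?thesis using t c(3) by (simp add: ennpowr_mult ennpowr_ennpowr ennpowr_ennreal powr_powr tt(2))
  qed
  finally show ?thesis by (simp add: mult.commute)
qed

text \<open>Takes the place of Minkowski's inequality for series. As all A j share the bound X,
  Jensen's inequality with weights c j already yields the factor \<open>suminf c\<close>; for
  infinite s the bound holds almost everywhere.\<close>

lemma weighted_Lnorm_suminf_le:
  fixes g :: "'a::euclidean_space \<Rightarrow> ennreal"
  assumes s: "1 < s" and c: "\<And>j. 0 \<le> c j" "summable c" "0 < suminf c"
    and [measurable]: "\<And>j. A j \<in> borel_measurable lebesgue" "g \<in> borel_measurable lebesgue" "\<mu> \<in> borel_measurable lebesgue"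
    and A: "\<And>j. weighted_Lnorm s \<mu> (A j) \<le> X"
    and g: "\<And>y. g y \<le> (\<Sum>j. ennreal (c j) * A j y)"
  shows "weighted_Lnorm s \<mu> g \<le> ennreal (suminf c) * X"
proof (cases "s = \<infinity>")
  case True
  have sumX: "(\<Sum>j. ennreal (c j) * X) = ennreal (suminf c) * X"
  proof -
    have "(\<Sum>j. ennreal (c j) * X) = (\<Sum>j. ennreal (c j)) * X" by (rule ennreal_suminf_multc)
    also have "(\<Sum>j. ennreal (c j)) = ennreal (suminf c)" using c by (intro suminf_ennreal2) auto
    finally show ?thesis .
  qed
  let ?M = "density lebesgue (\<lambda>x. ennreal (\<mu> x))"
  have "AE y in ?M. A j y \<le> X" for j
    using esssup_AE[of "A j" ?M] A[of j] True by (auto simp: weighted_Lnorm_def elim!: eventually_mono)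
  then have "AE y in ?M. \<forall>j. A j y \<le> X" by (simp add: AE_all_countable)
  then have "AE y in ?M. g y \<le> ennreal (suminf c) * X"
  proof eventually_elim
    case (elim y)
    have "g y \<le> (\<Sum>j. ennreal (c j) * A j y)" by (rule g)
    also have "\<dots> \<le> (\<Sum>j. ennreal (c j) * X)" using elim by (intro suminf_le summableI mult_left_mono) auto
    finally show ?case by (simp only: sumX)
  qed
  moreover have "g \<in> borel_measurable ?M" by simp
  ultimately have "esssup ?M g \<le> ennreal (suminf c) * X" by (intro esssup_I)
  then show ?thesis using True by (simp add: weighted_Lnorm_def)
next
  case False
  define t where "t = enn2real s"
  have st: "s = ennreal t" using False by (simp add: t_def less_top)
  then have t: "1 < t" using s by simp
  have S: "0 < suminf c" by (rule c)
  have L: "weighted_Lnorm s \<mu> h = (\<integral>\<^sup>+x. h x ennpowr t * ennreal (\<mu> x) \<partial>lebesgue) ennpowr (1 / t)" for h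
    using False by (simp add: weighted_Lnorm_def t_def)
  have At: "(\<integral>\<^sup>+x. A j x ennpowr t * ennreal (\<mu> x) \<partial>lebesgue) \<le> X ennpowr t" for j
  proof -
    have "((\<integral>\<^sup>+x. A j x ennpowr t * ennreal (\<mu> x) \<partial>lebesgue) ennpowr (1 / t)) ennpowr t \<le> X ennpowr t"
      using A[of j] t by (intro ennpowr_mono) (auto simp: L)
    then show ?thesis using t by (simp add: ennpowr_ennpowr)
  qed
  have "(\<integral>\<^sup>+x. g x ennpowr t * ennreal (\<mu> x) \<partial>lebesgue)
    \<le> (\<integral>\<^sup>+x. ennreal (suminf c powr (t - 1)) * (\<Sum>j. ennreal (c j) * (A j x ennpowr t * ennreal (\<mu> x))) \<partial>lebesgue)"
  proof (intro nn_integral_mono)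
    fix x
    have "g x ennpowr t \<le> (\<Sum>j. ennreal (c j) * A j x) ennpowr t" using t by (intro ennpowr_mono g) auto
    also have "\<dots> \<le> ennreal (suminf c powr (t - 1)) * (\<Sum>j. ennreal (c j) * A j x ennpowr t)"
      by (rule suminf_ennpowr_le[OF c t])
    finally have "g x ennpowr t * ennreal (\<mu> x) \<le> ennreal (suminf c powr (t - 1)) * (\<Sum>j. ennreal (c j) * A j x ennpowr t) * ennreal (\<mu> x)"
      by (rule mult_right_mono) simp
    also have "\<dots> = ennreal (suminf c powr (t - 1)) * (\<Sum>j. ennreal (c j) * (A j x ennpowr t * ennreal (\<mu> x)))"
      by (simp only: mult.assoc ennreal_suminf_multc[symmetric])
    finally show "g x ennpowr t * ennreal (\<mu> x) \<le> ennreal (suminf c powr (t - 1)) * (\<Sum>j. ennreal (c j) * (A j x ennpowr t * ennreal (\<mu> x)))" .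
  qed
  also have "\<dots> = ennreal (suminf c powr (t - 1)) * (\<Sum>j. ennreal (c j) * (\<integral>\<^sup>+x. A j x ennpowr t * ennreal (\<mu> x) \<partial>lebesgue))"
    by (simp add: nn_integral_cmult nn_integral_suminf)
  also have "\<dots> \<le> ennreal (suminf c powr (t - 1)) * (\<Sum>j. ennreal (c j) * X ennpowr t)"
    by (intro mult_left_mono suminf_le summableI At) auto
  also have "(\<Sum>j. ennreal (c j) * X ennpowr t) = (\<Sum>j. ennreal (c j)) * X ennpowr t" by (rule ennreal_suminf_multc)
  also have "(\<Sum>j. ennreal (c j)) = ennreal (suminf c)" using c by (intro suminf_ennreal2) auto
  finally have "weighted_Lnorm s \<mu> g \<le> (ennreal (suminf c powr (t - 1)) * (ennreal (suminf c) * X ennpowr t)) ennpowr (1 / t)"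
    unfolding L using t by (intro ennpowr_mono) auto
  also have "ennreal (suminf c powr (t - 1)) * (ennreal (suminf c) * X ennpowr t) = (ennreal (suminf c) * X) ennpowr t"
  proof -
    have "suminf c powr (t - 1) * suminf c = suminf c powr t"
      using powr_mult_base[of "suminf c" "t - 1"] S by (simp add: mult.commute)
    then have "ennreal (suminf c powr (t - 1)) * ennreal (suminf c) = ennreal (suminf c powr t)"
      by (metis ennreal_mult' powr_ge_zero)
    then show ?thesis using t S by (simp add: ennpowr_mult ennpowr_ennreal mult.assoc[symmetric])
  qed
  also have "((ennreal (suminf c) * X) ennpowr t) ennpowr (1 / t) = ennreal (suminf c) * X"
    using t by (simp add: ennpowr_ennpowr)
  finally show ?thesis .
qed

text \<open>Restricted to the points with \<mu> y > 0, since the norm does not see the set where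
  \<mu> vanishes.\<close>

lemma weighted_Lnorm_finite_AE:
  fixes g :: "'a::euclidean_space \<Rightarrow> ennreal"
  assumes s: "1 < s" and [measurable]: "g \<in> borel_measurable lebesgue" "\<mu> \<in> borel_measurable lebesgue"
    and fin: "weighted_Lnorm s \<mu> g < \<infinity>"
  shows "AE y in lebesgue. 0 < \<mu> y \<longrightarrow> g y < \<infinity>"
proof (cases "s = \<infinity>")
  case True
  have "AE y in density lebesgue (\<lambda>x. ennreal (\<mu> x)). g y \<le> esssup (density lebesgue (\<lambda>x. ennreal (\<mu> x))) g"
    by (rule esssup_AE)
  then have "AE y in lebesgue. 0 < ennreal (\<mu> y) \<longrightarrow> g y \<le> esssup (density lebesgue (\<lambda>x. ennreal (\<mu> x))) g"
    by (subst (asm) AE_density) auto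
  moreover have "esssup (density lebesgue (\<lambda>x. ennreal (\<mu> x))) g < \<infinity>"
    using fin True by (simp add: weighted_Lnorm_def)
  ultimately show ?thesis by (auto elim!: eventually_mono simp: le_less_trans)
next
  case False
  define t where "t = enn2real s"
  have st: "s = ennreal t" using False by (simp add: t_def less_top)
  then have t: "1 < t" using s by simp
  have "(\<integral>\<^sup>+x. g x ennpowr t * ennreal (\<mu> x) \<partial>lebesgue) ennpowr (1 / t) < \<infinity>"
    using fin False by (simp add: weighted_Lnorm_def t_def)
  then have "(\<integral>\<^sup>+x. g x ennpowr t * ennreal (\<mu> x) \<partial>lebesgue) \<noteq> \<infinity>"
    using t ennpowr_less_top_iff[of "1 / t"] by auto
  then have "AE x in lebesgue. g x ennpowr t * ennreal (\<mu> x) \<noteq> \<infinity>"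
    by (intro nn_integral_PInf_AE) auto
  then show ?thesis
  proof eventually_elim
    case (elim x)
    then show ?case using t by (cases "g x = top") (auto simp: ennreal_top_mult less_top[symmetric] split: if_splits)
  qed
qed

section \<open>Borel representatives, and the passage from the hypotheses on w and b to the
  two-weight setting\<close>

lemma borel_representative:
  fixes f :: "'a::euclidean_space \<Rightarrow> 'b::euclidean_space"
  assumes f [measurable]: "f \<in> borel_measurable lebesgue"
  obtains g where "g \<in> borel_measurable borel" "AE x in lborel. f x = g x"
proof -
  have "\<exists>h. h \<in> borel_measurable lborel \<and> (AE x in lborel. f x \<bullet> i = h x)" for i
    using completion_ex_borel_measurable_real[of "\<lambda>x. f x \<bullet> i" lborel] by auto
  then obtain h where h: "\<And>i. h i \<in> borel_measurable lborel" "\<And>i. AE x in lborel. f x \<bullet> i = h i x"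
    by metis
  define g where "g x = (\<Sum>i\<in>Basis. h i x *\<^sub>R i)" for x
  have [measurable]: "h i \<in> borel_measurable borel" for i using h(1)[of i] by simp
  have "g \<in> borel_measurable borel" unfolding g_def by measurable
  moreover have "AE x in lborel. \<forall>i\<in>Basis. f x \<bullet> i = h i x"
    using h(2) by (intro AE_finite_allI) auto
  then have "AE x in lborel. f x = g x"
  proof eventually_elim
    case (elim x)
    have "f x = (\<Sum>i\<in>Basis. (f x \<bullet> i) *\<^sub>R i)" by (simp add: euclidean_representation)
    also have "\<dots> = g x" unfolding g_def using elim by (intro sum.cong) auto
    finally show ?case .
  qed
  ultimately show ?thesis by (rule that)
qed

lemma emeasure_density_ball:
  assumes [measurable]: "u \<in> borel_measurable borel" "E \<in> sets borel"
  shows "emeasure (density lborel (\<lambda>x. ennreal (u x))) E = (\<integral>\<^sup>+x\<in>E. ennreal (u x) \<partial>lborel)"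
  by (simp add: emeasure_density)

text \<open>Since u^a v^(1-a) = 1, Hoelder's inequality on E gives |E| <= U(E)^a V(E)^(1-a) <=
  U(E)^a V(B)^(1-a). Multiplying by U(B)^a and inserting the bound on B gives the A-infinity
  condition with exponent a. The roles of u and v can be exchanged.\<close>

lemma A_infty_of_dual_weights:
  fixes u v :: "'a::euclidean_space \<Rightarrow> real"
  assumes [measurable]: "u \<in> borel_measurable borel" "v \<in> borel_measurable borel"
    and pos: "\<And>x. 0 < u x" "\<And>x. 0 < v x" and a: "0 < a" "a < 1"
    and prod: "\<And>x. u x powr a * v x powr (1 - a) = 1"
    and fin: "\<And>z r. (\<integral>\<^sup>+x\<in>ball z r. ennreal (u x) \<partial>lborel) < top" "\<And>z r. (\<integral>\<^sup>+x\<in>ball z r. ennreal (v x) \<partial>lborel) < top"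
    and K: "0 < K"
    and bound: "\<And>z r. 0 < r \<Longrightarrow> measure (density lborel (\<lambda>x. ennreal (u x))) (ball z r) powr a *
      measure (density lborel (\<lambda>x. ennreal (v x))) (ball z r) powr (1 - a) \<le> K * measure lborel (ball z r)"
  shows "A_infty_measure (density lborel (\<lambda>x. ennreal (u x))) K a"
proof -
  define U where "U = density lborel (\<lambda>x. ennreal (u x))"
  define V where "V = density lborel (\<lambda>x. ennreal (v x))"
  have fU: "emeasure U E = ennreal (measure U E)" and fV: "emeasure V E = ennreal (measure V E)"
    if "E \<in> sets borel" "E \<subseteq> ball z r" for E z r
  proof -
    have "emeasure U E \<le> emeasure U (ball z r)" "emeasure V E \<le> emeasure V (ball z r)"
      using that by (auto intro!: emeasure_mono simp: U_def V_def)
    moreover have "emeasure U (ball z r) < top" "emeasure V (ball z r) < top"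
      using fin by (auto simp: U_def V_def emeasure_density_ball)
    ultimately have "emeasure U E < top" "emeasure V E < top" by order+
    then show "emeasure U E = ennreal (measure U E)" "emeasure V E = ennreal (measure V E)"
      by (auto intro!: emeasure_eq_ennreal_measure)
  qed
  have Holder: "measure lborel E \<le> measure U E powr a * measure V E powr (1 - a)"
    if E [measurable]: "E \<in> sets borel" and sub: "E \<subseteq> ball z r" for E z r
  proof -
    have ex: "1 < 1 / a" "1 / (1 / a) + 1 / (1 / (1 - a)) = 1" "0 < 1 - a" using a by auto
    have pw: "ennreal (u x powr a) ennpowr (1 / a) = ennreal (u x)"
      "ennreal (v x powr (1 - a)) ennpowr (1 / (1 - a)) = ennreal (v x)" for x
      using ennpowr_ennreal'[of "u x powr a" "1 / a"] ennpowr_ennreal'[of "v x powr (1 - a)" "1 / (1 - a)"]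
        pos(1)[of x] pos(2)[of x] a by (simp_all add: powr_powr)
    have "emeasure lborel E = (\<integral>\<^sup>+x. indicator E x \<partial>lborel)" by simp
    also have "\<dots> = (\<integral>\<^sup>+x. (ennreal (u x powr a) * indicator E x) * (ennreal (v x powr (1 - a)) * indicator E x) \<partial>lborel)"
      using prod by (intro nn_integral_cong) (auto simp: indicator_def simp flip: ennreal_mult)
    also have "\<dots> \<le> (\<integral>\<^sup>+x. (ennreal (u x powr a) * indicator E x) ennpowr (1 / a) \<partial>lborel) ennpowr (1 / (1 / a)) *
      (\<integral>\<^sup>+x. (ennreal (v x powr (1 - a)) * indicator E x) ennpowr (1 / (1 - a)) \<partial>lborel) ennpowr (1 / (1 / (1 - a)))"
      by (rule Holder_nn_integral[OF _ _ ex(1,2)]) measurable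
    also have "(\<integral>\<^sup>+x. (ennreal (u x powr a) * indicator E x) ennpowr (1 / a) \<partial>lborel) = emeasure U E"
      unfolding U_def using a
      by (subst emeasure_density_ball) (auto intro!: nn_integral_cong simp: indicator_def pw)
    also have "(\<integral>\<^sup>+x. (ennreal (v x powr (1 - a)) * indicator E x) ennpowr (1 / (1 - a)) \<partial>lborel) = emeasure V E"
      unfolding V_def using a
      by (subst emeasure_density_ball) (auto intro!: nn_integral_cong simp: indicator_def pw)
    finally have "emeasure lborel E \<le> ennreal (measure U E powr a * measure V E powr (1 - a))"
      using a by (simp only: fU[OF E sub] fV[OF E sub]) (simp add: ennpowr_ennreal' ennreal_mult)
    then have "enn2real (emeasure lborel E) \<le> enn2real (ennreal (measure U E powr a * measure V E powr (1 - a)))"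
      by (rule enn2real_mono) simp
    then show ?thesis by (simp add: measure_def)
  qed
  have "A_infty_measure U K a"
  proof
    show "sets U = sets borel" by (simp add: U_def)
    show "absolutely_continuous lborel U" unfolding U_def by (rule absolutely_continuousI_density) measurable
    show "emeasure U (ball z r) < top" for z r using fU[of "ball z r" z r] by simp
    \<comment> \<open>A ball of U-measure zero would have Lebesgue measure zero by the inequality
      just proved.\<close>
    show "0 < emeasure U (ball z r)" if "0 < r" for z r
    proof (rule ccontr)
      assume "\<not> 0 < emeasure U (ball z r)"
      then have "measure U (ball z r) = 0" by (simp add: measure_def)
      then have "measure lborel (ball z r) \<le> 0" using Holder[of "ball z r" z r] by simp
      then show False using content_ball_pos[OF that, of z] by simp
    qed
    show "measure lborel E * measure U (ball z r) powr a \<le> K * measure lborel (ball z r) * measure U E powr a"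
      if r: "0 < r" and E: "E \<in> sets borel" "E \<subseteq> ball z r" for r E z
    proof -
      have "emeasure V E \<le> emeasure V (ball z r)" using E by (auto intro!: emeasure_mono simp: V_def)
      then have VE: "measure V E \<le> measure V (ball z r)"
        using fV[OF E] fV[of "ball z r" z r] by (simp add: ennreal_le_iff)
      have "measure lborel E * measure U (ball z r) powr a \<le> (measure U E powr a * measure V E powr (1 - a)) * measure U (ball z r) powr a"
        by (intro mult_right_mono Holder[OF E]) simp
      also have "\<dots> \<le> (measure U E powr a * measure V (ball z r) powr (1 - a)) * measure U (ball z r) powr a"
        using VE a by (intro mult_right_mono mult_left_mono powr_mono2) auto
      also have "\<dots> = measure U E powr a * (measure U (ball z r) powr a * measure V (ball z r) powr (1 - a))" by (simp only: mult_ac)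
      also have "\<dots> \<le> measure U E powr a * (K * measure lborel (ball z r))"
        using bound[OF r, of z] by (intro mult_left_mono) (auto simp: U_def V_def)
      finally show ?thesis by (simp only: mult_ac)
    qed
  qed (use K a in auto)
  then show ?thesis by (simp only: U_def)
qed

lemma locally_integrable_measurable:
  fixes f :: "'a::euclidean_space \<Rightarrow> 'b::euclidean_space"
  assumes "locally_integrable f"
  shows "f \<in> borel_measurable lebesgue"
proof (rule borel_measurable_LIMSEQ_metric)
  fix m :: nat
  have "set_integrable lebesgue (cball 0 (real m)) f"
    using assms by (simp add: locally_integrable_def)
  then show "(\<lambda>x. indicat_real (cball 0 (real m)) x *\<^sub>R f x) \<in> borel_measurable lebesgue"
    unfolding set_integrable_def by (rule borel_measurable_integrable)
next
  fix x :: 'a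
  have "eventually (\<lambda>m. indicat_real (cball 0 (real m)) x *\<^sub>R f x = f x) sequentially"
    using eventually_ge_at_top[of "nat \<lceil>norm x\<rceil>"]
  proof eventually_elim
    case (elim m)
    then have "norm x \<le> real m" by linarith
    then show ?case by simp
  qed
  then show "(\<lambda>m. indicat_real (cball 0 (real m)) x *\<^sub>R f x) \<longlonglongrightarrow> f x"
    by (rule tendsto_eventually)
qed

text \<open>Finiteness of the averages of w^(-p') forces w > 0 almost everywhere. The representative
  is positive everywhere, so all its real powers are finite positive functions, and the averages
  become measures of balls.\<close>

lemma Apq_representative:
  fixes w :: "'a::euclidean_space \<Rightarrow> real"
  assumes w: "w \<in> Apq p q" and p: "1 < p" and q: "1 < q"
  obtains w' K where "w' \<in> borel_measurable borel" "\<And>x. 0 < w' x" "AE x in lborel. w x = w' x" "0 < K"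
    "\<And>z r. (\<integral>\<^sup>+x\<in>ball z r. ennreal (w' x powr q) \<partial>lborel) < top"
    "\<And>z r. (\<integral>\<^sup>+x\<in>ball z r. ennreal (w' x powr (- conj_exponent p)) \<partial>lborel) < top"
    "\<And>z r. 0 < r \<Longrightarrow> measure (density lborel (\<lambda>x. ennreal (w' x powr q))) (ball z r) powr (1 / q) *
       measure (density lborel (\<lambda>x. ennreal (w' x powr (- conj_exponent p)))) (ball z r) powr (1 / conj_exponent p)
       \<le> K * measure lborel (ball z r) powr (1 / q + 1 / conj_exponent p)"
proof -
  define p' where "p' = conj_exponent p"
  have p': "1 < p'" using p by (simp add: p'_def conj_exponent_def)
  obtain C where C: "0 < C" and fin: "\<And>c r. 0 < r \<Longrightarrow> enn_avg (ball c r) (\<lambda>x. ennreal (w x) ennpowr (- p')) < \<infinity>"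
    and bnd: "\<And>c r. 0 < r \<Longrightarrow> enn_avg (ball c r) (\<lambda>x. ennreal (w x) ennpowr q) ennpowr (1 / q) *
      enn_avg (ball c r) (\<lambda>x. ennreal (w x) ennpowr (- p')) ennpowr (1 / p') \<le> ennreal C"
    and wt: "weight w"
    using w unfolding Apq_def p'_def by blast
  have w0: "0 \<le> w x" for x using wt by (simp add: weight_def)
  have wm: "w \<in> borel_measurable lebesgue" using wt by (auto simp: weight_def intro: locally_integrable_measurable)
  obtain g where g [measurable]: "g \<in> borel_measurable borel" and wg: "AE x in lborel. w x = g x"
    using borel_representative[OF wm] by blast
  have fin_ball: "(\<integral>\<^sup>+x\<in>ball c r. ennreal (w x) ennpowr (- p') \<partial>lborel) < top" if r: "0 < r" for c r
  proof -
    have "emeasure lborel (ball c r) < top" using emeasure_lborel_ball_finite[of c r] by simp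
    then have "(top :: ennreal) / emeasure lborel (ball c r) = top" by (simp add: ennreal_top_divide less_top)
    then show ?thesis
      using fin[OF r, of c] unfolding enn_avg_def nn_integral_completion
      by (auto simp: less_top[symmetric])
  qed
  have "AE x in lborel. \<forall>m::nat. x \<in> ball 0 (real (Suc m)) \<longrightarrow> g x > 0"
    unfolding AE_all_countable
  proof
    fix m :: nat
    have eq: "(\<integral>\<^sup>+x. ennreal (g x) ennpowr (- p') * indicator (ball 0 (real (Suc m))) x \<partial>lborel)
      = (\<integral>\<^sup>+x\<in>ball 0 (real (Suc m)). ennreal (w x) ennpowr (- p') \<partial>lborel)"
      using wg by (intro nn_integral_cong_AE) auto
    also have "\<dots> < top" by (rule fin_ball) simp
    finally have "AE x in lborel. ennreal (g x) ennpowr (- p') * indicator (ball 0 (real (Suc m))) x \<noteq> \<infinity>"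
      by (intro nn_integral_PInf_AE) auto
    with wg show "AE x in lborel. x \<in> ball 0 (real (Suc m)) \<longrightarrow> g x > 0"
    proof eventually_elim
      case (elim x)
      show ?case
      proof (intro impI, rule ccontr)
        assume x: "x \<in> ball 0 (real (Suc m))" "\<not> 0 < g x"
        then have "g x = 0" using elim(1) w0[of x] by simp
        then have "ennreal (g x) ennpowr (- p') = \<infinity>" using p' by (simp add: ennpowr_def)
        then show False using elim(2) x(1) by simp
      qed
    qed
  qed
  then have gpos: "AE x in lborel. 0 < g x"
  proof eventually_elim
    case (elim x)
    obtain m :: nat where "norm x < real m" using reals_Archimedean2 by blast
    then have "x \<in> ball 0 (real (Suc m))" by simp
    then show ?case using elim by blast
  qed
  \<comment> \<open>The value 1 is arbitrary; it is taken on a null set only.\<close>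
  define w' where "w' x = (if 0 < g x then g x else 1)" for x
  have [measurable]: "w' \<in> borel_measurable borel" unfolding w'_def by measurable
  have w'pos: "0 < w' x" for x by (simp add: w'_def)
  have ww': "AE x in lborel. w x = w' x" using wg gpos by eventually_elim (simp add: w'_def)
  define U where "U z r = (\<integral>\<^sup>+x\<in>ball z r. ennreal (w' x powr q) \<partial>lborel)" for z r
  define V where "V z r = (\<integral>\<^sup>+x\<in>ball z r. ennreal (w' x powr (- p')) \<partial>lborel)" for z r
  have Uw: "(\<integral>\<^sup>+x\<in>ball z r. ennreal (w x) ennpowr q \<partial>lborel) = U z r"
    and Vw: "(\<integral>\<^sup>+x\<in>ball z r. ennreal (w x) ennpowr (- p') \<partial>lborel) = V z r" for z r
  proof -
    show "(\<integral>\<^sup>+x\<in>ball z r. ennreal (w x) ennpowr q \<partial>lborel) = U z r"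
      "(\<integral>\<^sup>+x\<in>ball z r. ennreal (w x) ennpowr (- p') \<partial>lborel) = V z r"
      unfolding U_def V_def using ww' by (auto intro!: nn_integral_cong_AE elim!: eventually_mono simp: ennpowr_ennreal w'pos)
  qed
  have main: "U z r < top \<and> V z r < top \<and>
    enn2real (U z r) powr (1 / q) * enn2real (V z r) powr (1 / p') \<le> C * measure lborel (ball z r) powr (1 / q + 1 / p')"
    if r: "0 < r" for z r
  proof -
    define m where "m = measure lborel (ball z r)"
    have m: "0 < m" using r by (simp add: m_def content_ball)
    have em: "emeasure lebesgue (ball z r) = ennreal m"
      using emeasure_lborel_ball_finite[of z r] by (simp add: m_def emeasure_eq_ennreal_measure)
    have Vfin: "V z r < top" using fin_ball[OF r, of z] by (simp add: Vw)
    \<comment> \<open>Because 0 * top = 0, the bound on the product gives finiteness of U only once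
      V is known to be nonzero.\<close>
    have Vpos: "V z r \<noteq> 0"
    proof
      assume "V z r = 0"
      then have "AE x in lborel. ennreal (w' x powr (- p')) * indicator (ball z r) x = 0"
        unfolding V_def by (subst (asm) nn_integral_0_iff_AE) auto
      then have "AE x in lborel. x \<notin> ball z r"
      proof eventually_elim
        case (elim x)
        then show ?case using w'pos[of x] by (auto simp: indicator_def ennreal_eq_0_iff powr_def split: if_splits)
      qed
      then have "emeasure lborel (ball z r) = 0"
        by (subst (asm) AE_iff_measurable[OF _ refl]) (auto simp: ball_def)
      then show False using m by (simp add: m_def measure_def)
    qed
    obtain v0 where v0: "0 < v0" "V z r = ennreal v0"
      using Vfin Vpos by (cases "V z r" rule: ennreal_pos_cases) auto
    have b1: "(U z r / ennreal m) ennpowr (1 / q) * (V z r / ennreal m) ennpowr (1 / p') \<le> ennreal C"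
      using bnd[OF r, of z] unfolding enn_avg_def em nn_integral_completion Uw Vw .
    have b2: "V z r / ennreal m = ennreal (v0 / m)" using v0 m by (simp add: divide_ennreal)
    have Ufin: "U z r < top"
    proof (rule ccontr)
      assume "\<not> U z r < top"
      then have "U z r = top" using less_top by blast
      then have "(U z r / ennreal m) ennpowr (1 / q) = top" using q by (simp add: ennreal_top_divide)
      then have "(U z r / ennreal m) ennpowr (1 / q) * (V z r / ennreal m) ennpowr (1 / p') = top"
        using v0 m unfolding b2 by (simp add: ennpowr_ennreal ennreal_top_mult)
      then show False using b1 by (simp add: top_unique)
    qed
    then obtain u0 where u0: "0 \<le> u0" "U z r = ennreal u0" by (cases "U z r" rule: ennreal_cases) auto
    have "ennreal ((u0 / m) powr (1 / q) * (v0 / m) powr (1 / p')) \<le> ennreal C"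
      using b1 u0 v0 m q p' unfolding b2 by (simp add: divide_ennreal ennpowr_ennreal' ennreal_mult)
    then have "(u0 / m) powr (1 / q) * (v0 / m) powr (1 / p') \<le> C" using C by (simp add: ennreal_le_iff)
    then have "((u0 / m) powr (1 / q) * (v0 / m) powr (1 / p')) * m powr (1 / q + 1 / p') \<le> C * m powr (1 / q + 1 / p')"
      by (rule mult_right_mono) simp
    also have "((u0 / m) powr (1 / q) * (v0 / m) powr (1 / p')) * m powr (1 / q + 1 / p') = u0 powr (1 / q) * v0 powr (1 / p')"
      using u0 v0 m by (simp add: powr_divide powr_add)
    finally show ?thesis using Ufin Vfin u0 v0 by (simp add: m_def)
  qed
  have fin_all: "U z r < top" "V z r < top" for z r
  proof -
    have "U z r < top \<and> V z r < top"
    proof (cases "0 < r")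
      case False
      then have "ball z r = {}" by auto
      then show ?thesis unfolding U_def V_def by (simp add: ball_empty)
    qed (use main in blast)
    then show "U z r < top" "V z r < top" by auto
  qed
  have mU: "measure (density lborel (\<lambda>x. ennreal (w' x powr q))) (ball z r) = enn2real (U z r)"
    and mV: "measure (density lborel (\<lambda>x. ennreal (w' x powr (- p')))) (ball z r) = enn2real (V z r)" for z r
    by (simp_all add: measure_def U_def V_def emeasure_density_ball)
  show ?thesis
  proof (rule that[of w' C])
    fix z r
    show "(\<integral>\<^sup>+x\<in>ball z r. ennreal (w' x powr q) \<partial>lborel) < top"
      using fin_all(1) by (simp only: U_def)
    show "(\<integral>\<^sup>+x\<in>ball z r. ennreal (w' x powr (- conj_exponent p)) \<partial>lborel) < top"
      using fin_all(2) by (simp only: V_def p'_def)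
    show "measure (density lborel (\<lambda>x. ennreal (w' x powr q))) (ball z r) powr (1 / q) *
       measure (density lborel (\<lambda>x. ennreal (w' x powr (- conj_exponent p)))) (ball z r) powr (1 / conj_exponent p)
       \<le> C * measure lborel (ball z r) powr (1 / q + 1 / conj_exponent p)" if "0 < r"
      using main[OF that, of z] unfolding p'_def[symmetric] mU mV by blast
  qed (use w'pos ww' C in auto)
qed

lemma BMO_representative:
  fixes b :: "'a::euclidean_space \<Rightarrow> 'b::euclidean_space"
  assumes "b \<in> BMO"
  obtains b' c N where "b' \<in> borel_measurable borel" "AE x in lborel. b x = b' x" "mean_oscillation_bound b' c N"
proof -
  have loc: "locally_integrable b" and fin: "bmo_norm b < \<infinity>" using assms by (auto simp: BMO_def)
  obtain b' where b' [measurable]: "b' \<in> borel_measurable borel" and bb': "AE x in lborel. b x = b' x"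
    using borel_representative[OF locally_integrable_measurable[OF loc]] by blast
  define c where "c z r = mean_on (ball z r) b" for z r
  \<comment> \<open>The summand 1 makes N positive also when the seminorm of b is 0.\<close>
  define N where "N = enn2real (bmo_norm b) + 1"
  have N: "0 < N" by (simp add: N_def add_nonneg_pos)
  have "bmo_norm b \<le> ennreal N" using fin by (simp add: N_def ennreal_plus)
  moreover have "enn_avg (ball z r) (\<lambda>x. ennreal (norm (b x - c z r))) \<le> bmo_norm b" if "0 < r" for z r
    unfolding bmo_norm_def c_def using that by (intro SUP_upper2[of z] SUP_upper2[of r]) auto
  ultimately have avg: "enn_avg (ball z r) (\<lambda>x. ennreal (norm (b x - c z r))) \<le> ennreal N" if "0 < r" for z r
    using that order_trans by blast
  have "(\<integral>\<^sup>+x\<in>ball z r. ennreal (norm (b' x - c z r)) \<partial>lborel) \<le> ennreal N * emeasure lborel (ball z r)" if r: "0 < r" for z r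
  proof -
    define m where "m = measure lborel (ball z r)"
    have m: "0 < m" using r by (simp add: m_def content_ball)
    have em: "emeasure lborel (ball z r) = ennreal m"
      using emeasure_lborel_ball_finite[of z r] by (simp add: m_def emeasure_eq_ennreal_measure)
    define I where "I = (\<integral>\<^sup>+x\<in>ball z r. ennreal (norm (b x - c z r)) \<partial>lborel)"
    have "I / ennreal m \<le> ennreal N"
      using avg[OF r, of z] em unfolding enn_avg_def nn_integral_completion I_def by simp
    then have "I / ennreal m * ennreal m \<le> ennreal N * ennreal m" by (rule mult_right_mono) simp
    also have "I / ennreal m * ennreal m = I"
      using m by (simp add: ennreal_divide_times ennreal_divide_self)
    finally have "I \<le> ennreal N * emeasure lborel (ball z r)" by (simp only: em)
    moreover have "I = (\<integral>\<^sup>+x\<in>ball z r. ennreal (norm (b' x - c z r)) \<partial>lborel)"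
      unfolding I_def using bb' by (intro nn_integral_cong_AE) auto
    ultimately show ?thesis by simp
  qed
  then have "mean_oscillation_bound b' c N" using N by (simp add: mean_oscillation_bound_def)
  with b' bb' show ?thesis by (rule that)
qed

text \<open>The power of |B| in the A_{p,q} bound is \<sigma> = 1 - \<gamma>/n. Raising the bound to
  the power 1/\<sigma> yields the hypothesis of \<open>A_infty_of_dual_weights\<close>, and
  |B|^\<sigma> proportional to r^(n - \<gamma>) yields \<open>ball_bound\<close>.\<close>

lemma two_weight_commutator_Apq:
  fixes w' :: "'a::euclidean_space \<Rightarrow> real" and b :: "'a \<Rightarrow> 'b::euclidean_space"
  assumes \<gamma>: "0 < \<gamma>" "\<gamma> < real DIM('a)" and p: "1 < p" "p < q" and q: "1 / q = 1 / p - \<gamma> / real DIM('a)"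
    and [measurable]: "w' \<in> borel_measurable borel" and pos: "\<And>x. 0 < w' x" and K: "0 < K"
    and finU: "\<And>z r. (\<integral>\<^sup>+x\<in>ball z r. ennreal (w' x powr q) \<partial>lborel) < top"
    and finV: "\<And>z r. (\<integral>\<^sup>+x\<in>ball z r. ennreal (w' x powr (- conj_exponent p)) \<partial>lborel) < top"
    and bound: "\<And>z r. 0 < r \<Longrightarrow> measure (density lborel (\<lambda>x. ennreal (w' x powr q))) (ball z r) powr (1 / q) *
       measure (density lborel (\<lambda>x. ennreal (w' x powr (- conj_exponent p)))) (ball z r) powr (1 / conj_exponent p)
       \<le> K * measure lborel (ball z r) powr (1 / q + 1 / conj_exponent p)"
    and b: "mean_oscillation_bound b c N"
  obtains KA \<kappa>U \<kappa>S K0 where "two_weight_commutator (density lborel (\<lambda>x. ennreal (w' x powr q))) KA \<kappa>U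
    (density lborel (\<lambda>x. ennreal (w' x powr (- conj_exponent p)))) KA \<kappa>S \<gamma> p q K0 b c N"
proof -
  define p' where "p' = conj_exponent p"
  have p': "1 < p'" "1 / p' = 1 - 1 / p" using p by (auto simp: p'_def conj_exponent_def field_simps)
  define \<sigma> where "\<sigma> = 1 / q + 1 / p'"
  have \<sigma>n: "\<sigma> = 1 - \<gamma> / real DIM('a)" by (simp add: \<sigma>_def p'(2) q)
  have \<sigma>: "0 < \<sigma>" using p p' by (auto simp: \<sigma>_def intro!: add_pos_pos)
  \<comment> \<open>Chosen to make q a = p' (1 - a) = 1/\<sigma>, so that the powers of w cancel in
    u^a v^(1-a).\<close>
  define a where "a = (1 / q) / \<sigma>"
  have "1 - a = (\<sigma> - 1 / q) / \<sigma>" using \<sigma> by (simp add: a_def diff_divide_distrib)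
  then have a1: "1 - a = (1 / p') / \<sigma>" by (simp add: \<sigma>_def)
  have a: "0 < a" "a < 1"
  proof -
    show "0 < a" using \<sigma> p by (simp add: a_def)
    have "0 < 1 - a" unfolding a1 using \<sigma> p'(1) by simp
    then show "a < 1" by simp
  qed
  define u where "u x = w' x powr q" for x
  define v where "v x = w' x powr (- p')" for x
  have [measurable]: "u \<in> borel_measurable borel" "v \<in> borel_measurable borel" unfolding u_def v_def by measurable
  have uv: "0 < u x" "0 < v x" for x using pos[of x] by (simp_all add: u_def v_def)
  define U where "U = density lborel (\<lambda>x. ennreal (u x))"
  define V where "V = density lborel (\<lambda>x. ennreal (v x))"
  have prod: "u x powr a * v x powr (1 - a) = 1" for x
  proof -
    have "q * a = 1 / \<sigma>" using p by (simp add: a_def)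
    moreover have "p' * (1 - a) = 1 / \<sigma>" unfolding a1 using p'(1) by simp
    ultimately have "q * a + - p' * (1 - a) = 0" by simp
    then have "w' x powr (q * a) * w' x powr (- p' * (1 - a)) = w' x powr 0" by (simp only: powr_add[symmetric])
    then show ?thesis using pos[of x] by (simp add: u_def v_def powr_powr)
  qed
  define KA where "KA = K powr (1 / \<sigma>)"
  have KA: "0 < KA" using K by (simp add: KA_def)
  have bnd: "measure U (ball z r) powr (1 / q) * measure V (ball z r) powr (1 / p') \<le> K * measure lborel (ball z r) powr \<sigma>"
    if "0 < r" for z r using bound[OF that, of z] by (simp only: U_def V_def u_def v_def p'_def \<sigma>_def)
  have bndA: "measure U (ball z r) powr a * measure V (ball z r) powr (1 - a) \<le> KA * measure lborel (ball z r)"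
    if r: "0 < r" for z r
  proof -
    have "(measure U (ball z r) powr (1 / q) * measure V (ball z r) powr (1 / p')) powr (1 / \<sigma>) \<le> (K * measure lborel (ball z r) powr \<sigma>) powr (1 / \<sigma>)"
      using \<sigma> by (intro powr_mono2 bnd r) auto
    then show ?thesis unfolding a1 KA_def using \<sigma> by (simp add: powr_mult powr_powr a_def)
  qed
  have AU: "A_infty_measure U KA a"
    unfolding U_def
  proof (rule A_infty_of_dual_weights[of u v])
    show "(\<integral>\<^sup>+x\<in>ball z r. ennreal (u x) \<partial>lborel) < top" "(\<integral>\<^sup>+x\<in>ball z r. ennreal (v x) \<partial>lborel) < top" for z r
      using finU[of z r] finV[of z r] by (simp_all only: u_def v_def p'_def)
  qed (use uv a prod KA bndA in \<open>simp_all add: U_def V_def\<close>)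
  have AV: "A_infty_measure V KA (1 - a)"
    unfolding V_def
  proof (rule A_infty_of_dual_weights[of v u])
    show "(\<integral>\<^sup>+x\<in>ball z r. ennreal (u x) \<partial>lborel) < top" "(\<integral>\<^sup>+x\<in>ball z r. ennreal (v x) \<partial>lborel) < top" for z r
      using finU[of z r] finV[of z r] by (simp_all only: u_def v_def p'_def)
  qed (use uv a prod KA bndA in \<open>simp_all add: U_def V_def mult.commute\<close>)
  interpret AU: A_infty_measure U KA a by (rule AU)
  interpret AV: A_infty_measure V KA "1 - a" by (rule AV)
  \<comment> \<open>From |B|^\<sigma>, which is the \<sigma>-th power of the unit ball volume times
    r^(n - \<gamma>).\<close>
  define K0 where "K0 = K * unit_ball_vol (real DIM('a)) powr \<sigma>"
  have "two_weight_commutator U KA a V KA (1 - a) \<gamma> p q K0 b c N"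
  proof
    show "0 < K0" using K unit_ball_vol_pos[of "real DIM('a)"] by (simp add: K0_def less_imp_neq[symmetric])
    fix r :: real and z :: 'a assume r: "0 < r"
    define x where "x = measure U (ball z r)"
    define y where "y = measure V (ball z r)"
    have xy: "0 < x" "0 < y" using r by (simp_all add: x_def y_def AU.measure_ball_pos AV.measure_ball_pos)
    have e: "real DIM('a) * \<sigma> = real DIM('a) - \<gamma>" by (simp add: \<sigma>n field_simps)
    have "x powr (1 / q) * y powr (1 / p') \<le> K * (unit_ball_vol (real DIM('a)) * r ^ DIM('a)) powr \<sigma>"
      using bnd[OF r, of z] r by (simp add: x_def y_def content_ball)
    also have "\<dots> = K0 * r powr (real DIM('a) - \<gamma>)"
      using r by (simp add: K0_def powr_mult powr_powr e flip: powr_realpow)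
    finally have "(x powr (1 / q) * y powr (1 / p')) * (r powr (\<gamma> - real DIM('a)) * x powr (- (1 / q)) * y powr (- (1 / p')))
      \<le> (K0 * r powr (real DIM('a) - \<gamma>)) * (r powr (\<gamma> - real DIM('a)) * x powr (- (1 / q)) * y powr (- (1 / p')))"
      by (rule mult_right_mono) simp
    moreover have "(x powr (1 / q) * y powr (1 / p')) * (r powr (\<gamma> - real DIM('a)) * x powr (- (1 / q)) * y powr (- (1 / p')))
      = r powr (\<gamma> - real DIM('a)) * (x powr (1 / q) * x powr (- (1 / q))) * (y powr (1 / p') * y powr (- (1 / p')))" by (simp only: mult_ac)
    moreover have "(K0 * r powr (real DIM('a) - \<gamma>)) * (r powr (\<gamma> - real DIM('a)) * x powr (- (1 / q)) * y powr (- (1 / p')))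
      = (r powr (real DIM('a) - \<gamma>) * r powr (\<gamma> - real DIM('a))) * (K0 * (x powr (- (1 / q)) * y powr (- (1 / p'))))" by (simp only: mult_ac)
    moreover have "x powr (1 / q) * x powr (- (1 / q)) = 1" "y powr (1 / p') * y powr (- (1 / p')) = 1"
      "r powr (real DIM('a) - \<gamma>) * r powr (\<gamma> - real DIM('a)) = 1"
      using xy r by (simp_all flip: powr_add)
    ultimately have "r powr (\<gamma> - real DIM('a)) \<le> K0 * (x powr (- (1 / q)) * y powr (- (1 / p')))" by (simp only: mult_1_left mult_1_right)
    then show "r powr (\<gamma> - real DIM('a)) \<le> K0 * (measure U (ball z r) powr (- (1 / q)) * measure V (ball z r) powr (- (1 - 1 / p)))"
      by (simp only: x_def y_def p'(2))
  qed (use b \<gamma> p in auto)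
  then show ?thesis unfolding U_def V_def u_def v_def p'_def by (rule that)
qed

section \<open>Rewriting the amalgam norms in terms of the weighted measures, and the final
  estimate\<close>

lemma norm_commutator_integrand:
  "norm (commutator_integrand \<gamma> b f x y) =
    norm (b x - b y) * norm (x - y) powr (\<gamma> - real DIM('a)) * norm (f y)"
  for b f :: "'a::euclidean_space \<Rightarrow> 'b::{real_normed_field,euclidean_space}"
proof -
  have "inverse (norm (x - y) powr (real DIM('a) - \<gamma>)) = norm (x - y) powr (\<gamma> - real DIM('a))"
    using powr_minus[of "norm (x - y)" "real DIM('a) - \<gamma>"] by simp
  then show ?thesis by (simp add: commutator_integrand_def norm_mult mult_ac)
qed

text \<open>The equation k F = h^p w'^t moves weight from the integrand into the measure. It is used
  with k = w^q for the commutator, and with k = w^(-p') for f, where F is the p-th power of |f|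
  w^p'.\<close>

lemma weighted_Lnorm_ball:
  fixes w w' k :: "'a::euclidean_space \<Rightarrow> real" and g h :: "'a \<Rightarrow> real"
  assumes [measurable]: "w' \<in> borel_measurable borel" "h \<in> borel_measurable borel"
    and "0 < p" and "AE x in lborel. w x = w' x" "AE x in lborel. g x = h x"
    and "\<And>x. 0 \<le> h x" and [measurable]: "k \<in> borel_measurable borel" and k: "\<And>x. 0 \<le> k x"
    and [measurable]: "F \<in> borel_measurable borel"
    and F: "\<And>x. k x * F x = h x powr p * w' x powr t" and F0: "\<And>x. 0 \<le> F x"
  shows "weighted_Lnorm (ennreal p) (\<lambda>x. w x powr t) (\<lambda>x. ennreal (g x) * indicator (ball y r) x)
    = (\<integral>\<^sup>+x\<in>ball y r. ennreal (F x) \<partial>density lborel (\<lambda>x. ennreal (k x))) ennpowr (1 / p)"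
proof -
  have "(\<integral>\<^sup>+x. (ennreal (g x) * indicator (ball y r) x) ennpowr p * ennreal (w x powr t) \<partial>lborel)
    = (\<integral>\<^sup>+x. ennreal (k x) * (ennreal (F x) * indicator (ball y r) x) \<partial>lborel)"
    using assms(4,5)
  proof (intro nn_integral_cong_AE, eventually_elim)
    case (elim x)
    have "(ennreal (g x) * indicator (ball y r) x) ennpowr p * ennreal (w x powr t)
      = ennreal (h x powr p) * ennreal (w' x powr t) * indicator (ball y r) x"
      using elim assms(3,6) by (auto simp: indicator_def ennpowr_ennreal')
    also have "ennreal (h x powr p) * ennreal (w' x powr t) = ennreal (k x * F x)"
      unfolding F by (rule ennreal_mult[symmetric]) auto
    also have "\<dots> = ennreal (k x) * ennreal (F x)" using k[of x] F0[of x] by (rule ennreal_mult)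
    finally show ?case by (simp add: mult.assoc)
  qed
  also have "\<dots> = (\<integral>\<^sup>+x\<in>ball y r. ennreal (F x) \<partial>density lborel (\<lambda>x. ennreal (k x)))"
    by (rule nn_integral_density[symmetric]) measurable
  finally show ?thesis
    using assms(3) by (simp add: weighted_Lnorm_def nn_integral_completion)
qed

lemma weight_measure_ball:
  fixes w w' :: "'a::euclidean_space \<Rightarrow> real"
  assumes [measurable]: "w' \<in> borel_measurable borel" and "AE x in lborel. w x = w' x"
  shows "weight_measure (\<lambda>x. w x powr t) (ball y r) = emeasure (density lborel (\<lambda>x. ennreal (w' x powr t))) (ball y r)"
proof -
  have "(\<integral>\<^sup>+x\<in>ball y r. ennreal (w x powr t) \<partial>lborel) = (\<integral>\<^sup>+x\<in>ball y r. ennreal (w' x powr t) \<partial>lborel)"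
    using assms(2) by (intro nn_integral_cong_AE) auto
  then show ?thesis by (simp add: weight_measure_def nn_integral_completion emeasure_density_ball)
qed

lemma sum_geometric_weights:
  assumes "0 < C" "0 < \<theta>" "\<theta> < (1::real)"
  shows "\<And>j. 0 \<le> C * \<theta> ^ j" "summable (\<lambda>j. C * \<theta> ^ j)" "(\<Sum>j. C * \<theta> ^ j) = C / (1 - \<theta>)" "0 < (\<Sum>j. C * \<theta> ^ j)"
proof -
  show s: "summable (\<lambda>j. C * \<theta> ^ j)" using assms by (intro summable_mult summable_geometric) auto
  show eq: "(\<Sum>j. C * \<theta> ^ j) = C / (1 - \<theta>)"
    using assms by (subst suminf_mult) (auto simp: suminf_geometric intro!: summable_geometric)
  show "0 < (\<Sum>j. C * \<theta> ^ j)" unfolding eq using assms by simp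
qed (use assms in auto)

text \<open>The commutator integral is total, so a norm bound alone could rest on the default value
  0; hence the second part, on convergence of the integral and membership. It is claimed for \<mu>
  not almost everywhere 0, as otherwise the norm carries no information about f.\<close>

lemma commutator_amalgam_bound:
  fixes \<gamma> p q \<alpha> \<beta> :: real and s :: ennreal and w \<mu> :: "'a::euclidean_space \<Rightarrow> real"
    and b :: "'a \<Rightarrow> 'b::{real_normed_field,euclidean_space}"
  assumes \<gamma>: "0 < \<gamma>" "\<gamma> < real DIM('a)"
    and p: "1 < p" "p < real DIM('a) / \<gamma>"
    and q: "1 / q = 1 / p - \<gamma> / real DIM('a)"
    and w: "w \<in> Apq p q"
    and \<alpha>: "p \<le> \<alpha>" "\<alpha> < \<beta>" and s: "ennreal \<beta> < s"
    and \<beta>: "1 / \<beta> = 1 / \<alpha> - \<gamma> / real DIM('a)"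
    and \<mu>: "weight \<mu>"
    and b: "b \<in> BMO"
  shows "\<exists>C>0. \<forall>f \<in> amalgam_space p s \<alpha> (\<lambda>x. w x powr p) (\<lambda>x. w x powr q) \<mu>.
    amalgam_norm q s \<beta> (\<lambda>x. w x powr q) (\<lambda>x. w x powr q) \<mu> (frac_commutator \<gamma> b f)
      \<le> ennreal C * amalgam_norm p s \<alpha> (\<lambda>x. w x powr p) (\<lambda>x. w x powr q) \<mu> f \<and>
    (\<not> (AE y in lebesgue. \<mu> y = 0) \<longrightarrow>
      (AE x in lebesgue. integrable lebesgue (commutator_integrand \<gamma> b f x)) \<and>
      frac_commutator \<gamma> b f
        \<in> amalgam_space q s \<beta> (\<lambda>x. w x powr q) (\<lambda>x. w x powr q) \<mu>)"
proof -
  let ?n = "real DIM('a)"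
  have "p * \<gamma> < ?n" using p \<gamma> by (simp add: field_simps)
  then have "\<gamma> / ?n < 1 / p" using p by (simp add: field_simps)
  then have "0 < 1 / q" using q by simp
  then have q0: "0 < q" by simp
  have "1 / q < 1 / p" using q \<gamma> by simp
  then have pq: "p < q" using p q0 by (simp add: field_simps)
  then have q1: "1 < q" using p by simp
  define p' where "p' = conj_exponent p"
  have p': "1 < p'" "p' * (p - 1) = p" using p by (auto simp: p'_def conj_exponent_def)
  obtain w' K where w'm [measurable]: "w' \<in> borel_measurable borel" and w'pos: "\<And>x. 0 < w' x"
    and ww': "AE x in lborel. w x = w' x" and K: "0 < K"
    and finU: "\<And>z r. (\<integral>\<^sup>+x\<in>ball z r. ennreal (w' x powr q) \<partial>lborel) < top"
    and finV: "\<And>z r. (\<integral>\<^sup>+x\<in>ball z r. ennreal (w' x powr (- conj_exponent p)) \<partial>lborel) < top"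
    and bound: "\<And>z r. 0 < r \<Longrightarrow> measure (density lborel (\<lambda>x. ennreal (w' x powr q))) (ball z r) powr (1 / q) *
       measure (density lborel (\<lambda>x. ennreal (w' x powr (- conj_exponent p)))) (ball z r) powr (1 / conj_exponent p)
       \<le> K * measure lborel (ball z r) powr (1 / q + 1 / conj_exponent p)"
    using Apq_representative[OF w p(1) q1] by blast
  obtain b' c N where b'm [measurable]: "b' \<in> borel_measurable borel" and bb': "AE x in lborel. b x = b' x"
    and osc: "mean_oscillation_bound b' c N"
    using BMO_representative[OF b] by blast
  define U where "U = density lborel (\<lambda>x. ennreal (w' x powr q))"
  define V where "V = density lborel (\<lambda>x. ennreal (w' x powr (- p')))"
  obtain KA \<kappa>U \<kappa>S K0 where "two_weight_commutator U KA \<kappa>U V KA \<kappa>S \<gamma> p q K0 b' c N"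
    using two_weight_commutator_Apq[OF \<gamma> p(1) pq q w'm w'pos K finU finV bound osc] unfolding U_def V_def p'_def by blast
  then interpret T: two_weight_commutator U KA \<kappa>U V KA \<kappa>S \<gamma> p q K0 b' c N .
  have \<mu>0: "0 \<le> \<mu> x" for x using \<mu> by (simp add: weight_def)
  have \<mu>m [measurable]: "\<mu> \<in> borel_measurable lebesgue" using \<mu> by (auto simp: weight_def intro: locally_integrable_measurable)
  have \<beta>1: "1 < \<beta>" using p \<alpha> by simp
  have s1: "1 < s"
  proof -
    have "(1::ennreal) < ennreal \<beta>" using \<beta>1 by simp
    then show ?thesis using s by order
  qed
  \<comment> \<open>This strict inequality makes e + 1/q positive, and thereby the coefficients of
    the dilated balls summable.\<close>
  have s\<beta>: "enn2real (1 / s) < 1 / \<beta>"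
  proof (cases s rule: ennreal_cases)
    case (real t)
    then have "\<beta> < t" using s \<beta>1 by (simp add: ennreal_less_iff)
    then have "1 / s = ennreal (1 / t)" using real \<beta>1 by (simp add: divide_ennreal flip: ennreal_1)
    then show ?thesis using \<open>\<beta> < t\<close> \<beta>1 by (simp add: frac_less2)
  qed (use \<beta>1 in simp)
  define e where "e = 1 / \<beta> - 1 / q - enn2real (1 / s)"
  have e1: "0 < e + 1 / q" using s\<beta> by (simp add: e_def)
  \<comment> \<open>Since 1/\<alpha> - 1/p = 1/\<beta> - 1/q, both amalgam norms carry the same
    power of the mass.\<close>
  have e2: "1 / \<alpha> - 1 / p - enn2real (1 / s) = e" using \<beta> q by (simp add: e_def)
  obtain C \<theta> where C: "0 < C" and \<theta>: "0 < \<theta>" "\<theta> < 1" and pointwise: "\<And>F y r. F \<in> borel_measurable borel \<Longrightarrow> (\<And>x. 0 \<le> F x) \<Longrightarrow> 0 < r \<Longrightarrow>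
    ennreal (measure U (ball y r) powr e) * (\<integral>\<^sup>+x\<in>ball y r. T.abs_commutator F x ennpowr q \<partial>U) ennpowr (1 / q)
      \<le> (\<Sum>j. ennreal (C * \<theta> ^ j) * (ennreal (measure U (ball y (2 ^ (j + 1) * r)) powr e) *
          (\<integral>\<^sup>+x\<in>ball y (2 ^ (j + 1) * r). ennreal (F x powr p) \<partial>V) ennpowr (1 / p)))"
    by (rule T.amalgam_pointwise_bound[OF e1]) blast
  \<comment> \<open>The summand 1 makes \<kappa> positive whatever the value of
    \<open>frac_const\<close>.\<close>
  define \<kappa> where "\<kappa> = inverse \<bar>frac_const DIM('a) \<gamma>\<bar> + 1"
  have \<kappa>: "0 < \<kappa>" by (simp add: \<kappa>_def add_nonneg_pos)
  define C' where "C' = \<kappa> * C"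
  have C': "0 < C'" using C \<kappa> by (simp add: C'_def)
  have wmeas: "weight_measure (\<lambda>x. w x powr q) (ball y r) ennpowr e = ennreal (measure U (ball y r) powr e)" if "0 < r" for y r
    using T.U.measure_ball_pos[OF that, of y]
    by (simp add: weight_measure_ball[OF w'm ww'] U_def[symmetric] T.U.emeasure_ball_eq ennpowr_ennreal)
  have result: "amalgam_norm q s \<beta> (\<lambda>x. w x powr q) (\<lambda>x. w x powr q) \<mu> (frac_commutator \<gamma> b f)
      \<le> ennreal (C' / (1 - \<theta>)) * amalgam_norm p s \<alpha> (\<lambda>x. w x powr p) (\<lambda>x. w x powr q) \<mu> f \<and>
    (\<not> (AE y in lebesgue. \<mu> y = 0) \<longrightarrow>
      (AE x in lebesgue. integrable lebesgue (commutator_integrand \<gamma> b f x)) \<and>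
      frac_commutator \<gamma> b f \<in> amalgam_space q s \<beta> (\<lambda>x. w x powr q) (\<lambda>x. w x powr q) \<mu>)"
    if f: "f \<in> amalgam_space p s \<alpha> (\<lambda>x. w x powr p) (\<lambda>x. w x powr q) \<mu>" for f
  proof -
    define X where "X = amalgam_norm p s \<alpha> (\<lambda>x. w x powr p) (\<lambda>x. w x powr q) \<mu> f"
    have X: "X < \<infinity>" using f by (simp add: amalgam_space_def X_def)
    have fm [measurable]: "f \<in> borel_measurable lebesgue" using f by (auto simp: amalgam_space_def intro: locally_integrable_measurable)
    have bm [measurable]: "b \<in> borel_measurable lebesgue" using b by (auto simp: BMO_def intro: locally_integrable_measurable)
    obtain f' where f'm [measurable]: "f' \<in> borel_measurable borel" and ff': "AE x in lborel. f x = f' x"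
      using borel_representative[OF fm] by blast
    \<comment> \<open>The weight w'^p' is undone by the density of V in the operator, and turns the
      norm of F in L^p(V) into that of f in L^p(w^p).\<close>
    define F where "F x = norm (f' x) * w' x powr p'" for x
    have Fm [measurable]: "F \<in> borel_measurable borel" unfolding F_def by measurable
    have F0: "0 \<le> F x" for x by (simp add: F_def)
    define TF where "TF = T.abs_commutator F"
    have TFm [measurable]: "TF \<in> borel_measurable borel" unfolding TF_def by measurable
    define A where "A r y = ennreal (measure U (ball y r) powr e) * (\<integral>\<^sup>+x\<in>ball y r. ennreal (F x powr p) \<partial>V) ennpowr (1 / p)" for r y
    have in_fun: "weight_measure (\<lambda>x. w x powr q) (ball y r) ennpowr (1 / \<alpha> - 1 / p - enn2real (1 / s)) *
       weighted_Lnorm (ennreal p) (\<lambda>x. w x powr p) (\<lambda>x. ennreal (norm (f x)) * indicator (ball y r) x) = A r y" if "0 < r" for y r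
    proof -
      have "weighted_Lnorm (ennreal p) (\<lambda>x. w x powr p) (\<lambda>x. ennreal (norm (f x)) * indicator (ball y r) x)
        = (\<integral>\<^sup>+x\<in>ball y r. ennreal (F x powr p) \<partial>V) ennpowr (1 / p)"
        unfolding V_def
      proof (rule weighted_Lnorm_ball[OF w'm _ _ ww'])
        show "AE x in lborel. norm (f x) = norm (f' x)" using ff' by auto
        show "w' x powr (- p') * F x powr p = norm (f' x) powr p * w' x powr p" for x
        proof -
          have "- p' + p' * p = p" using p'(2) by (simp add: algebra_simps)
          then have "w' x powr (- p') * w' x powr (p' * p) = w' x powr p" by (simp only: powr_add[symmetric])
          then show ?thesis by (simp add: F_def powr_mult powr_powr)
        qed
      qed (use p in auto)
      then show ?thesis unfolding e2 wmeas[OF that] by (simp only: A_def)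
    qed
    have X_eq: "X = (SUP r\<in>{0<..}. weighted_Lnorm s \<mu> (A r))"
      unfolding X_def amalgam_norm_def by (intro SUP_cong refl) (simp add: in_fun)
    have A_le: "weighted_Lnorm s \<mu> (A r) \<le> X" if "0 < r" for r
      unfolding X_eq using that by (intro SUP_upper) auto
    have A_meas: "A r \<in> borel_measurable lebesgue" for r
    proof -
      have [measurable]: "(\<lambda>y. \<integral>\<^sup>+x\<in>ball y r. ennreal (F x powr p) \<partial>V) \<in> borel_measurable borel"
        by (rule T.S.borel_measurable_integral_ball) measurable
      have "A r \<in> borel_measurable borel" unfolding A_def by measurable
      then show ?thesis by (intro measurable_completion) simp
    qed
    \<comment> \<open>The amalgam quantity of the positive operator itself; its finiteness later
      gives convergence of the commutator integral.\<close>
    define G where "G r y = ennreal (measure U (ball y r) powr e) * (\<integral>\<^sup>+x\<in>ball y r. TF x ennpowr q \<partial>U) ennpowr (1 / q)" for r y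
    have G_le: "G r y \<le> (\<Sum>j. ennreal (C * \<theta> ^ j) * A (2 ^ (j + 1) * r) y)" if "0 < r" for r y
      unfolding G_def A_def TF_def by (rule pointwise) (use F0 that in auto)
    have G_meas: "G r \<in> borel_measurable lebesgue" for r
    proof -
      have [measurable]: "(\<lambda>y. \<integral>\<^sup>+x\<in>ball y r. TF x ennpowr q \<partial>U) \<in> borel_measurable borel"
        by (rule T.U.borel_measurable_integral_ball) measurable
      have "G r \<in> borel_measurable borel" unfolding G_def by measurable
      then show ?thesis by (intro measurable_completion) simp
    qed
    have G_fin: "weighted_Lnorm s \<mu> (G r) < \<infinity>" if r: "0 < r" for r
    proof -
      have "weighted_Lnorm s \<mu> (G r) \<le> ennreal (\<Sum>j. C * \<theta> ^ j) * X"
        using r by (intro weighted_Lnorm_suminf_le[where A="\<lambda>j. A (2 ^ (j + 1) * r)"] s1 sum_geometric_weights[OF C \<theta>] A_meas G_meas \<mu>m A_le G_le) auto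
      also have "\<dots> < \<infinity>" using X by (simp add: ennreal_mult_less_top)
      finally show ?thesis .
    qed
    have kernel_int: "(\<integral>\<^sup>+y. ennreal (norm (commutator_integrand \<gamma> b' f' x y)) \<partial>lborel) = TF x" for x
    proof -
      have "TF x = (\<integral>\<^sup>+y. T.commutator_kernel x y * ennreal (F y) \<partial>V)"
        by (simp only: TF_def T.abs_commutator_def)
      also have "\<dots> = (\<integral>\<^sup>+y. ennreal (w' y powr (- p')) * (T.commutator_kernel x y * ennreal (F y)) \<partial>lborel)"
        unfolding V_def by (rule nn_integral_density) measurable
      also have "\<dots> = (\<integral>\<^sup>+y. ennreal (norm (commutator_integrand \<gamma> b' f' x y)) \<partial>lborel)"
      proof (intro nn_integral_cong)
        fix y
        have "w' y powr (- p') * w' y powr p' = 1" using w'pos[of y] by (simp flip: powr_add)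
        then have eq: "ennreal (w' y powr (- p')) * ennreal (w' y powr p') = 1"
          by (metis ennreal_1 ennreal_mult' powr_ge_zero)
        have "ennreal (w' y powr (- p')) * (T.commutator_kernel x y * ennreal (F y))
          = (ennreal (w' y powr (- p')) * ennreal (w' y powr p')) * (T.commutator_kernel x y * ennreal (norm (f' y)))"
          by (simp add: F_def ennreal_mult mult_ac)
        also have "\<dots> = ennreal (norm (commutator_integrand \<gamma> b' f' x y))"
          unfolding eq norm_commutator_integrand by (simp add: T.commutator_kernel_def ennreal_mult)
        finally show "ennreal (w' y powr (- p')) * (T.commutator_kernel x y * ennreal (F y)) = ennreal (norm (commutator_integrand \<gamma> b' f' x y))" .
      qed
      finally show ?thesis ..
    qed
    have ci_meas2 [measurable]: "(\<lambda>(x, y). commutator_integrand \<gamma> b' f' x y) \<in> borel_measurable (borel \<Otimes>\<^sub>M lborel)"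
      unfolding commutator_integrand_def by measurable
    have ci_meas' [measurable]: "commutator_integrand \<gamma> b' f' x \<in> borel_measurable lborel" for x
      unfolding commutator_integrand_def by measurable
    have ci_meas: "commutator_integrand \<gamma> b f x \<in> borel_measurable lebesgue" for x
    proof -
      have "(\<lambda>y. norm (x - y) powr (?n - \<gamma>)) \<in> borel_measurable lebesgue"
        by (intro measurable_completion) measurable
      then show ?thesis unfolding commutator_integrand_def by measurable
    qed
    have ci_AE: "AE y in lebesgue. commutator_integrand \<gamma> b f x y = commutator_integrand \<gamma> b' f' x y" if "b x = b' x" for x
    proof -
      have "AE y in lborel. commutator_integrand \<gamma> b f x y = commutator_integrand \<gamma> b' f' x y"
        using bb' ff' by eventually_elim (simp add: commutator_integrand_def that)
      then show ?thesis by (rule AE_completion)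
    qed
    \<comment> \<open>The commutator of the Borel representatives. A change of f or b on a null set
      does not affect the integral in y, but b also enters at x, so agreement is obtained where b x
      = b' x.\<close>
    define h where "h x = (\<integral>y. commutator_integrand \<gamma> b' f' x y \<partial>lborel) /\<^sub>R frac_const DIM('a) \<gamma>" for x
    have hm [measurable]: "h \<in> borel_measurable borel"
      unfolding h_def by measurable
    have frac_eq: "frac_commutator \<gamma> b f x = h x" if "b x = b' x" for x
    proof -
      have "(\<integral>y. commutator_integrand \<gamma> b f x y \<partial>lebesgue) = (\<integral>y. commutator_integrand \<gamma> b' f' x y \<partial>lebesgue)"
        by (rule integral_cong_AE[OF ci_meas _ ci_AE[OF that]]) (rule measurable_completion[OF ci_meas'])
      also have "\<dots> = (\<integral>y. commutator_integrand \<gamma> b' f' x y \<partial>lborel)"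
        by (rule integral_completion[OF ci_meas'])
      finally show ?thesis by (simp add: frac_commutator_def h_def)
    qed
    have frac_AE: "AE x in lborel. frac_commutator \<gamma> b f x = h x"
      using bb' by eventually_elim (rule frac_eq)
    have h_le: "ennreal (norm (h x)) \<le> ennreal \<kappa> * TF x" for x
    proof -
      have "ennreal (norm (\<integral>y. commutator_integrand \<gamma> b' f' x y \<partial>lborel)) \<le> TF x"
      \<comment> \<open>Where the integral does not exist its value is 0 and the bound is
        trivial.\<close>
      proof (cases "integrable lborel (commutator_integrand \<gamma> b' f' x)")
        case True
        then show ?thesis using integral_norm_bound_ennreal[OF True] by (simp add: kernel_int)
      qed (simp add: not_integrable_integral_eq)
      then have "ennreal (inverse \<bar>frac_const DIM('a) \<gamma>\<bar>) * ennreal (norm (\<integral>y. commutator_integrand \<gamma> b' f' x y \<partial>lborel)) \<le> ennreal \<kappa> * TF x"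
        by (intro mult_mono ennreal_leI) (auto simp: \<kappa>_def)
      then show ?thesis by (simp add: h_def ennreal_mult)
    qed
    define H where "H r y = ennreal (measure U (ball y r) powr e) * (\<integral>\<^sup>+x\<in>ball y r. ennreal (norm (h x) powr q) \<partial>U) ennpowr (1 / q)" for r y
    have out_fun: "weight_measure (\<lambda>x. w x powr q) (ball y r) ennpowr (1 / \<beta> - 1 / q - enn2real (1 / s)) *
       weighted_Lnorm (ennreal q) (\<lambda>x. w x powr q) (\<lambda>x. ennreal (norm (frac_commutator \<gamma> b f x)) * indicator (ball y r) x) = H r y" if "0 < r" for y r
    proof -
      have "weighted_Lnorm (ennreal q) (\<lambda>x. w x powr q) (\<lambda>x. ennreal (norm (frac_commutator \<gamma> b f x)) * indicator (ball y r) x)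
        = (\<integral>\<^sup>+x\<in>ball y r. ennreal (norm (h x) powr q) \<partial>U) ennpowr (1 / q)"
        unfolding U_def
      proof (rule weighted_Lnorm_ball[OF w'm _ _ ww'])
        show "AE x in lborel. norm (frac_commutator \<gamma> b f x) = norm (h x)" using frac_AE by auto
      qed (use q0 in \<open>auto simp: mult.commute\<close>)
      then show ?thesis unfolding e_def[symmetric] wmeas[OF that] by (simp only: H_def)
    qed
    have H_meas: "H r \<in> borel_measurable lebesgue" for r
    proof -
      have [measurable]: "(\<lambda>y. \<integral>\<^sup>+x\<in>ball y r. ennreal (norm (h x) powr q) \<partial>U) \<in> borel_measurable borel"
        by (rule T.U.borel_measurable_integral_ball) measurable
      have "H r \<in> borel_measurable borel" unfolding H_def by measurable
      then show ?thesis by (intro measurable_completion) simp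
    qed
    have H_le: "H r y \<le> (\<Sum>j. ennreal (C' * \<theta> ^ j) * A (2 ^ (j + 1) * r) y)" if r: "0 < r" for r y
    proof -
      have "(\<integral>\<^sup>+x\<in>ball y r. ennreal (norm (h x) powr q) \<partial>U) \<le> (\<integral>\<^sup>+x. ennreal \<kappa> ennpowr q * (TF x ennpowr q * indicator (ball y r) x) \<partial>U)"
      proof (intro nn_integral_mono)
        fix x
        have "ennreal (norm (h x) powr q) = ennreal (norm (h x)) ennpowr q" using q0 by (simp add: ennpowr_ennreal')
        also have "\<dots> \<le> (ennreal \<kappa> * TF x) ennpowr q" using q0 by (intro ennpowr_mono h_le) auto
        also have "\<dots> = ennreal \<kappa> ennpowr q * TF x ennpowr q" using q0 by (intro ennpowr_mult) auto
        finally show "ennreal (norm (h x) powr q) * indicator (ball y r) x \<le> ennreal \<kappa> ennpowr q * (TF x ennpowr q * indicator (ball y r) x)"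
          by (auto simp: indicator_def)
      qed
      also have "\<dots> = ennreal \<kappa> ennpowr q * (\<integral>\<^sup>+x\<in>ball y r. TF x ennpowr q \<partial>U)" by (rule nn_integral_cmult) measurable
      finally have "(\<integral>\<^sup>+x\<in>ball y r. ennreal (norm (h x) powr q) \<partial>U) ennpowr (1 / q) \<le>
        (ennreal \<kappa> ennpowr q * (\<integral>\<^sup>+x\<in>ball y r. TF x ennpowr q \<partial>U)) ennpowr (1 / q)"
        using q0 by (intro ennpowr_mono) auto
      also have "\<dots> = ennreal \<kappa> * (\<integral>\<^sup>+x\<in>ball y r. TF x ennpowr q \<partial>U) ennpowr (1 / q)"
        using q0 by (simp add: ennpowr_mult ennpowr_ennpowr)
      finally have "H r y \<le> ennreal (measure U (ball y r) powr e) * (ennreal \<kappa> * (\<integral>\<^sup>+x\<in>ball y r. TF x ennpowr q \<partial>U) ennpowr (1 / q))"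
        unfolding H_def by (rule mult_left_mono) simp
      also have "\<dots> = ennreal \<kappa> * G r y" by (simp only: G_def mult_ac)
      also have "\<dots> \<le> ennreal \<kappa> * (\<Sum>j. ennreal (C * \<theta> ^ j) * A (2 ^ (j + 1) * r) y)"
        by (intro mult_left_mono G_le r) simp
      also have "\<dots> = (\<Sum>j. ennreal \<kappa> * (ennreal (C * \<theta> ^ j) * A (2 ^ (j + 1) * r) y))" by (rule ennreal_suminf_cmult[symmetric])
      also have "\<dots> = (\<Sum>j. ennreal (C' * \<theta> ^ j) * A (2 ^ (j + 1) * r) y)"
        using \<kappa> C \<theta> by (simp add: C'_def ennreal_mult mult.assoc)
      finally show ?thesis .
    qed
    have norm_bound: "amalgam_norm q s \<beta> (\<lambda>x. w x powr q) (\<lambda>x. w x powr q) \<mu> (frac_commutator \<gamma> b f) \<le> ennreal (C' / (1 - \<theta>)) * X"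
      unfolding amalgam_norm_def
    proof (rule SUP_least)
      fix r :: real assume "r \<in> {0<..}"
      then have r: "0 < r" by simp
      have "weighted_Lnorm s \<mu> (H r) \<le> ennreal (\<Sum>j. C' * \<theta> ^ j) * X"
        using r by (intro weighted_Lnorm_suminf_le[where A="\<lambda>j. A (2 ^ (j + 1) * r)"] s1 sum_geometric_weights[OF C' \<theta>] A_meas H_meas \<mu>m A_le H_le) auto
      then show "weighted_Lnorm s \<mu> (\<lambda>y. weight_measure (\<lambda>x. w x powr q) (ball y r) ennpowr (1 / \<beta> - 1 / q - enn2real (1 / s)) *
       weighted_Lnorm (ennreal q) (\<lambda>x. w x powr q) (\<lambda>x. ennreal (norm (frac_commutator \<gamma> b f x)) * indicator (ball y r) x)) \<le> ennreal (C' / (1 - \<theta>)) * X"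
        unfolding out_fun[OF r] sum_geometric_weights(3)[OF C' \<theta>] .
    qed
    have nontrivial: "(AE x in lebesgue. integrable lebesgue (commutator_integrand \<gamma> b f x)) \<and>
      frac_commutator \<gamma> b f \<in> amalgam_space q s \<beta> (\<lambda>x. w x powr q) (\<lambda>x. w x powr q) \<mu>"
      if nz: "\<not> (AE y in lebesgue. \<mu> y = 0)"
    proof -
      have ball_fin: "(\<integral>\<^sup>+x\<in>ball 0 (real m). TF x ennpowr q \<partial>U) < \<infinity>" for m :: nat
      proof -
        have "\<exists>k::nat. \<not> (AE y in lebesgue. y \<in> ball 0 (real k) \<longrightarrow> \<mu> y = 0)"
        proof (rule ccontr)
          assume "\<not> (\<exists>k::nat. \<not> (AE y in lebesgue. y \<in> ball 0 (real k) \<longrightarrow> \<mu> y = 0))"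
          then have "\<forall>k::nat. AE y in lebesgue. y \<in> ball 0 (real k) \<longrightarrow> \<mu> y = 0" by (simp only: not_ex not_not simp_thms)
          then have "AE y in lebesgue. \<forall>k::nat. y \<in> ball 0 (real k) \<longrightarrow> \<mu> y = 0" by (subst AE_all_countable)
          then have "AE y in lebesgue. \<mu> y = 0"
          proof eventually_elim
            case (elim y)
            obtain k :: nat where "norm y < real k" using reals_Archimedean2 by blast
            then show ?case using elim by auto
          qed
          with nz show False ..
        qed
        then obtain k :: nat where k: "\<not> (AE y in lebesgue. y \<in> ball 0 (real k) \<longrightarrow> \<mu> y = 0)" ..
        \<comment> \<open>Large enough that \<open>ball y r\<close> contains
          \<open>ball 0 (real m)\<close> for every y in \<open>ball 0 (real k)\<close>. Since \<mu>
          is not almost everywhere 0 on the latter, some such y has \<open>G r y\<close>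
          finite.\<close>
        define r where "r = real k + real m + 1"
        have r: "0 < r" by (simp add: r_def)
        have G_AE: "AE y in lebesgue. 0 < \<mu> y \<longrightarrow> G r y < \<infinity>"
          by (rule weighted_Lnorm_finite_AE[OF s1 G_meas \<mu>m G_fin[OF r]])
        have "\<exists>y. y \<in> ball 0 (real k) \<and> G r y < \<infinity>"
        proof (rule ccontr)
          assume no: "\<not> (\<exists>y. y \<in> ball 0 (real k) \<and> G r y < \<infinity>)"
          from G_AE have "AE y in lebesgue. y \<in> ball 0 (real k) \<longrightarrow> \<mu> y = 0"
          proof eventually_elim
            case (elim y)
            show ?case
            proof
              assume "y \<in> ball 0 (real k)"
              then have "\<not> 0 < \<mu> y" using no elim by blast
              then show "\<mu> y = 0" using \<mu>0[of y] by linarith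
            qed
          qed
          with k show False ..
        qed
        then obtain y where y: "y \<in> ball 0 (real k)" "G r y < \<infinity>" by blast
        have "(\<integral>\<^sup>+x\<in>ball y r. TF x ennpowr q \<partial>U) ennpowr (1 / q) < \<infinity>"
        proof (rule ccontr)
          assume "\<not> (\<integral>\<^sup>+x\<in>ball y r. TF x ennpowr q \<partial>U) ennpowr (1 / q) < \<infinity>"
          then have "(\<integral>\<^sup>+x\<in>ball y r. TF x ennpowr q \<partial>U) ennpowr (1 / q) = top"
            by (metis infinity_ennreal_def less_top)
          moreover have "ennreal (measure U (ball y r) powr e) \<noteq> 0"
            using T.U.measure_ball_pos[OF r, of y] by simp
          ultimately have "G r y = top" by (simp add: G_def ennreal_mult_top)
          then show False using y by simp
        qed
        then have fin: "(\<integral>\<^sup>+x\<in>ball y r. TF x ennpowr q \<partial>U) < \<infinity>"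
          using q0 by (simp add: ennpowr_less_top_iff)
        have "ball 0 (real m) \<subseteq> ball y r"
        proof
          fix x :: 'a assume "x \<in> ball 0 (real m)"
          then show "x \<in> ball y r" using y(1) norm_triangle_ineq4[of y x] by (simp add: r_def dist_norm)
        qed
        then have "(\<integral>\<^sup>+x\<in>ball 0 (real m). TF x ennpowr q \<partial>U) \<le> (\<integral>\<^sup>+x\<in>ball y r. TF x ennpowr q \<partial>U)"
          by (intro nn_integral_mono mult_left_mono) (auto simp: indicator_def)
        then show ?thesis using fin by order
      qed
      have TF_loc: "(\<integral>\<^sup>+x\<in>ball 0 (real m). TF x \<partial>lborel) < \<infinity>" for m :: nat
      proof -
        \<comment> \<open>TF is written as (TF w) w^(-1) and split by Hoelder's inequality with
          exponents q and q'. As p < q gives q' < p', the power w^(-q') is at most 1 + w^(-p'),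
          which is integrable over balls.\<close>
        define q' where "q' = q / (q - 1)"
        have q': "1 / q + 1 / q' = 1" "0 < q'" "q' < p'"
          using q1 p pq by (auto simp: q'_def p'_def conj_exponent_def field_simps)
        let ?B = "ball (0::'a) (real m)"
        have "(\<integral>\<^sup>+x\<in>?B. TF x \<partial>lborel) = (\<integral>\<^sup>+x. (TF x * ennreal (w' x) * indicator ?B x) * (ennreal (w' x powr (- 1)) * indicator ?B x) \<partial>lborel)"
        proof (intro nn_integral_cong)
          fix x
          have "w' x * w' x powr (- 1) = 1" using w'pos[of x] by (simp add: powr_minus_divide)
          then have "ennreal (w' x) * ennreal (w' x powr (- 1)) = 1"
            by (metis ennreal_1 ennreal_mult' less_imp_le w'pos)
          then have "(TF x * ennreal (w' x) * indicator ?B x) * (ennreal (w' x powr (- 1)) * indicator ?B x) = TF x * 1 * (indicator ?B x * indicator ?B x)"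
            by (metis mult.assoc mult.left_commute)
          then show "TF x * indicator ?B x = (TF x * ennreal (w' x) * indicator ?B x) * (ennreal (w' x powr (- 1)) * indicator ?B x)"
            by (auto simp: indicator_def)
        qed
        also have "\<dots> \<le> (\<integral>\<^sup>+x. (TF x * ennreal (w' x) * indicator ?B x) ennpowr q \<partial>lborel) ennpowr (1 / q) *
           (\<integral>\<^sup>+x. (ennreal (w' x powr (- 1)) * indicator ?B x) ennpowr q' \<partial>lborel) ennpowr (1 / q')"
          by (rule Holder_nn_integral[OF _ _ q1 q'(1)]) measurable
        also have "\<dots> < \<infinity>"
        proof -
          have "(\<integral>\<^sup>+x. (TF x * ennreal (w' x) * indicator ?B x) ennpowr q \<partial>lborel) = (\<integral>\<^sup>+x. ennreal (w' x powr q) * (TF x ennpowr q * indicator ?B x) \<partial>lborel)"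
            using q0 w'pos by (intro nn_integral_cong) (auto simp: indicator_def ennpowr_mult ennpowr_ennreal mult.commute)
          also have "\<dots> = (\<integral>\<^sup>+x\<in>?B. TF x ennpowr q \<partial>U)"
            unfolding U_def by (rule nn_integral_density[symmetric]) measurable
          finally have 1: "(\<integral>\<^sup>+x. (TF x * ennreal (w' x) * indicator ?B x) ennpowr q \<partial>lborel) < \<infinity>"
            using ball_fin[of m] by simp
          have "(\<integral>\<^sup>+x. (ennreal (w' x powr (- 1)) * indicator ?B x) ennpowr q' \<partial>lborel) \<le> (\<integral>\<^sup>+x. indicator ?B x + ennreal (w' x powr (- p')) * indicator ?B x \<partial>lborel)"
          proof (intro nn_integral_mono)
            fix x
            have "w' x powr (- q') \<le> 1 + w' x powr (- p')"
            proof (cases "1 \<le> w' x")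
              case True
              then have "w' x powr (- q') \<le> w' x powr 0" using q' by (intro powr_mono) auto
              then show ?thesis using w'pos[of x] by (simp add: add_increasing2)
            next
              case False
              then have "w' x powr (- q') \<le> w' x powr (- p')" using q' w'pos[of x] by (intro powr_mono') auto
              then show ?thesis by simp
            qed
            then have "ennreal (w' x powr (- q')) \<le> 1 + ennreal (w' x powr (- p'))"
              by (simp add: ennreal_leI flip: ennreal_plus ennreal_1)
            moreover have "ennreal (w' x powr (- 1)) ennpowr q' = ennreal (w' x powr (- q'))"
              using q'(2) by (subst ennpowr_ennreal') (simp_all only: powr_ge_zero powr_powr mult_minus1)
            ultimately show "(ennreal (w' x powr (- 1)) * indicator ?B x) ennpowr q' \<le> indicator ?B x + ennreal (w' x powr (- p')) * indicator ?B x"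
              using q' by (auto simp: indicator_def)
          qed
          also have "\<dots> = emeasure lborel ?B + (\<integral>\<^sup>+x\<in>?B. ennreal (w' x powr (- p')) \<partial>lborel)"
            by (subst nn_integral_add) auto
          also have "\<dots> < \<infinity>" using finV[of 0 "real m"] emeasure_lborel_ball_finite[of "0::'a" "real m"] by (simp add: p'_def)
          finally have 2: "(\<integral>\<^sup>+x. (ennreal (w' x powr (- 1)) * indicator ?B x) ennpowr q' \<partial>lborel) < \<infinity>" .
          show ?thesis using 1 2 q0 q'(2) by (simp add: ennreal_mult_less_top ennpowr_less_top_iff)
        qed
        finally show ?thesis .
      qed
      have "AE x in lborel. \<forall>m::nat. TF x * indicator (ball 0 (real m)) x \<noteq> \<infinity>"
        unfolding AE_all_countable
      proof
        fix m :: nat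
        show "AE x in lborel. TF x * indicator (ball 0 (real m)) x \<noteq> \<infinity>"
          using TF_loc[of m] by (intro nn_integral_PInf_AE) auto
      qed
      then have TF_fin: "AE x in lborel. TF x < \<infinity>"
      proof eventually_elim
        case (elim x)
        obtain m :: nat where "norm x < real m" using reals_Archimedean2 by blast
        then show ?case using elim[rule_format, of m] by (simp add: less_top)
      qed
      have "AE x in lborel. integrable lebesgue (commutator_integrand \<gamma> b f x)"
        using bb' TF_fin
      proof eventually_elim
        case (elim x)
        have "(\<integral>\<^sup>+y. ennreal (norm (commutator_integrand \<gamma> b f x y)) \<partial>lebesgue) = (\<integral>\<^sup>+y. ennreal (norm (commutator_integrand \<gamma> b' f' x y)) \<partial>lebesgue)"
          using ci_AE[OF elim(1)] by (intro nn_integral_cong_AE) auto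
        also have "\<dots> = TF x" by (simp add: nn_integral_completion kernel_int)
        finally show ?case using elim(2) ci_meas by (intro integrableI_bounded) auto
      qed
      then have int: "AE x in lebesgue. integrable lebesgue (commutator_integrand \<gamma> b f x)" by (rule AE_completion)
      have frac_meas: "frac_commutator \<gamma> b f \<in> borel_measurable lebesgue"
      proof -
        have "h \<in> borel_measurable lebesgue" using hm by (intro measurable_completion) simp
        moreover have "AE x in lebesgue. h x = frac_commutator \<gamma> b f x"
          using frac_AE by (intro AE_completion) auto
        ultimately show ?thesis by (rule borel_measurable_AE)
      qed
      have "locally_integrable (frac_commutator \<gamma> b f)"
        unfolding locally_integrable_def
      proof (intro allI impI)
        fix S :: "'a set" assume S: "compact S"
        then obtain B where B: "\<And>x. x \<in> S \<Longrightarrow> norm x \<le> B" using compact_imp_bounded bounded_iff by metis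
        obtain m :: nat where "B < real m" using reals_Archimedean2 by blast
        then have sub: "S \<subseteq> ball 0 (real m)" using B by force
        have "S \<in> sets lebesgue" using S by (simp add: compact_imp_closed)
        then have "(\<lambda>x. indicat_real S x *\<^sub>R frac_commutator \<gamma> b f x) \<in> borel_measurable lebesgue"
          using frac_meas by (intro borel_measurable_scaleR borel_measurable_indicator) auto
        moreover have "(\<integral>\<^sup>+x. ennreal (norm (indicat_real S x *\<^sub>R frac_commutator \<gamma> b f x)) \<partial>lebesgue) < \<infinity>"
        proof -
          have "(\<integral>\<^sup>+x. ennreal (norm (indicat_real S x *\<^sub>R frac_commutator \<gamma> b f x)) \<partial>lborel) \<le> (\<integral>\<^sup>+x. ennreal \<kappa> * (TF x * indicator (ball 0 (real m)) x) \<partial>lborel)"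
            using frac_AE
          proof (intro nn_integral_mono_AE, eventually_elim)
            case (elim x)
            show ?case
            proof (cases "x \<in> S")
              case True
              then have "x \<in> ball 0 (real m)" using sub by blast
              then show ?thesis using True elim h_le[of x] by simp
            qed simp
          qed
          also have "\<dots> = ennreal \<kappa> * (\<integral>\<^sup>+x\<in>ball 0 (real m). TF x \<partial>lborel)" by (rule nn_integral_cmult) measurable
          also have "\<dots> < \<infinity>" using TF_loc[of m] by (simp add: ennreal_mult_less_top)
          finally show ?thesis by (simp add: nn_integral_completion)
        qed
        ultimately show "set_integrable lebesgue S (frac_commutator \<gamma> b f)"
          unfolding set_integrable_def by (rule integrableI_bounded)
      qed
      moreover have "amalgam_norm q s \<beta> (\<lambda>x. w x powr q) (\<lambda>x. w x powr q) \<mu> (frac_commutator \<gamma> b f) < \<infinity>"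
        by (rule order.strict_trans1[OF norm_bound]) (use X in \<open>simp add: ennreal_mult_less_top\<close>)
      ultimately show ?thesis using int by (simp add: amalgam_space_def)
    qed
    show ?thesis using norm_bound nontrivial unfolding X_def by blast
  qed
  have "0 < C' / (1 - \<theta>)" using C' \<theta> by simp
  then show ?thesis using result by blast
qed

theorem theorem2p3:
  fixes \<gamma> p q \<alpha> \<beta> :: real
    and s :: ennreal
    and w \<mu> :: "real ^ 'n \<Rightarrow> real"
    and b :: "real ^ 'n \<Rightarrow> 'b::{real_normed_field,euclidean_space}"
  assumes "0 < \<gamma>" and "\<gamma> < real CARD('n)"
    and "1 < p" and "p < real CARD('n) / \<gamma>"
    and "1 / q = 1 / p - \<gamma> / real CARD('n)"
    and "w \<in> Apq p q"
    and "p \<le> \<alpha>" and "\<alpha> < \<beta>" and "ennreal \<beta> < s"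
    and "1 / \<beta> = 1 / \<alpha> - \<gamma> / real CARD('n)"
    and "\<mu> \<in> doubling_weights"
    and "b \<in> BMO"
  shows "\<exists>C>0. \<forall>f \<in> amalgam_space p s \<alpha> (\<lambda>x. w x powr p) (\<lambda>x. w x powr q) \<mu>.
    amalgam_norm q s \<beta> (\<lambda>x. w x powr q) (\<lambda>x. w x powr q) \<mu> (frac_commutator \<gamma> b f)
      \<le> ennreal C * amalgam_norm p s \<alpha> (\<lambda>x. w x powr p) (\<lambda>x. w x powr q) \<mu> f \<and>
    (\<not> (AE y in lebesgue. \<mu> y = 0) \<longrightarrow>
      (AE x in lebesgue. integrable lebesgue (commutator_integrand \<gamma> b f x)) \<and>
      frac_commutator \<gamma> b f
        \<in> amalgam_space q s \<beta> (\<lambda>x. w x powr q) (\<lambda>x. w x powr q) \<mu>)"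
proof (rule commutator_amalgam_bound)
  show "weight \<mu>" using assms(11) by (simp add: doubling_weights_def)
qed (use assms in simp_all)

end
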